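(* Assume $z$ is an $n$-vertex with $n\ge4$. Then the $A$-module $b_1A+b_2A$ has a rhombus filtration with three rhombus quotients. Explicitly, there is an exact sequence $$0\to b_1d_1A\to b_1A+b_2A\to\bar b_nb_1A\oplus\bar b_3b_2A\to0.$$
   Context: Tiling. Let $\mathrm p:\mathbb R^3\to\mathbb R^2$ be linear with $\mathrm p(\mathbf e_1)=(-\frac{\sqrt3}{2},-\frac12)$, $\mathrm p(\mathbf e_2)=(\frac{\sqrt3}{2},-\frac12)$, $\mathrm p(\mathbf e_3)=(0,1)$. For $\{i,j,k\}=\{1,2,3\}$ let $R_k=\{\lambda \mathrm p(\mathbf e_i)+\mu \mathrm p(\mathbf e_j):0\le\lambda,\mu\le1\}$. Let $\mathbf M=\begin{pmatrix}0&1&0\\0&0&1\\1&-1&-1\end{pmatrix}$ with columns $\mathbf c_1,\mathbf c_2,\mathbf c_3$. A pair $(z,k)$, $z\in\mathbb Z^3$, represents the rhombus $\mathrm p(z)+R_k$. Put $\mathcal P_0=\{(0,1),(0,2),(0,3)\}$ and $\mathcal P_{i+1}=\bigcup_{(z,k)\in\mathcal P_i}\mathcal R(z,k)$, where $\mathcal R(z,1)=\{(\mathbf Mz,3),(\mathbf Mz+\mathbf c_2,1),(\mathbf Mz+\mathbf c_3,2)\}$, $\mathcal R(z,2)=\{(\mathbf Mz,1)\}$, $\mathcal R(z,3)=\{(\mathbf Mz,2)\}$. Then $\mathcal P_i\subset\mathcal P_{i+1}$ and $\bigcup_i\mathcal P_i$ is a tiling of the plane by rhombi (the Rauzy tiling).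 Algebra $A$. Let $Q$ be the quiver whose vertices are the vertices of the Rauzy tiling, with each edge replaced by two arrows in opposite directions; $\bar b$ is the arrow opposite to $b$. Let $k$ be a field. Paths are composed left to right and modules are right modules. The Rauzy algebra is $A=kQ/I$, where $I$ is generated by: (1) a path of length two along two distinct edges that are not both edges of one rhombus is zero; (2) the two paths of length two joining opposite vertices of a rhombus (along its boundary) are equal; (3) for each vertex $z$, $s_1(z)D_1(z)=s_2(z)D_2(z)=s_3(z)D_3(z)$, where $D_a(z)=L_a^+(z)-L_a^-(z)$, $L_a^{\pm}(z)=g\bar g$ if there is an arrow $g:z\to z\pm\mathrm p(\mathbf e_a)$ and $L_a^\pm(z)=0$ otherwise, and $s_a(z)\in\{\pm1\}$ is a fixed choice of signs such that whenever $z,x$ are joined by an edge parallel to $\mathrm p(\mathbf e_a)$, $s_a(x)=-s_a(z)$ and $s_c(x)=s_c(z)$ for $c\ne a$ (such signs are determined by their values at one vertex). $S_z$ is the simple module at $z$. Local notation. An $n$-vertex is a vertex $z$ with exactly $n$ edges. Its neighbours are labelled $x_1,\dots,x_n$ counterclockwise (starting anywhere; indices mod $n$), $b_j:z\to x_j$ is the corresponding arrow, $y_j$ is the fourth vertex of the rhombus containing $z,x_j,x_{j+1}$, and $d_j:x_j\to y_j$, $c_j:x_{j+1}\to y_j$ are the corresponding arrows. Rhombus modules. For a rhombus of the tiling with opposite vertices $z,y$ and remaining vertices $u,v$, the rhombus module $R^y_z$ is the (unique up to isomorphism) $A$-module with top $S_y$, socle $S_z$ and $\mathrm{rad}/\mathrm{soc}\cong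 S_u\oplus S_v$; explicitly $R^y_z=pA$ with $p$ the path of length two from $z$ to $y$ around the rhombus. A module $M$ has a rhombus filtration (with $r$ quotients) if there are submodules $0=M_0\subset M_1\subset\dots\subset M_r=M$ with each $M_j/M_{j-1}$ a rhombus module. *)

theory Defs
  imports
    "HOL-Analysis.Analysis"
    "HOL-Algebra.QuotRing"
    "HOL-Library.Poly_Mapping"
    "Graph_Theory.Arc_Walk"
begin

section \<open>The Rauzy tiling\<close>

type_synonym point = "real^2"

definition proj :: "real^3 \<Rightarrow> point" where
  "proj v = v$1 *\<^sub>R vector [- (sqrt 3 / 2), - (1/2)] + v$2 *\<^sub>R vector [sqrt 3 / 2, - (1/2)]
    + v$3 *\<^sub>R vector [0, 1]"

definition real_vec :: "int^3 \<Rightarrow> real^3" where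
  "real_vec z = (\<chi> i. of_int (z$i))"

definition pe :: "3 \<Rightarrow> point" where
  "pe a = proj (axis a 1)"

text \<open>A pair \<open>(z, k)\<close> represents the rhombus with base point \<open>proj z\<close> spanned by the two
  vectors \<open>pe i\<close>, \<open>pe j\<close> with \<open>i, j \<noteq> k\<close>.\<close>

type_synonym tile = "(int^3) \<times> 3"

definition corners :: "tile \<Rightarrow> point set" where
  "corners t = {proj (real_vec (fst t)) + l *\<^sub>R pe i + m *\<^sub>R pe j | l m i j.
      {i, j, snd t} = UNIV \<and> l \<in> {0, 1} \<and> m \<in> {0, 1}}"

text \<open>The condition \<open>a \<noteq> k\<close> matters: since \<open>pe 1 + pe 2 + pe 3 = 0\<close>, the short diagonal of a
  rhombus of type \<open>k\<close> is a translate of \<open>pe k\<close>.\<close>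

definition tile_edges :: "tile \<Rightarrow> point set set" where
  "tile_edges t = {{u, u + pe a} | u a. a \<noteq> snd t \<and> u \<in> corners t \<and> u + pe a \<in> corners t}"

definition subst_matrix :: "int^3^3" where
  "subst_matrix = vector [vector [0, 1, 0], vector [0, 0, 1], vector [1, -1, -1]]"

definition subst_tile :: "tile \<Rightarrow> tile set" where
  "subst_tile t = (let z = fst t; k = snd t; w = subst_matrix *v z in
     if k = 1 then {(w, 3), (w + column 2 subst_matrix, 1), (w + column 3 subst_matrix, 2)}
     else if k = 2 then {(w, 1)}
     else {(w, 2)})"

primrec patch :: "nat \<Rightarrow> tile set" where
  "patch 0 = {(0, 1), (0, 2), (0, 3)}"
| "patch (Suc i) = (\<Union>t\<in>patch i. subst_tile t)"

definition rauzy_tiling :: "tile set" where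
  "rauzy_tiling = (\<Union>i. patch i)"

definition rauzy_vertices :: "point set" where
  "rauzy_vertices = (\<Union>t\<in>rauzy_tiling. corners t)"

definition rauzy_edges :: "point set set" where
  "rauzy_edges = (\<Union>t\<in>rauzy_tiling. tile_edges t)"

text \<open>\<open>x, u, w, v\<close> are the corners of a rhombus of the tiling, listed along its boundary; thus
  \<open>x, w\<close> are opposite, and so are \<open>u, v\<close>. The four points are distinct because a rhombus has
  four corners.\<close>

definition rhombus :: "point \<Rightarrow> point \<Rightarrow> point \<Rightarrow> point \<Rightarrow> bool" where
  "rhombus x u w v \<longleftrightarrow> (\<exists>t\<in>rauzy_tiling. corners t = {x, u, w, v} \<and>
      {x, u} \<in> tile_edges t \<and> {u, w} \<in> tile_edges t \<and>
      {w, v} \<in> tile_edges t \<and> {v, x} \<in> tile_edges t)"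

definition n_vertex :: "nat \<Rightarrow> point \<Rightarrow> bool" where
  "n_vertex n z \<longleftrightarrow> z \<in> rauzy_vertices \<and> card {e \<in> rauzy_edges. z \<in> e} = n"

text \<open>Indices are read modulo \<open>n\<close>, so that \<open>x 0 = x n\<close>. The function \<open>\<theta>\<close> gives arguments of
  the vectors \<open>x j - z\<close>.\<close>

definition local_labels :: "nat \<Rightarrow> point \<Rightarrow> (nat \<Rightarrow> point) \<Rightarrow> (nat \<Rightarrow> point) \<Rightarrow> bool" where
  "local_labels n z x y \<longleftrightarrow>
     (\<forall>j. x (j + n) = x j \<and> y (j + n) = y j) \<and>
     bij_betw x {1..n} {w. {z, w} \<in> rauzy_edges} \<and>
     (\<exists>\<theta> :: nat \<Rightarrow> real. strict_mono_on {1..n} \<theta> \<and> \<theta> n < \<theta> 1 + 2 * pi \<and>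
        (\<forall>j\<in>{1..n}. x j - z = norm (x j - z) *\<^sub>R vector [cos (\<theta> j), sin (\<theta> j)])) \<and>
     (\<forall>j. rhombus z (x j) (y j) (x (j + 1)))"

section \<open>Path algebras and quotients\<close>

text \<open>A path is a starting vertex together with the list of its arrows; \<open>(v, [])\<close> is the trivial
  path at \<open>v\<close>. Paths are composed from left to right.\<close>

type_synonym ('v, 'e) qpath = "'v \<times> 'e list"

definition qpaths :: "('v, 'e) pre_digraph \<Rightarrow> ('v, 'e) qpath set" where
  "qpaths Q = {(u, p). \<exists>v. pre_digraph.awalk Q u p v}"

definition path_mult :: "('v, 'e) pre_digraph \<Rightarrow> (('v, 'e) qpath \<Rightarrow>\<^sub>0 'k::field) \<Rightarrow>
    (('v, 'e) qpath \<Rightarrow>\<^sub>0 'k) \<Rightarrow> (('v, 'e) qpath \<Rightarrow>\<^sub>0 'k)" where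
  "path_mult Q f g = (\<Sum>(u, p)\<in>Poly_Mapping.keys f. \<Sum>(v, q)\<in>Poly_Mapping.keys g.
     if pre_digraph.awlast Q u p = v
     then Poly_Mapping.single (u, p @ q)
       (Poly_Mapping.lookup f (u, p) * Poly_Mapping.lookup g (v, q)) else 0)"

text \<open>The path algebra of a quiver with infinitely many vertices has no identity element, hence
  the field \<open>one\<close> carries no information here and in the records below.\<close>

definition path_algebra :: "('v, 'e) pre_digraph \<Rightarrow> (('v, 'e) qpath \<Rightarrow>\<^sub>0 'k::field) ring" where
  "path_algebra Q = \<lparr>carrier = {f. Poly_Mapping.keys f \<subseteq> qpaths Q},
     mult = path_mult Q, one = undefined, zero = 0, add = (+)\<rparr>"

text \<open>The library's \<open>genideal\<close> quantifies over ideals of rings with identity and is not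
  applicable. An ideal of a path algebra in the present sense is automatically closed under
  scalars, because these can be absorbed into the trivial paths.\<close>

definition two_sided_ideal :: "'a set \<Rightarrow> 'a ring \<Rightarrow> bool" where
  "two_sided_ideal I R \<longleftrightarrow> additive_subgroup I R \<and>
     (\<forall>a\<in>I. \<forall>r\<in>carrier R. r \<otimes>\<^bsub>R\<^esub> a \<in> I \<and> a \<otimes>\<^bsub>R\<^esub> r \<in> I)"

definition ideal_gen :: "'a ring \<Rightarrow> 'a set \<Rightarrow> 'a set" where
  "ideal_gen R S = \<Inter>{I. two_sided_ideal I R \<and> S \<subseteq> I}"

section \<open>Right modules over algebras with local units\<close>

text \<open>As in the library's record for left modules, the fields \<open>mult\<close> and \<open>one\<close> are unused.\<close>

record ('a, 'm) rmod = "'m ring" +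
  ract :: "'m \<Rightarrow> 'a \<Rightarrow> 'm" (infixl \<open>\<cdot>\<index>\<close> 70)

locale right_module = M?: abelian_group M for A :: "'a ring" and M :: "('a, 'm) rmod" (structure) +
  assumes ract_closed: "m \<in> carrier M \<Longrightarrow> a \<in> carrier A \<Longrightarrow> m \<cdot> a \<in> carrier M"
    and ract_add_left: "m \<in> carrier M \<Longrightarrow> m' \<in> carrier M \<Longrightarrow> a \<in> carrier A \<Longrightarrow>
      (m \<oplus> m') \<cdot> a = m \<cdot> a \<oplus> m' \<cdot> a"
    and ract_add_right: "m \<in> carrier M \<Longrightarrow> a \<in> carrier A \<Longrightarrow> a' \<in> carrier A \<Longrightarrow>
      m \<cdot> (a \<oplus>\<^bsub>A\<^esub> a') = m \<cdot> a \<oplus> m \<cdot> a'"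
    and ract_assoc: "m \<in> carrier M \<Longrightarrow> a \<in> carrier A \<Longrightarrow> a' \<in> carrier A \<Longrightarrow>
      m \<cdot> (a \<otimes>\<^bsub>A\<^esub> a') = (m \<cdot> a) \<cdot> a'"
    and ract_unital: "m \<in> carrier M \<Longrightarrow> \<exists>a\<in>carrier A. m \<cdot> a = m"
      \<comment> \<open>equivalent to \<open>MA = M\<close> when \<open>A\<close> has local units\<close>

definition submod :: "'a ring \<Rightarrow> 'm set \<Rightarrow> ('a, 'm) rmod \<Rightarrow> bool" where
  "submod A N M \<longleftrightarrow> additive_subgroup N M \<and> (\<forall>m\<in>N. \<forall>a\<in>carrier A. m \<cdot>\<^bsub>M\<^esub> a \<in> N)"

definition restrict_mod :: "('a, 'm) rmod \<Rightarrow> 'm set \<Rightarrow> ('a, 'm) rmod" where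
  "restrict_mod M N = M\<lparr>carrier := N\<rparr>"

definition quot_mod :: "('a, 'm) rmod \<Rightarrow> 'm set \<Rightarrow> ('a, 'm set) rmod" where
  "quot_mod M N = \<lparr>carrier = a_rcosets\<^bsub>M\<^esub> N, mult = undefined, one = undefined, zero = N,
     add = set_add M, ract = (\<lambda>X a. \<Union>m\<in>X. N +>\<^bsub>M\<^esub> (m \<cdot>\<^bsub>M\<^esub> a))\<rparr>"

definition direct_sum :: "('a, 'm) rmod \<Rightarrow> ('a, 'n) rmod \<Rightarrow> ('a, 'm \<times> 'n) rmod" where
  "direct_sum M N = \<lparr>carrier = carrier M \<times> carrier N, mult = undefined, one = undefined,
     zero = (\<zero>\<^bsub>M\<^esub>, \<zero>\<^bsub>N\<^esub>), add = (\<lambda>(m, n) (m', n'). (m \<oplus>\<^bsub>M\<^esub> m', n \<oplus>\<^bsub>N\<^esub> n')),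
     ract = (\<lambda>(m, n) a. (m \<cdot>\<^bsub>M\<^esub> a, n \<cdot>\<^bsub>N\<^esub> a))\<rparr>"

definition mod_hom :: "'a ring \<Rightarrow> ('a, 'm) rmod \<Rightarrow> ('a, 'n) rmod \<Rightarrow> ('m \<Rightarrow> 'n) set" where
  "mod_hom A M N = {f \<in> hom (add_monoid M) (add_monoid N).
     \<forall>m\<in>carrier M. \<forall>a\<in>carrier A. f (m \<cdot>\<^bsub>M\<^esub> a) = f m \<cdot>\<^bsub>N\<^esub> a}"

definition mod_iso :: "'a ring \<Rightarrow> ('a, 'm) rmod \<Rightarrow> ('a, 'n) rmod \<Rightarrow> bool" where
  "mod_iso A M N \<longleftrightarrow> (\<exists>f\<in>mod_hom A M N. bij_betw f (carrier M) (carrier N))"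

text \<open>Exactness of \<open>0 \<rightarrow> L \<rightarrow> M \<rightarrow> N \<rightarrow> 0\<close> with maps \<open>f\<close> and \<open>g\<close>.\<close>

definition short_exact :: "'a ring \<Rightarrow> ('a, 'l) rmod \<Rightarrow> ('a, 'm) rmod \<Rightarrow> ('a, 'n) rmod \<Rightarrow>
    ('l \<Rightarrow> 'm) \<Rightarrow> ('m \<Rightarrow> 'n) \<Rightarrow> bool" where
  "short_exact A L M N f g \<longleftrightarrow> f \<in> mod_hom A L M \<and> g \<in> mod_hom A M N \<and>
     inj_on f (carrier L) \<and> f ` carrier L = a_kernel M N g \<and> g ` carrier M = carrier N"

definition maximal_submod :: "'a ring \<Rightarrow> 'm set \<Rightarrow> ('a, 'm) rmod \<Rightarrow> bool" where
  "maximal_submod A N M \<longleftrightarrow> submod A N M \<and> N \<noteq> carrier M \<and>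
     (\<forall>N'. submod A N' M \<and> N \<subseteq> N' \<longrightarrow> N' = N \<or> N' = carrier M)"

definition simple_submod :: "'a ring \<Rightarrow> 'm set \<Rightarrow> ('a, 'm) rmod \<Rightarrow> bool" where
  "simple_submod A N M \<longleftrightarrow> submod A N M \<and> N \<noteq> {\<zero>\<^bsub>M\<^esub>} \<and>
     (\<forall>N'. submod A N' M \<and> N' \<subseteq> N \<longrightarrow> N' = {\<zero>\<^bsub>M\<^esub>} \<or> N' = N)"

definition radical :: "'a ring \<Rightarrow> ('a, 'm) rmod \<Rightarrow> 'm set" where
  "radical A M = carrier M \<inter> \<Inter>{N. maximal_submod A N M}"

text \<open>The sum of all simple submodules, as the least submodule containing them.\<close>

definition socle :: "'a ring \<Rightarrow> ('a, 'm) rmod \<Rightarrow> 'm set" where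
  "socle A M = \<Inter>{N. submod A N M \<and> (\<forall>S. simple_submod A S M \<longrightarrow> S \<subseteq> N)}"

definition regular_mod :: "'a ring \<Rightarrow> ('a, 'a) rmod" where
  "regular_mod A = \<lparr>carrier = carrier A, mult = undefined, one = undefined, zero = \<zero>\<^bsub>A\<^esub>,
     add = add A, ract = mult A\<rparr>"

definition principal_right :: "'a ring \<Rightarrow> 'a \<Rightarrow> 'a set" where
  "principal_right A b = {b \<otimes>\<^bsub>A\<^esub> a | a. a \<in> carrier A}"

definition principal_mod :: "'a ring \<Rightarrow> 'a \<Rightarrow> ('a, 'a) rmod" where
  "principal_mod A b = restrict_mod (regular_mod A) (principal_right A b)"

section \<open>The Rauzy algebra\<close>

text \<open>An edge with endpoints \<open>u\<close>, \<open>w\<close> gives the two arrows \<open>(u, w)\<close> and \<open>(w, u)\<close>.\<close>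

definition rauzy_quiver :: "(point, point \<times> point) pre_digraph" where
  "rauzy_quiver = \<lparr>verts = rauzy_vertices, arcs = {(u, w). {u, w} \<in> rauzy_edges},
     tail = fst, head = snd\<rparr>"

type_synonym 'k rauzy_paths = "(point, point \<times> point) qpath \<Rightarrow>\<^sub>0 'k"

definition path2 :: "point \<Rightarrow> point \<Rightarrow> point \<Rightarrow> 'k::field rauzy_paths" where
  "path2 x u w = Poly_Mapping.single (x, [(x, u), (u, w)]) 1"

definition out_back :: "point \<Rightarrow> point \<Rightarrow> 'k::field rauzy_paths" where
  "out_back z w = (if {z, w} \<in> rauzy_edges then path2 z w z else 0)"

definition rauzy_D :: "3 \<Rightarrow> point \<Rightarrow> 'k::field rauzy_paths" where
  "rauzy_D a z = out_back z (z + pe a) - out_back z (z - pe a)"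

definition sign_choice :: "(3 \<Rightarrow> point \<Rightarrow> 'k::field) \<Rightarrow> bool" where
  "sign_choice s \<longleftrightarrow> (\<forall>a. \<forall>z\<in>rauzy_vertices. s a z \<in> {1, -1}) \<and>
     (\<forall>z x a. {z, x} \<in> rauzy_edges \<and> (x = z + pe a \<or> x = z - pe a) \<longrightarrow>
        s a x = - s a z \<and> (\<forall>c. c \<noteq> a \<longrightarrow> s c x = s c z))"

definition signed_D :: "(3 \<Rightarrow> point \<Rightarrow> 'k::field) \<Rightarrow> 3 \<Rightarrow> point \<Rightarrow> 'k rauzy_paths" where
  "signed_D s a z = Poly_Mapping.map ((*) (s a z)) (rauzy_D a z)"

inductive_set rauzy_relations :: "(3 \<Rightarrow> point \<Rightarrow> 'k::field) \<Rightarrow> 'k rauzy_paths set"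
  for s :: "3 \<Rightarrow> point \<Rightarrow> 'k" where
  zero_path: "{x, u} \<in> rauzy_edges \<Longrightarrow> {u, w} \<in> rauzy_edges \<Longrightarrow> x \<noteq> w \<Longrightarrow>
    \<not> (\<exists>t\<in>rauzy_tiling. {x, u} \<in> tile_edges t \<and> {u, w} \<in> tile_edges t) \<Longrightarrow>
    path2 x u w \<in> rauzy_relations s"
| commutative_square: "rhombus x u w v \<Longrightarrow> path2 x u w - path2 x v w \<in> rauzy_relations s"
| loops: "z \<in> rauzy_vertices \<Longrightarrow> signed_D s a z - signed_D s c z \<in> rauzy_relations s"

definition rauzy_ideal :: "(3 \<Rightarrow> point \<Rightarrow> 'k::field) \<Rightarrow> 'k rauzy_paths set" where
  "rauzy_ideal s = ideal_gen (path_algebra rauzy_quiver) (rauzy_relations s)"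

definition rauzy_algebra :: "(3 \<Rightarrow> point \<Rightarrow> 'k::field) \<Rightarrow> 'k rauzy_paths set ring" where
  "rauzy_algebra s = path_algebra rauzy_quiver Quot rauzy_ideal s"

text \<open>The class in the algebra of the arrow from \<open>u\<close> to \<open>w\<close>.\<close>

definition arrow :: "(3 \<Rightarrow> point \<Rightarrow> 'k::field) \<Rightarrow> point \<Rightarrow> point \<Rightarrow> 'k rauzy_paths set" where
  "arrow s u w = rauzy_ideal s +>\<^bsub>path_algebra rauzy_quiver\<^esub> Poly_Mapping.single (u, [(u, w)]) 1"

text \<open>The one-dimensional module on which the trivial path at \<open>z\<close> acts as the identity and all
  other paths act as zero. The relations only involve paths of positive length, so the choice of
  a representative is immaterial.\<close>

definition simple_mod :: "point \<Rightarrow> ('k::field rauzy_paths set, 'k) rmod" where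
  "simple_mod z = \<lparr>carrier = UNIV, mult = undefined, one = undefined, zero = 0, add = (+),
     ract = (\<lambda>c X. c * Poly_Mapping.lookup (SOME f. f \<in> X) (z, []))\<rparr>"

section \<open>Rhombus modules and filtrations\<close>

text \<open>\<open>M\<close> is the rhombus module with top at \<open>y\<close> and socle at \<open>z\<close> for a rhombus with corners
  \<open>z, u, y, v\<close>.\<close>

definition is_rhombus_module_of :: "(3 \<Rightarrow> point \<Rightarrow> 'k::field) \<Rightarrow> point \<Rightarrow> point \<Rightarrow> point \<Rightarrow> point \<Rightarrow>
    ('k rauzy_paths set, 'm) rmod \<Rightarrow> bool" where
  "is_rhombus_module_of s z u y v M \<longleftrightarrow>
    (let A = rauzy_algebra s; R = radical A M; S = socle A M in
       rhombus z u y v \<and> right_module A M \<and>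
       mod_iso A (quot_mod M R) (simple_mod y) \<and>
       mod_iso A (restrict_mod M S) (simple_mod z) \<and>
       S \<subseteq> R \<and>
       mod_iso A (quot_mod (restrict_mod M R) S) (direct_sum (simple_mod u) (simple_mod v)))"

definition rhombus_module ::
    "(3 \<Rightarrow> point \<Rightarrow> 'k::field) \<Rightarrow> ('k rauzy_paths set, 'm) rmod \<Rightarrow> bool" where
  "rhombus_module s M \<longleftrightarrow> (\<exists>z u y v. is_rhombus_module_of s z u y v M)"

definition has_rhombus_filtration ::
    "(3 \<Rightarrow> point \<Rightarrow> 'k::field) \<Rightarrow> ('k rauzy_paths set, 'm) rmod \<Rightarrow> nat \<Rightarrow> bool" where
  "has_rhombus_filtration s M r \<longleftrightarrow>
    (\<exists>F :: nat \<Rightarrow> 'm set. F 0 = {\<zero>\<^bsub>M\<^esub>} \<and> F r = carrier M \<and>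
       (\<forall>j\<le>r. submod (rauzy_algebra s) (F j) M) \<and>
       (\<forall>j<r. F j \<subseteq> F (Suc j) \<and>
          rhombus_module s (quot_mod (restrict_mod M (F (Suc j))) (F j))))"

end

theory Submission
  imports Defs
begin

text \<open>
  Measuring the height of a lattice point by the left eigenvector \<open>v\<close> of the matrix \<open>M\<close> identifies the
  tiling with a stepped surface: \<open>(z, k)\<close> is a tile iff the height of \<open>z\<close> lies in \<open>[0, v_k)\<close>. That all
  such pairs occur follows from the contraction of \<open>M\<close> inverse along the plane of height zero, which
  leaves finitely many cases. The vertices of the tiling are therefore the lattice points in a slab,
  the edges are the unit steps that stay in the slab, and the first two kinds of relations say that
  steps along different axes commute and that a step cannot be repeated.

  Left multiplication by \<open>x_n \<rightarrow> z\<close> kills \<open>b_2\<close>, left multiplication by \<open>x_3 \<rightarrow> z\<close> kills \<open>b_1\<close>, and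
  both kill \<open>b_1 d_1\<close>. On \<open>b_1 A\<close> modulo \<open>b_1 d_1 A\<close> and on \<open>b_2 A\<close> modulo \<open>b_1 d_1 A\<close>, respectively, they
  are injective with a rhombus module as image. The relations bound these modules from above by the
  four paths along a rhombus. That these paths are independent amounts to the closed path around
  the rhombus being nonzero in the algebra, which is detected by a linear form on closed paths of
  length four modelled on the intersection form of a toric surface.
\<close>

section \<open>The Rauzy tiling as a stepped surface\<close>

text \<open>The obstacle is the lower bound. Relations readily show that a word is zero, but that
  the path around a rhombus survives needs an invariant, and no basis of the algebra is at hand. One
  linear form suffices: the four candidate basis elements of \<open>pA\<close>, for a path
  \<open>p\<close> along a rhombus, are completed to the full closed path by four different
  remainders, so one nonzero value separates all of them. The form comes from the loop relations.
  Once the signs are absorbed they say that the three differences of opposite loops agree, and these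
  are the linear equivalences between the torus invariant divisors, because the three projected axis
  vectors have sum zero.

  The hypothesis \<open>n \<ge> 4\<close> enters through one fact: an edge lies in exactly two
  rhombi. The edge to x_2 already has x_1 and x_3 as partners, so x_n, being different from both,
  spans no rhombus with x_2. For three edges x_n would be x_3, and x_n -> z -> x_2 would be a
  nonzero path along a rhombus.\<close>

definition al :: real where
  "al = (SOME a. 543/1000 < a \<and> a < 544/1000 \<and> a^3 + a^2 + a = 1)"

text \<open>\<open>al\<close> is the reciprocal of the tribonacci constant. The intermediate value
  theorem gives a root of the cubic between the two decimals, and evaluation at the end points makes
  the bounds strict. Three digits are enough for every numerical estimate below.\<close>

lemma al: "543/1000 < al" "al < 544/1000" "al^3 + al^2 + al = 1"
proof -
  define f :: "real \<Rightarrow> real" where "f = (\<lambda>a. a^3 + a^2 + a)"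
  have "\<exists>x\<ge>543/1000. x \<le> 544/1000 \<and> f x = 1"
    by (rule IVT') (auto simp: f_def power3_eq_cube power2_eq_square intro!: continuous_intros)
  then obtain a where a: "543/1000 \<le> a" "a \<le> 544/1000" "f a = 1" by blast
  have "f (543/1000) \<noteq> 1" "f (544/1000) \<noteq> 1"
    by (simp_all add: f_def power3_eq_cube power2_eq_square)
  with a(3) have "a \<noteq> 543/1000" "a \<noteq> 544/1000" by blast+
  with a have "\<exists>a. 543/1000 < a \<and> a < 544/1000 \<and> a^3 + a^2 + a = (1::real)"
    by (intro exI[of _ a]) (auto simp: f_def)
  then have "543/1000 < al \<and> al < 544/1000 \<and> al^3 + al^2 + al = 1"
    unfolding al_def by (rule someI_ex)
  then show "543/1000 < al" "al < 544/1000" "al^3 + al^2 + al = 1" by auto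
qed

definition wt :: "3 \<Rightarrow> real" where
  "wt a = (if a = 1 then 1 else if a = 2 then al + al^2 else al)"

lemma wt_simps [simp]: "wt 1 = 1" "wt 2 = al + al^2" "wt 3 = al"
  by (auto simp: wt_def)

lemma wt_pos: "0 < wt a"
  using al by (auto simp: wt_def intro!: add_pos_pos)

lemma wt_le_1: "wt a \<le> 1"
proof -
  have "0 \<le> al^3" using al by simp
  then have "al + al^2 \<le> 1" using al by linarith
  then show ?thesis using al by (auto simp: wt_def)
qed

definition width :: real where
  "width = wt 1 + wt 2 + wt 3"

lemma wt_third: "{a, b, c} = (UNIV :: 3 set) \<Longrightarrow> wt a + wt b + wt c = width"
proof -
  assume u: "{a, b, c} = (UNIV :: 3 set)"
  then have "(1::3) \<in> {a, b, c}" "(2::3) \<in> {a, b, c}" "(3::3) \<in> {a, b, c}" by auto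
  then show ?thesis unfolding width_def by auto
qed

text \<open>The coefficients form the left eigenvector of \<open>subst_matrix\<close> for the eigenvalue \<open>al\<close>.\<close>

definition height :: "int^3 \<Rightarrow> real" where
  "height w = (\<Sum>a\<in>UNIV. wt a * of_int (w$a))"

lemma height_3: "height w = of_int (w$1) + (al + al^2) * of_int (w$2) + al * of_int (w$3)"
  by (simp add: height_def sum_3)

lemma height_add: "height (v + w) = height v + height w"
  by (simp add: height_3 algebra_simps)

lemma height_diff: "height (v - w) = height v - height w"
  by (simp add: height_3 algebra_simps)

lemma height_0 [simp]: "height 0 = 0"
  by (simp add: height_3)

lemma height_axis: "height (axis a c) = wt a * of_int c"
  by (auto simp: height_def axis_def if_distrib if_distribR cong: if_cong)

definition stepped_surface :: "tile set" where
  "stepped_surface = {(z, k). 0 \<le> height z \<and> height z < wt k}"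

lemma subst_matrix_mult: "subst_matrix *v z = vector [z$2, z$3, z$1 - z$2 - z$3]"
  by (simp add: vec_eq_iff forall_3 matrix_vector_mult_def sum_3 subst_matrix_def)

lemma subst_matrix_columns:
  "column 2 subst_matrix = vector [1, 0, -1]" "column 3 subst_matrix = vector [0, 1, -1]"
  by (simp_all add: vec_eq_iff forall_3 column_def subst_matrix_def)

lemma height_subst: "height (subst_matrix *v z) = al * height z"
proof -
  have *: "al * (al * al) = 1 - al - al * al"
    using al(3) by (simp add: power3_eq_cube power2_eq_square)
  have "al * height z = al * z$1 + (al * al + al * (al * al)) * z$2 + al * al * z$3"
    by (simp add: height_3 algebra_simps power2_eq_square)
  also have "\<dots> = al * z$1 + (1 - al) * z$2 + al * al * z$3" unfolding * by simp
  also have "\<dots> = height (subst_matrix *v z)"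
    by (simp add: subst_matrix_mult height_3 algebra_simps power2_eq_square)
  finally show ?thesis by simp
qed

lemma al_powers: "al + al * al + al * (al * al) = 1" "0 < al * al" "0 < al * (al * al)"
  using al by (auto simp: power3_eq_cube power2_eq_square)

text \<open>\<open>subst_matrix\<close> scales heights by \<open>al\<close>, and its columns 2 and 3
  have heights \<open>1 - al\<close> and \<open>al^2\<close>. So [0, 1) of type 1 goes to [0, al) of
  type 3, [1 - al, 1) of type 1 and [al^2, al + al^2) of type 2, while types 2 and 3 go to [0, 1 -
  al) of type 1 and [0, al^2) of type 2. The image intervals partition the target intervals; this
  singles out the predecessor of a tile in the converse inclusion.\<close>

lemma subst_tile_stepped: "t \<in> stepped_surface \<Longrightarrow> subst_tile t \<subseteq> stepped_surface"
proof -
  assume t: "t \<in> stepped_surface"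
  obtain z k where tz: "t = (z, k)" by force
  have z: "0 \<le> height z" "height z < wt k" using t tz by (auto simp: stepped_surface_def)
  have pos: "0 < al" using al by simp
  have m: "0 \<le> al * height z" "al * height z < al * wt k"
    using z pos by auto
  have c: "height (vector [1, 0, -1]) = 1 - al" "height (vector [0, 1, -1]) = al^2"
    by (simp_all add: height_3)
  consider "k = 1" | "k = 2" | "k = 3" using exhaust_3[of k] by auto
  then show ?thesis
  proof cases
    case 1
    then show ?thesis using m al al_powers
      by (auto simp: tz subst_tile_def Let_def stepped_surface_def height_add height_subst
          subst_matrix_columns c power2_eq_square)
  next
    case 2
    then show ?thesis using m al al_powers
      by (auto simp: tz subst_tile_def Let_def stepped_surface_def height_subst
          power2_eq_square algebra_simps)
  next
    case 3
    have "al * height z < al + al * al"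
    proof -
      have "al * height z \<le> height z" using z al by (simp add: mult_left_le_one_le)
      moreover have "height z < al" using z 3 by simp
      moreover have "0 < al * al" using al by simp
      ultimately have "al * height z < al + al * al" by linarith
      then show ?thesis .
    qed
    with 3 show ?thesis using m al al_powers
      by (auto simp: tz subst_tile_def Let_def stepped_surface_def height_subst
          power2_eq_square algebra_simps)
  qed
qed

lemma rauzy_tiling_subset: "rauzy_tiling \<subseteq> stepped_surface"
proof -
  have "patch i \<subseteq> stepped_surface" for i
  proof (induction i)
    case 0
    then show ?case using wt_pos by (auto simp: stepped_surface_def)
  next
    case (Suc i)
    then show ?case using subst_tile_stepped by fastforce
  qed
  then show ?thesis by (auto simp: rauzy_tiling_def)
qed

subsection \<open>Every tile of the stepped surface has the origin among its ancestors\<close>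

abbreviation in_tiling :: "int \<Rightarrow> int \<Rightarrow> int \<Rightarrow> 3 \<Rightarrow> bool" where
  "in_tiling a b c k \<equiv> (vector [a, b, c], k) \<in> rauzy_tiling"

lemma tiling_subst: "t \<in> rauzy_tiling \<Longrightarrow> u \<in> subst_tile t \<Longrightarrow> u \<in> rauzy_tiling"
proof -
  assume "t \<in> rauzy_tiling" "u \<in> subst_tile t"
  then obtain i where "t \<in> patch i" by (auto simp: rauzy_tiling_def)
  then have "u \<in> patch (Suc i)" using \<open>u \<in> subst_tile t\<close> by auto
  then show ?thesis unfolding rauzy_tiling_def by blast
qed

lemma in_tiling_0: "in_tiling 0 0 0 k"
proof -
  have "(vector [0, 0, 0] :: int^3) = 0" by (simp add: vec_eq_iff forall_3)
  moreover have "(0, k) \<in> patch 0" using exhaust_3[of k] by auto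
  ultimately show ?thesis unfolding rauzy_tiling_def by (metis UN_I UNIV_I)
qed

text \<open>\<open>(a + b + c, a, b)\<close> is the preimage of \<open>(a, b, c)\<close> under
  \<open>subst_matrix\<close>. Adding column \<open>j\<close> after the multiplication is the same
  as a unit step along axis \<open>j\<close> before it, hence the entries \<open>a - 1\<close> and
  \<open>b - 1\<close>.\<close>

lemma in_tiling_step:
  "in_tiling (a + b + c) a b 1 \<Longrightarrow> in_tiling a b c 3"
  "in_tiling (a + b + c) a b 2 \<Longrightarrow> in_tiling a b c 1"
  "in_tiling (a + b + c) (a - 1) b 1 \<Longrightarrow> in_tiling a b c 1"
  "in_tiling (a + b + c) a b 3 \<Longrightarrow> in_tiling a b c 2"
  "in_tiling (a + b + c) a (b - 1) 1 \<Longrightarrow> in_tiling a b c 2"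
  by (erule tiling_subst, simp add: subst_tile_def Let_def subst_matrix_mult subst_matrix_columns
      vec_eq_iff forall_3)+

text \<open>The thresholds approximate \<open>al\<close> by decimals. A wrong choice of branch could only
  make \<open>ancestor1\<close> etc. fail, so their soundness does not depend on the approximation.\<close>

fun ancestor1 and ancestor2 and ancestor3 :: "nat \<Rightarrow> int \<Rightarrow> int \<Rightarrow> int \<Rightarrow> bool" where
  "ancestor1 0 a b c \<longleftrightarrow> a = 0 \<and> b = 0 \<and> c = 0"
| "ancestor1 (Suc n) a b c \<longleftrightarrow> a = 0 \<and> b = 0 \<and> c = 0 \<or>
    (if 1000 * a + 839 * b + 544 * c < 456 then ancestor2 n (a + b + c) a b
     else ancestor1 n (a + b + c) (a - 1) b)"
| "ancestor2 0 a b c \<longleftrightarrow> a = 0 \<and> b = 0 \<and> c = 0"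
| "ancestor2 (Suc n) a b c \<longleftrightarrow> a = 0 \<and> b = 0 \<and> c = 0 \<or>
    (if 1000 * a + 839 * b + 544 * c < 295 then ancestor3 n (a + b + c) a b
     else ancestor1 n (a + b + c) a (b - 1))"
| "ancestor3 0 a b c \<longleftrightarrow> a = 0 \<and> b = 0 \<and> c = 0"
| "ancestor3 (Suc n) a b c \<longleftrightarrow> a = 0 \<and> b = 0 \<and> c = 0 \<or> ancestor1 n (a + b + c) a b"

lemma ancestor_in_tiling:
  shows "ancestor1 n a b c \<Longrightarrow> in_tiling a b c 1"
    and "ancestor2 n a b c \<Longrightarrow> in_tiling a b c 2"
    and "ancestor3 n a b c \<Longrightarrow> in_tiling a b c 3"
  by (induction n a b c and n a b c and n a b c
      rule: ancestor1_ancestor2_ancestor3.induct)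
    (auto simp: in_tiling_0 split: if_splits intro: in_tiling_step)

text \<open>For given \<open>b\<close> and \<open>c\<close>, this \<open>a\<close> is the candidate
  with height in [0, 1). The second disjuncts are certificates of exclusion: if
  \<open>(a, b - 1, c)\<close> is a tile, its height is nonnegative, so \<open>(a, b, c)\<close> has
  height at least \<open>wt 2\<close> and carries no tile of type 2; likewise for type 3. In this
  way the evaluation stays within the integers. Depth 15 reaches the origin from every point of the
  box.\<close>

lemma ancestor_box:
  "\<forall>b\<in>set [-3..3]. \<forall>c\<in>set [-5..5]. let a = - ((839 * b + 544 * c) div 1000) in
     ancestor1 15 a b c \<and>
     (ancestor2 15 a b c \<or> ancestor1 15 a (b - 1) c) \<and>
     (ancestor3 15 a b c \<or> ancestor1 15 a b (c - 1))"
  by code_simp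

lemma stepped_surface_box:
  assumes "(vector [a, b, c], k) \<in> stepped_surface" "\<bar>b\<bar> \<le> 3" "\<bar>c\<bar> \<le> 5"
  shows "in_tiling a b c k"
proof -
  let ?h = "\<lambda>a. of_int a + (al + al^2) * of_int b + al * of_int c"
  define a' where "a' = - ((839 * b + 544 * c) div 1000)"
  have "b \<in> set [-3..3]" "c \<in> set [-5..5]" using assms(2,3) by auto
  from bspec[OF bspec[OF ancestor_box this(1)] this(2)]
  have anc: "ancestor1 15 a' b c" "ancestor2 15 a' b c \<or> ancestor1 15 a' (b - 1) c"
    "ancestor3 15 a' b c \<or> ancestor1 15 a' b (c - 1)"
    unfolding Let_def a'_def[symmetric] by (blast, blast, blast)
  have st: "in_tiling a b c k \<Longrightarrow> (vector [a, b, c], k) \<in> stepped_surface" for a b c k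
    using rauzy_tiling_subset by blast
  have h: "0 \<le> ?h a" "?h a < wt k" using assms(1) by (auto simp: stepped_surface_def height_3)
  have h': "0 \<le> ?h a'" "?h a' < 1"
    using st[OF ancestor_in_tiling(1)[OF anc(1)]] by (auto simp: stepped_surface_def height_3)
  \<comment> \<open>Both heights lie in [0, 1) and they differ by the integer
    \<open>a - a'\<close>.\<close>
  have "\<bar>of_int a - of_int a' :: real\<bar> < 1" using h h' wt_le_1[of k] by linarith
  then have a: "a' = a" by linarith
  consider "k = 1" | "k = 2" | "k = 3" using exhaust_3[of k] by auto
  then show ?thesis
  proof cases
    case 1
    then show ?thesis using anc(1) ancestor_in_tiling(1) a by simp
  next
    case 2
    have "\<not> ancestor1 15 a' (b - 1) c"
    proof
      assume "ancestor1 15 a' (b - 1) c"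
      from st[OF ancestor_in_tiling(1)[OF this]] have "al + al^2 \<le> ?h a"
        by (simp add: stepped_surface_def height_3 a algebra_simps)
      with h(2) 2 show False by simp
    qed
    with anc(2) 2 show ?thesis using ancestor_in_tiling(2) a by auto
  next
    case 3
    have "\<not> ancestor1 15 a' b (c - 1)"
    proof
      assume "ancestor1 15 a' b (c - 1)"
      from st[OF ancestor_in_tiling(1)[OF this]] have "al \<le> ?h a"
        by (simp add: stepped_surface_def height_3 a algebra_simps)
      with h(2) 3 show False by simp
    qed
    with anc(3) 3 show ?thesis using ancestor_in_tiling(3) a by auto
  qed
qed

text \<open>This form is multiplied by \<open>al\<close> under the linear map that \<open>subst_matrix\<inverse>\<close> induces on the
  plane \<open>height w = 0\<close> with coordinates \<open>w$2\<close>, \<open>w$3\<close>.\<close>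

definition quad :: "real \<Rightarrow> real \<Rightarrow> real" where
  "quad x y = x^2 + (al + al^2) * x * y + al * y^2"

text \<open>Completing the square splits \<open>4 * al * quad x y\<close> into the square of
  \<open>(al + al^2) * x + 2 * al * y\<close> and a multiple of \<open>x^2\<close>. The exact
  coefficients after multiplication by \<open>(1 - al) / (4 * al)\<close> are about 0.2098 and
  0.3085; 1/5 and 3/10 round them down.\<close>

lemma quad_lower:
  "(1 - al) * quad x y \<ge> ((al + al^2) * x + 2 * al * y)^2 / 5 + 3 * x^2 / 10"
proof -
  define p where "p = al + al^2"
  have p: "0 < p" "p < 84/100"
  proof -
    have "al * al < (544/1000) * (544/1000)" using al by (intro mult_strict_mono) auto
    then show "p < 84/100" using al by (simp add: p_def power2_eq_square)
    show "0 < p" using al by (simp add: p_def add_pos_pos)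
  qed
  have p2: "p * p < (84/100) * (84/100)" using p by (intro mult_strict_mono) auto
  have "(456/1000) * (4 * (543/1000) - (84/100) * (84/100)) \<le> (1 - al) * (4 * al - p * p)"
    using al p2 by (intro mult_mono) auto
  then have c: "12 * al / 10 \<le> (1 - al) * (4 * al - p * p)" using al by simp
  have "4 * al * quad x y = (p * x + 2 * al * y)^2 + (4 * al - p * p) * x^2"
    unfolding quad_def p_def[symmetric] by (simp add: power2_eq_square algebra_simps)
  then have "(1 - al) * (4 * al * quad x y)
      = (1 - al) * ((p * x + 2 * al * y)^2 + (4 * al - p * p) * x^2)" by simp
  then have "4 * al * ((1 - al) * quad x y)
      = (1 - al) * (p * x + 2 * al * y)^2 + ((1 - al) * (4 * al - p * p)) * x^2"
    by (simp only: distrib_left mult_ac)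
  also have "\<dots> \<ge> (4 * al / 5) * (p * x + 2 * al * y)^2 + (12 * al / 10) * x^2"
    using al c by (intro add_mono mult_right_mono) auto
  finally have "4 * al * ((p * x + 2 * al * y)^2 / 5 + 3 * x^2 / 10) \<le> 4 * al * ((1 - al) * quad x y)"
    by (simp add: algebra_simps)
  then show ?thesis using al by (simp add: p_def)
qed

text \<open>For \<open>e = 0\<close> this is the exact contraction on the plane of height zero. A
  tile lies slightly off that plane, and \<open>e\<close> accounts for the deviation.\<close>

lemma quad_step:
  "quad (- ((al + al^2) * x + al * y) + e) x
    = al * quad x y + e^2 - e * ((al + al^2) * x + 2 * al * y)"
  unfolding quad_def by (simp add: power2_eq_square algebra_simps)

text \<open>The two cases are the changes of coordinates that occur in the passage from a tile to its
  predecessor.\<close>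

lemma quad_decreases:
  assumes xy: "4 \<le> \<bar>x\<bar> \<or> \<bar>x\<bar> \<le> 3 \<and> 6 \<le> \<bar>y\<bar>"
  shows "\<bar>e\<bar> \<le> 55/100 \<Longrightarrow>
      quad (- ((al + al^2) * x + al * y) + e) x \<le> quad x y - 1/10"
    and "0 \<le> e \<Longrightarrow> e \<le> al + al^2 \<Longrightarrow>
      quad (- ((al + al^2) * x + al * y) + e) (x - 1) \<le> quad x y - 1/10"
proof -
  define p where "p = al + al^2"
  have p: "0 < p" "p < 84/100"
  proof -
    have "al * al < (544/1000) * (544/1000)" using al by (intro mult_strict_mono) auto
    then show "p < 84/100" using al by (simp add: p_def power2_eq_square)
    show "0 < p" using al by (simp add: p_def add_pos_pos)
  qed
  define U where "U = p * x + 2 * al * y"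
  have Q: "(1 - al) * quad x y \<ge> U^2 / 5 + 3 * x^2 / 10"
    using quad_lower[of x y] by (simp add: U_def p_def)
  \<comment> \<open>The right-hand sides leave the required gain of 1/10: 66/100 exceeds
    \<open>al + 1/10\<close>, and 41/100 exceeds \<open>(55/100)^2 + 1/10\<close>. Outside the box
    either \<open>x\<close> is large enough, or \<open>x\<close> is small and \<open>y\<close>
    forces \<open>\<bar>U\<bar>\<close> to be at least 3.99.\<close>
  have key: "U^2 / 5 + 3 * x^2 / 10 - 42/100 * \<bar>U\<bar> - 74/100 * \<bar>x\<bar> \<ge> 66/100"
    and key2: "U^2 / 5 + 3 * x^2 / 10 - 55/100 * \<bar>U\<bar> \<ge> 41/100"
  proof -
    \<comment> \<open>1.05 and 1.375 are the minimum points of the two parabolas in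
      \<open>\<bar>U\<bar>\<close>, as 37/30 is below for the one in
      \<open>\<bar>x\<bar>\<close>.\<close>
    have U0: "U^2 / 5 - 42/100 * \<bar>U\<bar> \<ge> -23/100" "U^2 / 5 - 55/100 * \<bar>U\<bar> \<ge> -4/10"
    proof -
      have "0 \<le> (\<bar>U\<bar> - 105/100)^2" "0 \<le> (\<bar>U\<bar> - 1375/1000)^2" by auto
      then show "U^2 / 5 - 42/100 * \<bar>U\<bar> \<ge> -23/100" "U^2 / 5 - 55/100 * \<bar>U\<bar> \<ge> -4/10"
        by (simp_all add: power2_diff power_divide)
    qed
    have x0: "3 * x^2 / 10 - 74/100 * \<bar>x\<bar> \<ge> -46/100"
    proof -
      have "0 \<le> (\<bar>x\<bar> - 37/30)^2" by auto
      then show ?thesis by (simp add: power2_diff power_divide)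
    qed
    from xy have "U^2 / 5 + 3 * x^2 / 10 - 42/100 * \<bar>U\<bar> - 74/100 * \<bar>x\<bar> \<ge> 66/100
      \<and> U^2 / 5 + 3 * x^2 / 10 - 55/100 * \<bar>U\<bar> \<ge> 41/100"
    proof
      assume x: "4 \<le> \<bar>x\<bar>"
      then have "4 * \<bar>x\<bar> \<le> \<bar>x\<bar> * \<bar>x\<bar>" by (intro mult_right_mono) auto
      then have "4 * \<bar>x\<bar> \<le> x^2" by (simp add: power2_eq_square)
      with U0 x show ?thesis by linarith
    next
      assume "\<bar>x\<bar> \<le> 3 \<and> 6 \<le> \<bar>y\<bar>"
      then have x: "\<bar>x\<bar> \<le> 3" and y: "6 \<le> \<bar>y\<bar>" by auto
      have "\<bar>p * x\<bar> \<le> (84/100) * 3" unfolding abs_mult using p x by (intro mult_mono) auto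
      moreover have "2 * (543/1000) * 6 \<le> \<bar>2 * al * y\<bar>"
        unfolding abs_mult using al y by (intro mult_mono) auto
      ultimately have U: "399/100 \<le> \<bar>U\<bar>" unfolding U_def by linarith
      then have "399/100 * \<bar>U\<bar> \<le> \<bar>U\<bar> * \<bar>U\<bar>" by (intro mult_right_mono) auto
      then have "399/100 * \<bar>U\<bar> \<le> U^2" by (simp add: power2_eq_square)
      moreover have "0 \<le> x^2" by simp
      ultimately show ?thesis using U x0 by linarith
    qed
    then show "U^2 / 5 + 3 * x^2 / 10 - 42/100 * \<bar>U\<bar> - 74/100 * \<bar>x\<bar> \<ge> 66/100"
      "U^2 / 5 + 3 * x^2 / 10 - 55/100 * \<bar>U\<bar> \<ge> 41/100" by auto
  qed
  {
    assume e: "\<bar>e\<bar> \<le> 55/100"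
    have "\<bar>e * U\<bar> \<le> 55/100 * \<bar>U\<bar>" unfolding abs_mult using e by (intro mult_right_mono) auto
    then have 1: "- (55/100 * \<bar>U\<bar>) \<le> e * U" by (simp only: abs_le_iff) linarith
    have 2: "e^2 \<le> (55/100)^2" using power_mono[OF e, of 2] by simp
    have "a - e2 + b \<ge> 1/10"
      if "U^2 / 5 + 3 * x^2 / 10 \<le> a" "- (55/100 * \<bar>U\<bar>) \<le> b" "e2 \<le> (55/100)^2" for a b e2 :: real
      using that key2 by (simp add: power_divide)
    from this[OF Q 1 2] have "1/10 \<le> (1 - al) * quad x y - e^2 + e * U" .
    moreover have "(1 - al) * quad x y = quad x y - al * quad x y" by (simp add: left_diff_distrib)
    ultimately have "quad x y - (al * quad x y + e^2 - e * U) \<ge> 1/10" by linarith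
    moreover have "quad (- ((al + al^2) * x + al * y) + e) x = al * quad x y + e^2 - e * U"
      by (simp only: quad_step U_def p_def)
    ultimately show "quad (- ((al + al^2) * x + al * y) + e) x \<le> quad x y - 1/10"
      by linarith
  }
  {
    assume e: "0 \<le> e" "e \<le> al + al^2"
    have "\<bar>(e - p / 2) * U\<bar> \<le> 42/100 * \<bar>U\<bar>"
      unfolding abs_mult using e p by (intro mult_right_mono) (auto simp: p_def[symmetric] abs_if)
    then have 1: "(e - p / 2) * U \<ge> - (42/100 * \<bar>U\<bar>)" by (simp only: abs_le_iff) linarith
    have 2: "e * e \<le> p * e" using e by (intro mult_right_mono) (auto simp: p_def)
    have "\<bar>(2 * al - p * p / 2) * x\<bar> \<le> 74/100 * \<bar>x\<bar>"
    proof -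
      have "(837/1000) * (837/1000) \<le> p * p"
      proof -
        have "(543/1000) * (543/1000) \<le> al * al" using al by (intro mult_mono) auto
        then have "837/1000 \<le> p" using al by (simp add: p_def power2_eq_square)
        then show ?thesis by (intro mult_mono) auto
      qed
      moreover have "p * p \<le> (84/100) * (84/100)" using p by (intro mult_mono) auto
      ultimately have "\<bar>2 * al - p * p / 2\<bar> \<le> 74/100" using al by linarith
      then show ?thesis unfolding abs_mult by (rule mult_right_mono) simp
    qed
    then have 3: "(2 * al - p * p / 2) * x \<ge> - (74/100 * \<bar>x\<bar>)"
      by (simp only: abs_le_iff) linarith
    \<comment> \<open>The shift of the second argument to \<open>x - 1\<close> adds a multiple of
      the new first coordinate. Its dependence on \<open>y\<close> is absorbed into
      \<open>U\<close>, which replaces \<open>e\<close> by \<open>e - p / 2\<close>; as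
      \<open>e\<close> ranges over [0, p], this factor stays below 42/100 in absolute value.\<close>
    have 4: "quad x y - quad (- (p * x + al * y) + e) (x - 1)
      = (1 - al) * quad x y + (e - p / 2) * U - e * e + p * e - al + (2 * al - p * p / 2) * x"
      unfolding quad_def p_def[symmetric] U_def by (simp add: power2_eq_square algebra_simps)
    have "a + b - e2 + pe - al + c \<ge> 1/10"
      if "U^2 / 5 + 3 * x^2 / 10 \<le> a" "- (42/100 * \<bar>U\<bar>) \<le> b" "e2 \<le> pe" "- (74/100 * \<bar>x\<bar>) \<le> c"
      for a b c e2 pe :: real
      using that key al(2) by linarith
    from this[OF Q 1 2 3] have "quad x y - quad (- (p * x + al * y) + e) (x - 1) \<ge> 1/10"
      unfolding 4 .
    then show "quad (- ((al + al^2) * x + al * y) + e) (x - 1) \<le> quad x y - 1/10"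
      by (simp add: p_def)
  }
qed

lemma quad_nonneg: "0 \<le> quad x y"
proof -
  have "0 \<le> (1 - al) * quad x y"
    using quad_lower[of x y] by (smt (verit) divide_nonneg_nonneg zero_le_power2)
  then show ?thesis using al by (simp add: zero_le_mult_iff)
qed

text \<open>Descent along predecessors. The height intervals of types 1 and 2 are cut at
  \<open>1 - al\<close> and \<open>al^2\<close>, and the piece containing the height decides which
  substitution rule produced the tile; type 3 arises from type 1 alone. Outside the box each step
  lowers \<open>quad\<close> of the last two coordinates by at least 1/10, so the rounded value of
  \<open>10 * quad\<close> drops; inside the box the explicit evaluation takes over.\<close>

lemma in_tiling_if_stepped:
  "(vector [a, b, c], k) \<in> stepped_surface \<Longrightarrow> in_tiling a b c k"
proof (induction "nat \<lfloor>10 * quad (of_int b) (of_int c)\<rfloor>" arbitrary: a b c k rule: less_induct)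
  case less
  let ?x = "of_int b :: real" and ?y = "of_int c :: real"
  let ?L = "- ((al + al^2) * ?x + al * ?y)"
  \<comment> \<open>This is the height of the tile, written as the deviation of \<open>a\<close>
    from the plane of height zero. The predecessor has \<open>a\<close> as its second coordinate, so
    \<open>h\<close> becomes the perturbation \<open>e\<close> of
    \<open>quad_decreases\<close>.\<close>
  define h where "h = of_int a - ?L"
  have h: "0 \<le> h" "h < wt k" using less.prems by (auto simp: stepped_surface_def height_3 h_def)
  have a: "of_int a = ?L + h" by (simp add: h_def)
  show ?case
  proof (cases "\<bar>b\<bar> \<le> 3 \<and> \<bar>c\<bar> \<le> 5")
    case True
    then show ?thesis using stepped_surface_box less.prems by blast
  next
    case False
    then have "4 \<le> \<bar>b\<bar> \<or> \<bar>b\<bar> \<le> 3 \<and> 6 \<le> \<bar>c\<bar>" by linarith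
    then have xy: "4 \<le> \<bar>?x\<bar> \<or> \<bar>?x\<bar> \<le> 3 \<and> 6 \<le> \<bar>?y\<bar>" by linarith
    note dec = quad_decreases[OF xy]
    have IH: "in_tiling a' b' c' k'"
      if "quad (of_int b') (of_int c') \<le> quad ?x ?y - 1/10"
        "(vector [a', b', c'], k') \<in> stepped_surface" for a' b' c' k'
    proof (rule less.hyps[OF _ that(2)])
      have "10 * quad (of_int b') (of_int c') \<le> 10 * quad ?x ?y - 1" using that(1) by linarith
      then show "nat \<lfloor>10 * quad (of_int b') (of_int c')\<rfloor> < nat \<lfloor>10 * quad ?x ?y\<rfloor>"
        using quad_nonneg[of "of_int b'" "of_int c'"] by linarith
    qed
    have pos: "0 < al" using al by simp
    have hM: "h = al * height (vector [a + b + c, a, b])"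
    proof -
      have "h = height (vector [a, b, c])" by (simp add: h_def height_3)
      also have "vector [a, b, c] = subst_matrix *v (vector [a + b + c, a, b])"
        by (simp add: subst_matrix_mult vec_eq_iff forall_3)
      finally show ?thesis by (simp add: height_subst)
    qed
    have st: "(vector [a + b + c, a, b], k') \<in> stepped_surface" if "h < al * wt k'" for k'
      using h(1) that pos unfolding hM by (simp add: stepped_surface_def zero_le_mult_iff)
    have st': "(w, k') \<in> stepped_surface"
      if "w = vector [a + b + c, a, b] - axis j 1" "al * wt j \<le> h" "h < al * wt j + al * wt k'"
      for w k' j
    proof -
      have "height w = height (vector [a + b + c, a, b]) - wt j"
        by (simp add: that(1) height_diff height_axis)
      then have "al * height w = h - al * wt j" by (simp add: hM right_diff_distrib)
      then have "0 \<le> al * height w" "al * height w < al * wt k'" using that by auto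
      then show ?thesis using pos by (simp add: stepped_surface_def zero_le_mult_iff)
    qed
    have v: "vector [a + b + c, a - 1, b] = vector [a + b + c, a, b] - (axis 2 1 :: int^3)"
      "vector [a + b + c, a, b - 1] = vector [a + b + c, a, b] - (axis 3 1 :: int^3)"
      by (simp_all add: vec_eq_iff forall_3 axis_def)
    have al2: "al * al \<le> 3/10"
    proof -
      have "al * al \<le> (544/1000) * (544/1000)" using al by (intro mult_mono) auto
      then show ?thesis by simp
    qed
    have al3: "al * wt 2 = 1 - al" using al(3) by (simp add: power3_eq_cube power2_eq_square algebra_simps)
    consider "k = 1" "h < 1 - al" | "k = 1" "1 - al \<le> h" | "k = 2" "h < al * al"
      | "k = 2" "al * al \<le> h" | "k = 3" using exhaust_3[of k] by force
    then show ?thesis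
    proof cases
      case 1
      have "in_tiling (a + b + c) a b 2"
        using dec(1)[of h] st[of 2] 1 h al al3 by (intro IH) (auto simp: a)
      then show ?thesis using 1 in_tiling_step(2) by simp
    next
      case 2
      \<comment> \<open>Here the second coordinate is \<open>a - 1\<close>, so the perturbation is
        \<open>h - 1\<close>, which lies in [-al, 0).\<close>
      have "in_tiling (a + b + c) (a - 1) b 1"
        using dec(1)[of "h - 1"] st'[OF v(1), of 1] 2 h al al3
        by (intro IH) (auto simp: a algebra_simps)
      then show ?thesis using 2 in_tiling_step(3) by simp
    next
      case 3
      have "in_tiling (a + b + c) a b 3"
        using dec(1)[of h] st[of 3] 3 h al al2 by (intro IH) (auto simp: a)
      then show ?thesis using 3 in_tiling_step(4) by simp
    next
      case 4
      have "in_tiling (a + b + c) a (b - 1) 1"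
        using dec(2)[of h] st'[OF v(2), of 1] 4 h al by (intro IH) (auto simp: a power2_eq_square algebra_simps)
      then show ?thesis using 4 in_tiling_step(5) by simp
    next
      case 5
      have "in_tiling (a + b + c) a b 1"
        using dec(1)[of h] st[of 1] 5 h al by (intro IH) (auto simp: a)
      then show ?thesis using 5 in_tiling_step(1) by simp
    qed
  qed
qed

theorem rauzy_tiling_eq: "rauzy_tiling = stepped_surface"
proof
  show "stepped_surface \<subseteq> rauzy_tiling"
  proof
    fix t :: tile
    assume "t \<in> stepped_surface"
    moreover obtain z k where "t = (z, k)" by force
    moreover have "z = vector [z$1, z$2, z$3]" by (simp add: vec_eq_iff forall_3)
    ultimately show "t \<in> rauzy_tiling" using in_tiling_if_stepped by metis
  qed
qed (rule rauzy_tiling_subset)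

section \<open>Vertices, edges and rhombi in terms of heights\<close>

definition pr :: "int^3 \<Rightarrow> point" where
  "pr w = proj (real_vec w)"

lemma pr_nth: "pr w $ 1 = sqrt 3 / 2 * (of_int (w$2) - of_int (w$1))"
  "pr w $ 2 = of_int (w$3) - (of_int (w$1) + of_int (w$2)) / 2"
  by (simp_all add: pr_def proj_def real_vec_def algebra_simps add_divide_distrib)

lemma pr_add: "pr (v + w) = pr v + pr w"
  by (simp add: vec_eq_iff forall_2 pr_nth algebra_simps add_divide_distrib)

lemma pr_axis: "pr (axis a c) = of_int c *\<^sub>R pe a"
proof -
  have "real_vec (axis a c) = of_int c *\<^sub>R axis a 1"
    by (simp add: vec_eq_iff real_vec_def axis_def)
  then show ?thesis by (simp add: pr_def pe_def proj_def scaleR_add_right)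
qed

lemma pr_eq_iff: "pr v = pr w \<longleftrightarrow> (\<exists>t. v = w + vector [t, t, t])"
proof
  assume "pr v = pr w"
  then have "pr v $ 1 = pr w $ 1" "pr v $ 2 = pr w $ 2" by auto
  then have "sqrt 3 / 2 * real_of_int (v$2 - v$1) = sqrt 3 / 2 * of_int (w$2 - w$1)"
    and *: "real_of_int (v$3) - of_int (v$1 + v$2) / 2 = of_int (w$3) - of_int (w$1 + w$2) / 2"
    unfolding pr_nth by simp_all
  have "v$2 - v$1 = w$2 - w$1"
    using \<open>sqrt 3 / 2 * real_of_int (v$2 - v$1) = sqrt 3 / 2 * of_int (w$2 - w$1)\<close>
    by (simp only: mult_cancel_left of_int_eq_iff) simp
  moreover have "real_of_int (2 * v$3 - v$1 - v$2) = of_int (2 * w$3 - w$1 - w$2)"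
  proof -
    have "2 * a - b = 2 * c - d" if "a - b / 2 = c - d / 2" for a b c d :: real
      using that by (simp add: field_simps)
    from this[OF *] show ?thesis by (simp add: algebra_simps)
  qed
  ultimately have "v$2 - v$1 = w$2 - w$1" "2 * v$3 - v$1 - v$2 = 2 * w$3 - w$1 - w$2"
    by (simp_all only: of_int_eq_iff)
  then have "v = w + vector [v$1 - w$1, v$1 - w$1, v$1 - w$1]"
    by (simp add: vec_eq_iff forall_3)
  then show "\<exists>t. v = w + vector [t, t, t]" by blast
qed (auto simp: vec_eq_iff forall_2 pr_nth algebra_simps add_divide_distrib)

section \<open>Lattice points and unit steps in the slab of heights\<close>

definition slab :: "real \<Rightarrow> bool" where
  "slab h \<longleftrightarrow> 0 \<le> h \<and> h < width"

text \<open>Lattice points with equal projection differ by a multiple of (1, 1, 1). The height of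
  this vector is \<open>width\<close>, exactly the thickness of the half-open slab.\<close>

lemma pr_inj: "slab (height v) \<Longrightarrow> slab (height w) \<Longrightarrow> pr v = pr w \<Longrightarrow> v = w"
proof -
  assume s: "slab (height v)" "slab (height w)" and "pr v = pr w"
  then obtain t where t: "v = w + vector [t, t, t]" using pr_eq_iff by blast
  then have "height v = height w + of_int t * width"
    by (simp add: height_3 width_def algebra_simps)
  then have "\<bar>of_int t * width\<bar> < width" using s by (auto simp: slab_def)
  moreover have "0 < width" using al by (simp add: width_def add_pos_pos)
  ultimately have "\<bar>of_int t :: real\<bar> < 1" by (simp add: abs_mult)
  then have "t = 0" by linarith
  then show "v = w" using t by (simp add: vec_eq_iff forall_3)
qed

type_synonym dir = "3 \<times> bool"

definition opp :: "dir \<Rightarrow> dir" where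
  "opp d = (fst d, \<not> snd d)"

definition dint :: "dir \<Rightarrow> int^3" where
  "dint d = axis (fst d) (if snd d then 1 else -1)"

definition dvec :: "dir \<Rightarrow> point" where
  "dvec d = (if snd d then pe (fst d) else - pe (fst d))"

definition dht :: "dir \<Rightarrow> real" where
  "dht d = (if snd d then wt (fst d) else - wt (fst d))"

lemma opp_simps [simp]: "fst (opp d) = fst d" "snd (opp d) = (\<not> snd d)" "opp (opp d) = d"
  "opp (a, s) = (a, \<not> s)" "opp d \<noteq> d" "d \<noteq> opp d"
  "dvec (opp d) = - dvec d" "dht (opp d) = - dht d"
  by (auto simp: opp_def dvec_def dht_def prod_eq_iff)

lemma same_axis: "fst d = fst e \<Longrightarrow> d = e \<or> d = opp e"
  by (auto simp: opp_def prod_eq_iff)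

lemma pr_dint [simp]: "pr (dint d) = dvec d"
  by (simp add: dint_def dvec_def pr_axis)

lemma height_dint [simp]: "height (dint d) = dht d"
  by (simp add: dint_def dht_def height_axis)

lemma dint_nth: "dint d $ i = (if i = fst d then if snd d then 1 else -1 else 0)"
  by (simp add: dint_def axis_def)

lemma axis_nth_if: "axis a c $ i = (if i = a then c else 0)"
  by (simp add: axis_def)

lemma other_axis: "\<exists>c::3. c \<noteq> a \<and> c \<noteq> b"
proof -
  have "(1::3) \<noteq> 2" "(1::3) \<noteq> 3" "(2::3) \<noteq> 3" by simp_all
  then show ?thesis by metis
qed

lemma dvec_inj: "dvec d = dvec e \<longleftrightarrow> d = e"
proof
  assume "dvec d = dvec e"
  then have "pr (dint d) = pr (dint e)" by simp
  then obtain t where t: "dint d = dint e + vector [t, t, t]" using pr_eq_iff by blast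
  obtain a where a: "a \<noteq> fst d" "a \<noteq> fst e" using other_axis by blast
  have "(vector [t, t, t] :: int^3) $ i = t" for i using exhaust_3[of i] by auto
  then have "dint d $ i = dint e $ i + t" for i using t by simp
  from this[of a] have "t = 0" using a by (simp add: dint_nth)
  then have "dint d = dint e" using t by (simp add: vec_eq_iff forall_3)
  then have "dint d $ i = dint e $ i" for i by simp
  from this[of "fst d"] show "d = e"
    by (auto simp: dint_nth prod_eq_iff split: if_splits)
qed simp

lemma dvec_neq_0 [simp]: "dvec d \<noteq> 0"
proof
  assume "dvec d = 0"
  then have "dvec d = dvec (opp d)" by simp
  then show False using dvec_inj by (metis opp_simps(5))
qed

text \<open>The lattice lifts of the corners of a tile. On lattice points an edge along axis
  \<open>a\<close> cannot be confused with the short diagonal, whose projection is also a translate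
  of some \<open>pe a\<close>.\<close>

definition cell :: "tile \<Rightarrow> (int^3) set" where
  "cell t = {w. w $ snd t = fst t $ snd t \<and> (\<forall>i. w $ i - fst t $ i \<in> {0, 1})}"

lemma cell_3:
  "w \<in> cell (z, 1) \<longleftrightarrow> w$1 = z$1 \<and> w$2 - z$2 \<in> {0, 1} \<and> w$3 - z$3 \<in> {0, 1}"
  "w \<in> cell (z, 2) \<longleftrightarrow> w$2 = z$2 \<and> w$1 - z$1 \<in> {0, 1} \<and> w$3 - z$3 \<in> {0, 1}"
  "w \<in> cell (z, 3) \<longleftrightarrow> w$3 = z$3 \<and> w$1 - z$1 \<in> {0, 1} \<and> w$2 - z$2 \<in> {0, 1}"
  by (auto simp: cell_def forall_3)

text \<open>The base of a tile of type \<open>k\<close> has height below \<open>wt k\<close>, and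
  the three weights add up to \<open>width\<close>, so there is room for steps along both other
  axes.\<close>

lemma cell_height:
  assumes "t \<in> stepped_surface" "w \<in> cell t"
  shows "slab (height w)"
proof -
  obtain z k where t: "t = (z, k)" by force
  define e where "e i = (of_int (w$i - z$i) :: real)" for i
  have w: "height w = height z + e 1 + wt 2 * e 2 + wt 3 * e 3"
    by (simp add: e_def height_3 algebra_simps)
  have "e i \<in> {0, 1}" for i using assms(2) by (auto simp: cell_def t e_def)
  then have "e i = 0 \<or> e i = 1" for i by blast
  from this[of 1] this[of 2] this[of 3] show ?thesis
    using assms exhaust_3[of k] wt_pos[of 2] wt_pos[of 3] unfolding w
    by (auto simp: cell_3 e_def t slab_def stepped_surface_def width_def)
qed

lemma UNIV_3: "(UNIV :: 3 set) = {1, 2, 3}"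
  using exhaust_3 by auto

lemma corners_eq: "corners t = pr ` cell t"
proof -
  obtain z k where t: "t = (z, k)" by force
  show ?thesis
  proof (intro equalityI subsetI)
    fix p assume "p \<in> corners t"
    then obtain l m i j where p: "p = pr z + l *\<^sub>R pe i + m *\<^sub>R pe j" "{i, j, k} = UNIV"
      "l \<in> {0, 1}" "m \<in> {0, 1}" unfolding corners_def by (auto simp: t pr_def)
    obtain l' m' :: int where lm: "l = of_int l'" "m = of_int m'" "l' \<in> {0, 1}" "m' \<in> {0, 1}"
      using p(3,4) by (metis empty_iff insert_iff of_int_0 of_int_1)
    have "p = pr (z + axis i l' + axis j m')" by (simp add: p(1) lm pr_add pr_axis)
    moreover have "z + axis i l' + axis j m' \<in> cell t"
    proof -
      have "(1::3) \<in> {i, j, k}" "(2::3) \<in> {i, j, k}" "(3::3) \<in> {i, j, k}" using p(2) by auto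
      then have "i \<noteq> j" "i \<noteq> k" "j \<noteq> k" by auto
      then show ?thesis using lm by (auto simp: cell_def t axis_def)
    qed
    ultimately show "p \<in> pr ` cell t" by blast
  next
    fix p assume "p \<in> pr ` cell t"
    then obtain w where w: "p = pr w" "w \<in> cell t" by blast
    have e: "z + axis i (w$i - z$i) + axis j (w$j - z$j) = w" if "{i, j, k} = UNIV" for i j
    proof -
      have "(1::3) \<in> {i, j, k}" "(2::3) \<in> {i, j, k}" "(3::3) \<in> {i, j, k}" using that by auto
      then have "i \<noteq> j" "i \<noteq> k" "j \<noteq> k" by auto
      moreover have "n \<in> {i, j, k}" for n using that by auto
      moreover have "w$k = z$k" using w(2) by (simp add: cell_def t)
      ultimately have "(z + axis i (w$i - z$i) + axis j (w$j - z$j)) $ n = w $ n" for n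
        by (cases "n = i"; cases "n = j"; cases "n = k") (auto simp: axis_def)
      then show ?thesis by (simp add: vec_eq_iff)
    qed
    have "\<exists>i j. {i, j, k} = UNIV"
      using exhaust_3[of k] unfolding UNIV_3
      by (elim disjE) (rule exI[of _ 2], rule exI[of _ 3], force, rule exI[of _ 1], rule exI[of _ 3], force,
          rule exI[of _ 1], rule exI[of _ 2], force)
    then obtain i j where ij: "{i, j, k} = UNIV" by blast
    have "p = pr z + of_int (w$i - z$i) *\<^sub>R pe i + of_int (w$j - z$j) *\<^sub>R pe j"
      unfolding w(1) by (subst e[OF ij, symmetric]) (simp only: pr_add pr_axis)
    moreover have "of_int (w$i - z$i) \<in> {0, 1::real}" "of_int (w$j - z$j) \<in> {0, 1::real}"
      using w(2) by (auto simp: cell_def t)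
    ultimately show "p \<in> corners t"
      unfolding corners_def mem_Collect_eq t fst_conv snd_conv pr_def[symmetric] using ij by blast
  qed
qed

lemma tile_edges_iff:
  "{p, q} \<in> tile_edges t \<longleftrightarrow> (\<exists>w d. fst d \<noteq> snd t \<and> w \<in> cell t \<and> w + dint d \<in> cell t
     \<and> p = pr w \<and> q = pr w + dvec d)"
proof
  assume "{p, q} \<in> tile_edges t"
  then obtain u a where u: "{p, q} = {u, u + pe a}" "a \<noteq> snd t" "u \<in> corners t" "u + pe a \<in> corners t"
    unfolding tile_edges_def by blast
  obtain w w' where w: "u = pr w" "w \<in> cell t" "u + pe a = pr w'" "w' \<in> cell t"
    using u(3,4) unfolding corners_eq by (elim imageE) metis
  have "pr w' = pr (w + axis a 1)" using w by (simp add: pr_add pr_axis)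
  then obtain s where s: "w' = w + axis a 1 + vector [s, s, s]" using pr_eq_iff by blast
  have "(vector [s, s, s] :: int^3) $ i = s" for i using exhaust_3[of i] by auto
  then have "w' $ i = w $ i + axis a 1 $ i + s" for i using s by simp
  from this[of "snd t"] have "w' $ snd t = w $ snd t + axis a 1 $ snd t + s" .
  moreover have "w' $ snd t = w $ snd t" using w(2,4) by (simp add: cell_def)
  moreover have "axis a (1::int) $ snd t = 0" using u(2) by (simp add: axis_def)
  ultimately have "s = 0" by simp
  then have w': "w' = w + dint (a, True)" using s by (simp add: vec_eq_iff forall_3 dint_def)
  then have w2: "w = w' + dint (a, False)" by (simp add: vec_eq_iff dint_nth)
  from u(1) have "p = u \<and> q = u + pe a \<or> p = u + pe a \<and> q = u" by (auto simp: doubleton_eq_iff)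
  then show "\<exists>w d. fst d \<noteq> snd t \<and> w \<in> cell t \<and> w + dint d \<in> cell t \<and> p = pr w \<and> q = pr w + dvec d"
  proof
    assume pq: "p = u \<and> q = u + pe a"
    have "w + dint (a, True) \<in> cell t" using w(4) unfolding w' .
    moreover have "q = pr w + dvec (a, True)" using pq w(1) by (simp add: dvec_def)
    ultimately show ?thesis using w(1,2) u(2) pq by (metis fst_conv)
  next
    assume pq: "p = u + pe a \<and> q = u"
    have "w' + dint (a, False) \<in> cell t" using w(2) by (simp flip: w2)
    moreover have "q = pr w' + dvec (a, False)" using pq by (simp add: dvec_def flip: w(3))
    ultimately show ?thesis using w(3,4) u(2) pq by (metis fst_conv)
  qed
next
  assume "\<exists>w d. fst d \<noteq> snd t \<and> w \<in> cell t \<and> w + dint d \<in> cell t \<and> p = pr w \<and> q = pr w + dvec d"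
  then obtain w d where w: "fst d \<noteq> snd t" "w \<in> cell t" "w + dint d \<in> cell t" "p = pr w" "q = pr w + dvec d"
    by blast
  then have c: "p \<in> corners t" "q \<in> corners t"
    by (auto simp: corners_eq pr_add[symmetric] simp flip: pr_dint)
  show "{p, q} \<in> tile_edges t"
  proof (cases "snd d")
    case True
    then have "q = p + pe (fst d)" using w by (simp add: dvec_def)
    then show ?thesis unfolding tile_edges_def using c w(1) by blast
  next
    case False
    then have "p = q + pe (fst d)" using w by (simp add: dvec_def)
    then have "{p, q} = {q, q + pe (fst d)}" by auto
    moreover have "q + pe (fst d) \<in> corners t" using \<open>p = q + pe (fst d)\<close> c by simp
    ultimately show ?thesis unfolding tile_edges_def using c w(1) by blast
  qed
qed

text \<open>Heights are unspecified at points that are not vertices.\<close>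

definition lift :: "point \<Rightarrow> int^3" where
  "lift p = (THE w. slab (height w) \<and> pr w = p)"

definition ht :: "point \<Rightarrow> real" where
  "ht p = height (lift p)"

lemma lift_pr: "slab (height w) \<Longrightarrow> lift (pr w) = w"
  unfolding lift_def using pr_inj by blast

lemma ht_pr: "slab (height w) \<Longrightarrow> ht (pr w) = height w"
  by (simp add: ht_def lift_pr)

text \<open>The thresholds \<open>wt 1\<close> and \<open>wt 1 + wt 2\<close> cut the slab into
  intervals whose lengths are the three weights. In each of them, going back along the axes already
  passed gives the base of a tile with the point as a corner.\<close>

lemma slab_in_cell:
  assumes "slab (height w)"
  obtains t where "t \<in> stepped_surface" "w \<in> cell t"
proof -
  consider "height w < wt 1" | "wt 1 \<le> height w" "height w < wt 1 + wt 2" | "wt 1 + wt 2 \<le> height w"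
    by linarith
  then show ?thesis
  proof cases
    case 1
    then show ?thesis using assms by (intro that[of "(w, 1)"]) (auto simp: slab_def stepped_surface_def cell_3)
  next
    case 2
    then show ?thesis using assms
      by (intro that[of "(w - axis 1 1, 2)"])
        (auto simp: slab_def stepped_surface_def cell_3 height_diff height_axis axis_nth_if)
  next
    case 3
    then show ?thesis using assms
      by (intro that[of "(w - axis 1 1 - axis 2 1, 3)"])
        (auto simp: slab_def stepped_surface_def cell_3 height_diff height_axis axis_nth_if width_def)
  qed
qed

lemma rauzy_vertices_iff: "p \<in> rauzy_vertices \<longleftrightarrow> (\<exists>w. slab (height w) \<and> p = pr w)"
proof
  assume "p \<in> rauzy_vertices"
  then show "\<exists>w. slab (height w) \<and> p = pr w"
    unfolding rauzy_vertices_def rauzy_tiling_eq using cell_height by (auto simp: corners_eq)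
next
  assume "\<exists>w. slab (height w) \<and> p = pr w"
  then show "p \<in> rauzy_vertices"
    unfolding rauzy_vertices_def rauzy_tiling_eq by (metis UN_I corners_eq image_eqI slab_in_cell)
qed

lemma slab_ht: "p \<in> rauzy_vertices \<Longrightarrow> slab (ht p)"
  by (auto simp: rauzy_vertices_iff ht_pr)

definition valid_step :: "point \<Rightarrow> dir \<Rightarrow> bool" where
  "valid_step p d \<longleftrightarrow> p \<in> rauzy_vertices \<and> slab (ht p + dht d)"

lemma valid_stepD:
  assumes "valid_step p d"
  shows "p \<in> rauzy_vertices" "p + dvec d \<in> rauzy_vertices" "ht (p + dvec d) = ht p + dht d"
proof -
  obtain w where w: "slab (height w)" "p = pr w"
    using assms by (auto simp: valid_step_def rauzy_vertices_iff)
  have *: "slab (height (w + dint d))" "p + dvec d = pr (w + dint d)"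
    using assms w by (simp_all add: valid_step_def ht_pr height_add pr_add)
  then show "p + dvec d \<in> rauzy_vertices" using rauzy_vertices_iff by blast
  show "ht (p + dvec d) = ht p + dht d"
    unfolding *(2) using * w by (simp add: ht_pr height_add)
  show "p \<in> rauzy_vertices" using assms by (simp add: valid_step_def)
qed

lemma valid_step_pr: "slab (height w) \<Longrightarrow> valid_step (pr w) d \<longleftrightarrow> slab (height (w + dint d))"
  by (auto simp: valid_step_def ht_pr height_add rauzy_vertices_iff)

section \<open>Rhombi at a vertex in terms of its height\<close>

definition square :: "real \<Rightarrow> dir \<Rightarrow> dir \<Rightarrow> bool" where
  "square h d e \<longleftrightarrow> fst d \<noteq> fst e \<and> slab h \<and> slab (h + dht d) \<and> slab (h + dht e)
     \<and> slab (h + dht d + dht e)"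

lemma square_commute: "square h d e \<longleftrightarrow> square h e d"
  by (auto simp: square_def algebra_simps)

lemma square_opp: "square (h + dht d) (opp d) e \<longleftrightarrow> square h d e"
  by (auto simp: square_def algebra_simps)

lemma axes_UNIV:
  fixes a b c :: 3
  assumes "a \<noteq> b" "a \<noteq> c" "b \<noteq> c"
  shows "{a, b, c} = UNIV"
proof -
  have "card {a, b, c} = 3" using assms by simp
  then show ?thesis by (intro card_subset_eq) auto
qed

lemma wt_sum:
  assumes "a \<noteq> b" "a \<noteq> c" "b \<noteq> c"
  shows "wt a + wt b + wt c = width"
  using wt_third[OF axes_UNIV[OF assms]] .

text \<open>For positive \<open>d\<close> the hypotheses put \<open>h\<close> into [0, wt a + wt b).
  The rhombus with \<open>(a, True)\<close> requires \<open>h < wt b\<close>, the one with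
  \<open>(b, False)\<close> requires \<open>wt b \<le> h\<close>, and these are complementary. The
  other signs are analogous.\<close>

lemma square_third:
  assumes "fst d \<noteq> a" "fst d \<noteq> b" "a \<noteq> b" "slab h" "slab (h + dht d)"
  shows "square h d (a, s) \<longleftrightarrow> \<not> square h d (b, \<not> s)"
  using assms wt_sum[OF assms(1-3)] wt_pos[of a] wt_pos[of b] wt_pos[of "fst d"]
  by (cases "snd d"; cases s) (auto simp: square_def slab_def dht_def)

lemma square_exists:
  assumes "slab h" "slab (h + dht d)"
  obtains e where "square h d e"
proof -
  obtain a where a: "a \<noteq> fst d" using other_axis by blast
  obtain b where b: "b \<noteq> fst d" "b \<noteq> a" using other_axis by blast
  show ?thesis using square_third[of d a b h True] a b assms that by metis
qed

text \<open>The four candidates for the second direction form two pairs, and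
  \<open>square_third\<close> admits exactly one from each. Geometrically, an edge lies in exactly
  two rhombi.\<close>

lemma square_two:
  assumes "square h d e" "square h d f" "square h d g" "e \<noteq> f"
  shows "g = e \<or> g = f"
proof -
  obtain a where a: "a \<noteq> fst d" using other_axis by blast
  obtain b where b: "b \<noteq> fst d" "b \<noteq> a" using other_axis by blast
  have u: "x \<in> {fst d, a, b}" for x using axes_UNIV[of "fst d" a b] a b by auto
  have "slab h" "slab (h + dht d)" using assms(1) by (auto simp: square_def)
  then have "square h d (a, True) \<longleftrightarrow> \<not> square h d (b, False)"
    "square h d (a, False) \<longleftrightarrow> \<not> square h d (b, True)"
    using square_third[of d a b h True] square_third[of d a b h False] a b by auto
  note ab = this
  define p where "p = (if square h d (a, True) then (a, True) else (b, False))"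
  define q where "q = (if square h d (a, False) then (a, False) else (b, True))"
  have pq: "x = p \<or> x = q" if x: "square h d x" for x
  proof -
    have "fst x \<noteq> fst d" using x by (auto simp: square_def)
    then have "x = (a, True) \<or> x = (a, False) \<or> x = (b, True) \<or> x = (b, False)"
      using u[of "fst x"] by (cases x) auto
    then show ?thesis using x ab unfolding p_def q_def by (elim disjE) simp_all
  qed
  show ?thesis using pq[OF assms(1)] pq[OF assms(2)] pq[OF assms(3)] assms(4) by metis
qed

text \<open>Three steps of equal sign change the height by the full \<open>width\<close>, which is
  too much for the half-open slab. If one sign differs, the two equal steps and the opposite one,
  taken from the same point, end \<open>width\<close> apart in height.\<close>

lemma no_cube:
  assumes "fst d \<noteq> fst e" "fst d \<noteq> fst f" "fst e \<noteq> fst f"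
    and "slab h" "slab (h + dht d)" "slab (h + dht e)" "slab (h + dht f)"
    and "slab (h + dht d + dht e)" "slab (h + dht d + dht f)" "slab (h + dht e + dht f)"
    and "slab (h + dht d + dht e + dht f)"
  shows False
proof -
  have W: "wt (fst d) + wt (fst e) + wt (fst f) = width" using assms(1-3) by (rule wt_sum)
  have mixed: False
    if "slab (h + dht a + dht b)" "slab (h + dht c)" "snd a = snd b" "snd c \<noteq> snd a"
      "wt (fst a) + wt (fst b) + wt (fst c) = width" for a b c
  proof (cases "snd a")
    case True
    then have "dht a = wt (fst a)" "dht b = wt (fst b)" "dht c = - wt (fst c)"
      using that(3,4) by (simp_all add: dht_def)
    then show ?thesis using that(1,2,5) unfolding slab_def by linarith
  next
    case False
    then have "dht a = - wt (fst a)" "dht b = - wt (fst b)" "dht c = wt (fst c)"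
      using that(3,4) by (simp_all add: dht_def)
    then show ?thesis using that(1,2,5) unfolding slab_def by linarith
  qed
  have same: False if "snd d = snd e" "snd d = snd f"
  proof (cases "snd d")
    case True
    then have "dht d = wt (fst d)" "dht e = wt (fst e)" "dht f = wt (fst f)"
      using that by (simp_all add: dht_def)
    then show ?thesis using assms(4,11) W unfolding slab_def by linarith
  next
    case False
    then have "dht d = - wt (fst d)" "dht e = - wt (fst e)" "dht f = - wt (fst f)"
      using that by (simp_all add: dht_def)
    then show ?thesis using assms(4,11) W unfolding slab_def by linarith
  qed
  consider "snd d = snd e" "snd d = snd f" | "snd d = snd e" "snd f \<noteq> snd d"
    | "snd d = snd f" "snd e \<noteq> snd d" | "snd e = snd f" "snd d \<noteq> snd e" by metis
  then show False
  proof cases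
    case 1
    then show ?thesis by (rule same)
  next
    case 2
    then show ?thesis using mixed[OF assms(8,7)] W by simp
  next
    case 3
    then show ?thesis using mixed[OF assms(9,6)] W by simp
  next
    case 4
    then show ?thesis using mixed[OF assms(10,5)] W by simp
  qed
qed

lemma cellD:
  assumes "w \<in> cell t"
  shows "w$i - fst t$i = 0 \<or> w$i - fst t$i = 1" "w$snd t = fst t$snd t"
  using assms by (simp_all add: cell_def)

lemma cellI:
  assumes "w$snd t = fst t$snd t" "\<And>i. w$i - fst t$i = 0 \<or> w$i - fst t$i = 1"
  shows "w \<in> cell t"
  using assms by (simp add: cell_def)

lemma cell_dint:
  assumes "w \<in> cell t" "fst d \<noteq> snd t"
  shows "w + dint d \<in> cell t \<longleftrightarrow> w$fst d - fst t$fst d = (if snd d then 0 else 1)"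
proof
  assume "w + dint d \<in> cell t"
  from cellD(1)[OF this] have "(w + dint d)$fst d - fst t$fst d = 0 \<or> (w + dint d)$fst d - fst t$fst d = 1" .
  moreover have "w$fst d - fst t$fst d = 0 \<or> w$fst d - fst t$fst d = 1" using cellD(1)[OF assms(1)] .
  ultimately show "w$fst d - fst t$fst d = (if snd d then 0 else 1)"
    by (auto simp: dint_nth split: if_splits)
next
  assume "w$fst d - fst t$fst d = (if snd d then 0 else 1)"
  then show "w + dint d \<in> cell t" using assms
    by (auto simp: cell_def dint_nth split: if_splits)
qed

lemma cell_flip: "w \<in> cell t \<Longrightarrow> a \<noteq> snd t \<Longrightarrow> \<exists>s. w + dint (a, s) \<in> cell t"
proof -
  assume w: "w \<in> cell t" "a \<noteq> snd t"
  then have "w$a - fst t$a \<in> {0, 1}" by (simp add: cell_def)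
  then have "w$a - fst t$a = 0 \<or> w$a - fst t$a = 1" by blast
  then show ?thesis using cell_dint[OF w(1), of "(a, True)"] cell_dint[OF w(1), of "(a, False)"] w(2)
    by auto
qed

lemma cell_dint2:
  assumes "w \<in> cell t" "w + dint d \<in> cell t" "fst d \<noteq> snd t" "fst e \<noteq> snd t"
  shows "w + dint d + dint e \<in> cell t \<longleftrightarrow> e = opp d \<or> fst d \<noteq> fst e \<and> w + dint e \<in> cell t"
proof (cases "fst d = fst e")
  case True
  then consider "e = opp d" | "e = d" using same_axis by metis
  then show ?thesis
  proof cases
    case 1
    have "dint d + dint (opp d) = 0" by (simp add: vec_eq_iff dint_nth)
    then have "w + (dint d + dint (opp d)) = w" by simp
    then have "w + dint d + dint e = w" unfolding 1 add.assoc .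
    then have "w + dint d + dint e \<in> cell t" using assms(1) by (rule ssubst)
    then show ?thesis using 1 by blast
  next
    case 2
    have "w$fst d - fst t$fst d = (if snd d then 0 else 1)"
      using cell_dint[OF assms(1,3)] assms(2) by simp
    then have "w + dint d + dint e \<notin> cell t"
      using cell_dint[OF assms(2,4)] 2 by (auto simp: dint_nth split: if_splits)
    then show ?thesis using 2 by simp
  qed
next
  case False
  then have "(w + dint d)$fst e = w$fst e" by (simp add: dint_nth)
  then show ?thesis
    using cell_dint[OF assms(2,4)] cell_dint[OF assms(1,4)] False by auto
qed

lemma square_cell:
  assumes "square (height w) d e"
  obtains t where "t \<in> stepped_surface" "fst d \<noteq> snd t" "fst e \<noteq> snd t"
    "cell t = {w, w + dint d, w + dint d + dint e, w + dint e}"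
proof -
  have de: "fst d \<noteq> fst e" using assms by (simp add: square_def)
  obtain c where c: "c \<noteq> fst d" "c \<noteq> fst e" using other_axis by blast
  \<comment> \<open>The lowest corner, reached by taking those of the two steps that go down; it is
    the base of the tile.\<close>
  define z where "z = w + (if snd d then 0 else dint d) + (if snd e then 0 else dint e)"
  have hz: "height z = height w + (if snd d then 0 else dht d) + (if snd e then 0 else dht e)"
    by (simp add: z_def height_add)
  have W: "wt (fst d) + wt (fst e) + wt c = width" using wt_sum de c by metis
  have st: "(z, c) \<in> stepped_surface"
    using assms W
    by (auto simp: stepped_surface_def hz square_def slab_def dht_def split: if_splits)
  have u: "x \<in> {fst d, fst e, c}" for x using axes_UNIV[OF de] c by auto
  have zd: "z$fst d = w$fst d - (if snd d then 0 else 1)" and ze: "z$fst e = w$fst e - (if snd e then 0 else 1)"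
    and zc: "z$c = w$c" using de c by (simp_all add: z_def dint_nth)
  have zi: "z$i = w$i - (if i = fst d \<and> \<not> snd d \<or> i = fst e \<and> \<not> snd e then 1 else 0)" for i
    using zd ze zc u[of i] de c by auto
  have "v \<in> cell (z, c) \<longleftrightarrow> v \<in> {w, w + dint d, w + dint d + dint e, w + dint e}" for v
  proof
    assume v: "v \<in> cell (z, c)"
    have v': "v$fst d - z$fst d = 0 \<or> v$fst d - z$fst d = 1" "v$fst e - z$fst e = 0 \<or> v$fst e - z$fst e = 1"
      "v$c = z$c" using cellD(1)[OF v, of "fst d"] cellD(1)[OF v, of "fst e"] cellD(2)[OF v] by simp_all
    have ext: "v = v'" if "v$fst d = v'$fst d" "v$fst e = v'$fst e" "v$c = v'$c" for v'
      unfolding vec_eq_iff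
    proof
      fix i
      have "i = fst d \<or> i = fst e \<or> i = c" using u[of i] by blast
      then show "v$i = v'$i" using that by (elim disjE) simp_all
    qed
    have "v = w + (if v$fst d = w$fst d then 0 else dint d) + (if v$fst e = w$fst e then 0 else dint e)"
    proof (rule ext)
      show "v$fst d = (w + (if v$fst d = w$fst d then 0 else dint d) + (if v$fst e = w$fst e then 0 else dint e))$fst d"
        using v'(1) zd de by (auto simp: dint_nth split: if_splits)
      show "v$fst e = (w + (if v$fst d = w$fst d then 0 else dint d) + (if v$fst e = w$fst e then 0 else dint e))$fst e"
        using v'(2) ze de by (auto simp: dint_nth split: if_splits)
      show "v$c = (w + (if v$fst d = w$fst d then 0 else dint d) + (if v$fst e = w$fst e then 0 else dint e))$c"
        using v'(3) zc c by (simp add: dint_nth)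
    qed
    then show "v \<in> {w, w + dint d, w + dint d + dint e, w + dint e}"
      by (cases "v$fst d = w$fst d"; cases "v$fst e = w$fst e") simp_all
  next
    assume "v \<in> {w, w + dint d, w + dint d + dint e, w + dint e}"
    moreover have "w \<in> cell (z, c)" "w + dint d \<in> cell (z, c)" "w + dint d + dint e \<in> cell (z, c)"
      "w + dint e \<in> cell (z, c)"
      by (rule cellI; use de c in \<open>auto simp: zi zc dint_nth\<close>)+
    ultimately show "v \<in> cell (z, c)" by blast
  qed
  then show ?thesis using st de c by (intro that[of "(z, c)"]) auto
qed

lemma tile_path_square:
  assumes t: "t \<in> stepped_surface" and e: "{x, u} \<in> tile_edges t" "{u, w} \<in> tile_edges t" and "x \<noteq> w"
  obtains p d e where "p \<in> cell t" "x = pr p" "u = pr (p + dint d)" "w = pr (p + dint d + dint e)"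
    "p + dint d \<in> cell t" "p + dint d + dint e \<in> cell t" "p + dint e \<in> cell t"
    "fst d \<noteq> snd t" "fst e \<noteq> snd t" "fst d \<noteq> fst e" "square (ht x) d e"
proof -
  obtain p d where p: "p \<in> cell t" "p + dint d \<in> cell t" "fst d \<noteq> snd t" "x = pr p" "u = pr (p + dint d)"
    using e(1) unfolding tile_edges_iff by (auto simp: pr_add)
  obtain q e where q: "q \<in> cell t" "q + dint e \<in> cell t" "fst e \<noteq> snd t" "u = pr q" "w = pr (q + dint e)"
    using e(2) unfolding tile_edges_iff by (auto simp: pr_add)
  have qp: "q = p + dint d"
    using pr_inj cell_height[OF t] p q by metis
  have ne: "e \<noteq> opp d"
  proof
    assume "e = opp d"
    then have "w = x" using p q qp by (simp add: pr_add)
    with assms show False by simp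
  qed
  then have e: "fst d \<noteq> fst e" "p + dint e \<in> cell t"
    using cell_dint2[OF p(1,2,3) q(3)] q qp by auto
  have "square (ht x) d e"
    using cell_height[OF t p(1)] cell_height[OF t p(2)] cell_height[OF t q(2)] cell_height[OF t e(2)] e(1)
    unfolding p(4) by (simp add: ht_pr square_def qp height_add)
  then show ?thesis using that p q qp e by metis
qed

lemma square_tile:
  assumes "x \<in> rauzy_vertices" "square (ht x) d e"
  obtains t where "t \<in> rauzy_tiling" "corners t = {x, x + dvec d, x + dvec d + dvec e, x + dvec e}"
    "{x, x + dvec d} \<in> tile_edges t" "{x + dvec d, x + dvec d + dvec e} \<in> tile_edges t"
    "{x + dvec d + dvec e, x + dvec e} \<in> tile_edges t" "{x + dvec e, x} \<in> tile_edges t"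
proof -
  obtain p where p: "slab (height p)" "x = pr p" using assms(1) rauzy_vertices_iff by blast
  then have "square (height p) d e" using assms(2) by (simp add: ht_pr)
  then obtain t where t: "t \<in> stepped_surface" "fst d \<noteq> snd t" "fst e \<noteq> snd t"
    "cell t = {p, p + dint d, p + dint d + dint e, p + dint e}" by (rule square_cell)
  have E: "{pr q, pr q + dvec f} \<in> tile_edges t" if "q \<in> cell t" "q + dint f \<in> cell t" "fst f \<noteq> snd t" for q f
    unfolding tile_edges_iff using that by blast
  have c: "corners t = {x, x + dvec d, x + dvec d + dvec e, x + dvec e}"
    unfolding corners_eq t(4) p(2) by (simp add: pr_add)
  have "{x, x + dvec d} \<in> tile_edges t" using E[of p d] t(2,4) p(2) by simp
  moreover have "{x + dvec d, x + dvec d + dvec e} \<in> tile_edges t"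
    using E[of "p + dint d" e] t(3,4) p(2) by (simp add: pr_add)
  moreover have "{x + dvec d + dvec e, x + dvec e} \<in> tile_edges t"
    using E[of "p + dint e" d] t(2,4) p(2) by (simp add: pr_add insert_commute algebra_simps)
  moreover have "{x + dvec e, x} \<in> tile_edges t"
    using E[of p e] t(3,4) p(2) by (simp add: insert_commute)
  ultimately show ?thesis using that t(1) c rauzy_tiling_eq by blast
qed

lemma edge_iff: "{p, q} \<in> rauzy_edges \<longleftrightarrow> (\<exists>d. valid_step p d \<and> q = p + dvec d)"
proof
  assume "{p, q} \<in> rauzy_edges"
  then obtain t where t: "t \<in> stepped_surface" "{p, q} \<in> tile_edges t"
    by (auto simp: rauzy_edges_def rauzy_tiling_eq)
  obtain w d where w: "w \<in> cell t" "w + dint d \<in> cell t" "p = pr w" "q = pr w + dvec d"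
    using t(2) unfolding tile_edges_iff by blast
  then have "valid_step p d" using cell_height[OF t(1)] valid_step_pr by metis
  then show "\<exists>d. valid_step p d \<and> q = p + dvec d" using w by blast
next
  assume "\<exists>d. valid_step p d \<and> q = p + dvec d"
  then obtain d where d: "p \<in> rauzy_vertices" "slab (ht p + dht d)" "q = p + dvec d"
    by (auto simp: valid_step_def)
  obtain e where "square (ht p) d e" using square_exists slab_ht d by metis
  from square_tile[OF d(1) this] show "{p, q} \<in> rauzy_edges"
    unfolding rauzy_edges_def d(3) by blast
qed

lemma rhombus_iff:
  "rhombus x u w v \<longleftrightarrow> (\<exists>d e. x \<in> rauzy_vertices \<and> square (ht x) d e \<and>
     u = x + dvec d \<and> v = x + dvec e \<and> w = x + dvec d + dvec e)"
proof
  assume "rhombus x u w v"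
  then obtain t where t: "t \<in> stepped_surface" "corners t = {x, u, w, v}" "{x, u} \<in> tile_edges t"
    "{u, w} \<in> tile_edges t" "{w, v} \<in> tile_edges t" "{v, x} \<in> tile_edges t"
    unfolding rhombus_def rauzy_tiling_eq by blast
  have inj: "p = q" if "p \<in> cell t" "q \<in> cell t" "pr p = pr q" for p q
    using that pr_inj cell_height[OF t(1)] by blast
  obtain p d where p: "p \<in> cell t" "p + dint d \<in> cell t" "fst d \<noteq> snd t" "x = pr p" "u = pr (p + dint d)"
    using t(3) unfolding tile_edges_iff by (auto simp: pr_add)
  obtain c where c: "c \<noteq> fst d" "c \<noteq> snd t" using other_axis by blast
  obtain s where e: "p + dint (c, s) \<in> cell t" using cell_flip[OF p(1)] c by blast
  define f where "f = (c, s)"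
  have f: "p + dint f \<in> cell t" "p + dint d + dint f \<in> cell t" "fst d \<noteq> fst f"
    using cell_dint2[OF p(1,2,3), of f] e c by (auto simp: f_def)
  have xf: "pr (p + dint f) \<in> {x, u, w, v}" "pr (p + dint d + dint f) \<in> {x, u, w, v}"
    using f t(2) corners_eq by blast+
  have df: "dint d $ fst d \<noteq> 0" "dint f $ fst d = 0" "dint f $ fst f \<noteq> 0" "dint d $ fst f = 0"
    using f(3) by (auto simp: dint_nth)
  have ne: "p + dint f \<noteq> p" "p + dint f \<noteq> p + dint d" "p + dint d + dint f \<noteq> p"
    "p + dint d + dint f \<noteq> p + dint d" "p + dint f \<noteq> p + dint d + dint f"
  proof -
    have *: "a \<noteq> b" if "a $ i \<noteq> b $ i" for a b :: "int^3" and i using that by auto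
    show "p + dint f \<noteq> p" "p + dint d + dint f \<noteq> p" "p + dint d + dint f \<noteq> p + dint d"
      using *[of _ "fst f"] df by auto
    show "p + dint f \<noteq> p + dint d" by (rule *[of _ "fst f"]) (use df in auto)
    show "p + dint f \<noteq> p + dint d + dint f" by (rule *[of _ "fst d"]) (use df in auto)
  qed
  \<comment> \<open>The corners are given as a set, so a repetition in the list has to be excluded.
    If \<open>x = w\<close>, that set would be \<open>{x, u, v}\<close>, and both remaining points
    of the cell would project to \<open>v\<close>.\<close>
  have "x \<noteq> w"
  proof
    assume "x = w"
    then have "pr (p + dint f) \<in> {x, u, v}" "pr (p + dint d + dint f) \<in> {x, u, v}" using xf by auto
    then have "pr (p + dint f) = v" "pr (p + dint d + dint f) = v"
      using inj f p ne by (metis insertE empty_iff)+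
    then show False using inj f ne(5) by metis
  qed
  obtain p' d' e where q: "p' \<in> cell t" "x = pr p'" "u = pr (p' + dint d')" "w = pr (p' + dint d' + dint e)"
    "p' + dint d' \<in> cell t" "p' + dint d' + dint e \<in> cell t" "p' + dint e \<in> cell t"
    "fst d' \<noteq> snd t" "fst e \<noteq> snd t" "fst d' \<noteq> fst e" "square (ht x) d' e"
    by (rule tile_path_square[OF t(1,3,4) \<open>x \<noteq> w\<close>])
  have "p' = p" using inj p q by metis
  have "p' + dint d' = p + dint d" using inj p q by metis
  then have "dint d' = dint d" using \<open>p' = p\<close> by simp
  then have "dvec d' = dvec d" by (metis pr_dint)
  then have "d' = d" by (simp add: dvec_inj)
  have "fst e = fst f" using axes_UNIV[of "fst d" "snd t" c] c q \<open>d' = d\<close> p(3)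
    unfolding f_def by (metis UNIV_I empty_iff fst_conv insertE)
  have "e = f \<or> e = opp f" using same_axis \<open>fst e = fst f\<close> by blast
  moreover have "e \<noteq> opp f"
    using cell_dint[OF p(1), of e] cell_dint[OF p(1), of f] q f \<open>p' = p\<close> \<open>fst e = fst f\<close>
    by (auto split: if_splits)
  ultimately have "e = f" by blast
  then have "w = pr (p + dint d + dint f)" using q \<open>p' = p\<close> \<open>d' = d\<close> by simp
  then have "v = pr (p + dint f)" using xf(1) ne inj f p by (metis insertE empty_iff)
  then show "\<exists>d e. x \<in> rauzy_vertices \<and> square (ht x) d e \<and>
     u = x + dvec d \<and> v = x + dvec e \<and> w = x + dvec d + dvec e"
    using q \<open>p' = p\<close> \<open>d' = d\<close> \<open>e = f\<close> cell_height[OF t(1) p(1)] rauzy_vertices_iff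
    by (intro exI[of _ d] exI[of _ f]) (auto simp: pr_add)
next
  assume "\<exists>d e. x \<in> rauzy_vertices \<and> square (ht x) d e \<and>
     u = x + dvec d \<and> v = x + dvec e \<and> w = x + dvec d + dvec e"
  then show "rhombus x u w v" unfolding rhombus_def by (metis square_tile)
qed

section \<open>Path algebras and their quotients\<close>

abbreviation cf :: "('a \<Rightarrow>\<^sub>0 'b::zero) \<Rightarrow> 'a \<Rightarrow> 'b" where
  "cf \<equiv> Poly_Mapping.lookup"

abbreviation sg :: "'a \<Rightarrow> 'b::zero \<Rightarrow> 'a \<Rightarrow>\<^sub>0 'b" where
  "sg \<equiv> Poly_Mapping.single"

definition endv :: "('v, 'e) pre_digraph \<Rightarrow> 'v \<Rightarrow> 'e list \<Rightarrow> 'v" where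
  "endv Q u p = (if p = [] then u else head Q (last p))"

lemma awlast_eq: "pre_digraph.awlast Q u p = endv Q u p"
  by (simp add: endv_def pre_digraph.awalk_verts_conv)

lemma endv_append: "endv Q u (p @ q) = endv Q (endv Q u p) q"
  by (simp add: endv_def)

lemma endv_Nil [simp]: "endv Q u [] = u"
  by (simp add: endv_def)

lemma endv_Cons [simp]: "endv Q u (e # p) = endv Q (head Q e) p"
  by (simp add: endv_def)

text \<open>A coefficient of the product is a convolution over the places where the path can be cut.
  In this form, bilinearity and associativity follow by comparing coefficients.\<close>

lemma path_mult_lookup:
  "cf (path_mult Q f g) (u, p)
    = (\<Sum>i\<le>length p. cf f (u, take i p) * cf g (endv Q u (take i p), drop i p))"
proof -
  let ?F = "Poly_Mapping.keys f" and ?G = "Poly_Mapping.keys g"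
  define P where "P k l i \<longleftrightarrow> k = (u, take i p) \<and> l = (endv Q u (take i p), drop i p)" for k l i
  have inner: "cf (if endv Q u' p' = v then sg (u', p' @ q) (a * b) else 0) (u, p)
      = (\<Sum>i\<le>length p. if P (u', p') (v, q) i then a * b else 0)" for u' p' v q and a b :: 'a
  proof (cases "u' = u \<and> p = p' @ q \<and> v = endv Q u p'")
    case True
    have "P (u', p') (v, q) i \<longleftrightarrow> i = length p'" if "i \<le> length p" for i
    proof
      assume "P (u', p') (v, q) i"
      then have "length p' = length (take i p)" by (simp add: P_def)
      then show "i = length p'" using that by simp
    next
      assume "i = length p'"
      then show "P (u', p') (v, q) i" using True by (simp add: P_def)
    qed
    then have "(\<Sum>i\<le>length p. if P (u', p') (v, q) i then a * b else 0)
        = (\<Sum>i\<le>length p. if i = length p' then a * b else 0)"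
      by (intro sum.cong) auto
    then show ?thesis using True by (simp add: lookup_single)
  next
    case False
    then have "\<not> P (u', p') (v, q) i" for i unfolding P_def by auto
    then show ?thesis using False by (auto simp: lookup_single when_def)
  qed
  have "cf (path_mult Q f g) (u, p) = (\<Sum>k\<in>?F. \<Sum>l\<in>?G. \<Sum>i\<le>length p. if P k l i then cf f k * cf g l else 0)"
    unfolding path_mult_def awlast_eq
    unfolding lookup_sum split_def
    by (intro sum.cong refl) (subst inner, simp only: prod.collapse)
  also have "\<dots> = (\<Sum>i\<le>length p. \<Sum>k\<in>?F. \<Sum>l\<in>?G. if P k l i then cf f k * cf g l else 0)"
  proof -
    have "(\<Sum>l\<in>?G. \<Sum>i\<le>length p. if P k l i then cf f k * cf g l else 0)
        = (\<Sum>i\<le>length p. \<Sum>l\<in>?G. if P k l i then cf f k * cf g l else 0)" for k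
      by (rule sum.swap)
    then show ?thesis by (simp only:) (rule sum.swap)
  qed
  also have "\<dots> = (\<Sum>i\<le>length p. cf f (u, take i p) * cf g (endv Q u (take i p), drop i p))"
  proof (rule sum.cong[OF refl])
    fix i
    let ?k = "(u, take i p)" and ?l = "(endv Q u (take i p), drop i p)"
    have "(\<Sum>k\<in>?F. \<Sum>l\<in>?G. if P k l i then cf f k * cf g l else 0)
        = (\<Sum>k\<in>?F. if k = ?k then (\<Sum>l\<in>?G. if l = ?l then cf f k * cf g l else 0) else 0)"
      by (intro sum.cong) (auto simp: P_def)
    also have "\<dots> = cf f ?k * cf g ?l"
      by (simp add: sum.delta in_keys_iff)
    finally show "(\<Sum>k\<in>?F. \<Sum>l\<in>?G. if P k l i then cf f k * cf g l else 0) = cf f ?k * cf g ?l" .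
  qed
  finally show ?thesis .
qed

lemma path_mult_eqI: "(\<And>u p. cf f (u, p) = cf g (u, p)) \<Longrightarrow> f = g"
  by (intro poly_mapping_eqI) auto

lemma path_mult_add_left: "path_mult Q (f + g) h = path_mult Q f h + path_mult Q g h"
  by (rule path_mult_eqI) (simp add: path_mult_lookup lookup_add distrib_right sum.distrib)

lemma path_mult_add_right: "path_mult Q f (g + h) = path_mult Q f g + path_mult Q f h"
  by (rule path_mult_eqI) (simp add: path_mult_lookup lookup_add distrib_left sum.distrib)

lemma path_mult_zero [simp]: "path_mult Q 0 f = 0" "path_mult Q f 0 = 0"
  by (simp_all add: path_mult_def)

lemma path_mult_minus_left: "path_mult Q (- f) h = - path_mult Q f h"
  by (rule path_mult_eqI) (simp add: path_mult_lookup sum_negf)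

lemma path_mult_minus_right: "path_mult Q f (- h) = - path_mult Q f h"
  by (rule path_mult_eqI) (simp add: path_mult_lookup sum_negf)

lemma path_mult_diff_left: "path_mult Q (f - g) h = path_mult Q f h - path_mult Q g h"
  by (rule path_mult_eqI) (simp add: path_mult_lookup lookup_minus left_diff_distrib sum_subtractf)

lemma path_mult_diff_right: "path_mult Q f (g - h) = path_mult Q f g - path_mult Q f h"
  by (rule path_mult_eqI) (simp add: path_mult_lookup lookup_minus right_diff_distrib sum_subtractf)

lemma path_mult_single:
  "path_mult Q (sg (u, p) a) (sg (v, q) b) = (if endv Q u p = v then sg (u, p @ q) (a * b) else 0)"
  by (cases "a = 0"; cases "b = 0") (simp_all add: path_mult_def awlast_eq)

lemma path_mult_assoc:
  fixes f g h :: "('v, 'e) qpath \<Rightarrow>\<^sub>0 'k::field"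
  shows "path_mult Q (path_mult Q f g) h = path_mult Q f (path_mult Q g h)"
proof (rule path_mult_eqI)
  fix u :: 'v and p :: "'e list"
  let ?n = "length p"
  let ?t = "\<lambda>i j. cf f (u, take j p) * (cf g (endv Q u (take j p), take (i - j) (drop j p))
    * cf h (endv Q u (take i p), drop i p))"
  have "cf (path_mult Q (path_mult Q f g) h) (u, p) = (\<Sum>i\<le>?n. \<Sum>j\<le>i. ?t i j)"
    unfolding path_mult_lookup sum_distrib_right
  proof (rule sum.cong[OF refl])
    fix i assume "i \<in> {..?n}"
    then have i: "i \<le> ?n" by simp
    show "(\<Sum>j\<le>length (take i p). cf f (u, take j (take i p)) *
        cf g (endv Q u (take j (take i p)), drop j (take i p)) * cf h (endv Q u (take i p), drop i p))
      = (\<Sum>j\<le>i. ?t i j)"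
      using i by (intro sum.cong) (auto simp: min_def drop_take mult.assoc)
  qed
  also have "\<dots> = (\<Sum>(i, j)\<in>Sigma {..?n} (\<lambda>i. {..i}). ?t i j)"
    by (simp add: sum.Sigma)
  \<comment> \<open>A path is cut twice, at positions \<open>j \<le> i\<close>; the other bracketing
    counts the same cuts by \<open>j\<close> and the length \<open>l = i - j\<close> of the middle
    piece.\<close>
  also have "\<dots> = (\<Sum>(j, l)\<in>Sigma {..?n} (\<lambda>j. {..?n - j}). ?t (j + l) j)"
    by (rule sum.reindex_bij_witness[of _ "\<lambda>(j, l). (j + l, j)" "\<lambda>(i, j). (j, i - j)"]) auto
  also have "\<dots> = (\<Sum>j\<le>?n. \<Sum>l\<le>?n - j. ?t (j + l) j)"
    by (simp add: sum.Sigma)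
  also have "\<dots> = cf (path_mult Q f (path_mult Q g h)) (u, p)"
    unfolding path_mult_lookup sum_distrib_left
  proof (rule sum.cong[OF refl], rule sum.cong)
    fix j l assume "j \<in> {..?n}"
    have "endv Q (endv Q u (take j p)) (take l (drop j p)) = endv Q u (take (j + l) p)"
      unfolding take_add endv_append ..
    then show "?t (j + l) j = cf f (u, take j p) * (cf g (endv Q u (take j p), take l (drop j p)) *
        cf h (endv Q (endv Q u (take j p)) (take l (drop j p)), drop l (drop j p)))"
      by (simp add: add.commute)
  qed simp
  finally show "cf (path_mult Q (path_mult Q f g) h) (u, p)
    = cf (path_mult Q f (path_mult Q g h)) (u, p)" .
qed

lemma poly_mapping_sum_singles: "f = (\<Sum>k\<in>Poly_Mapping.keys f. sg k (cf f k))"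
proof (rule poly_mapping_eqI)
  fix k
  have "cf (\<Sum>k\<in>Poly_Mapping.keys f. sg k (cf f k)) k = (\<Sum>l\<in>Poly_Mapping.keys f. if l = k then cf f l else 0)"
    by (simp add: lookup_sum lookup_single when_def)
  then show "cf f k = cf (\<Sum>k\<in>Poly_Mapping.keys f. sg k (cf f k)) k"
    by (simp add: in_keys_iff)
qed

lemma poly_mapping_keys_induct [consumes 1, case_names zero add single]:
  fixes f :: "'a \<Rightarrow>\<^sub>0 'b::comm_monoid_add"
  assumes "Poly_Mapping.keys f \<subseteq> S"
    and "P 0" "\<And>f g. P f \<Longrightarrow> P g \<Longrightarrow> P (f + g)" "\<And>k c. k \<in> S \<Longrightarrow> P (sg k c)"
  shows "P f"
proof -
  have "P (\<Sum>k\<in>K. sg k (cf f k))" if "finite K" "K \<subseteq> S" for K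
    using that by (induction K rule: finite_induct) (auto intro: assms(2-4))
  from this[of "Poly_Mapping.keys f"] assms(1) show ?thesis
    using poly_mapping_sum_singles[of f] by simp
qed

lemma qpaths_append:
  assumes "(u, p) \<in> qpaths Q" "(endv Q u p, q) \<in> qpaths Q"
  shows "(u, p @ q) \<in> qpaths Q"
proof -
  have cas: "pre_digraph.cas Q u (p @ q) w \<longleftrightarrow> pre_digraph.cas Q u p v \<and> pre_digraph.cas Q v q w"
    if "v = endv Q u p" for u v w
    using that
  proof (induction p arbitrary: u)
    case Nil
    then show ?case by (simp add: pre_digraph.cas.simps)
  next
    case (Cons e p)
    then show ?case by (simp add: pre_digraph.cas.simps)
  qed
  have end_eq: "pre_digraph.cas Q u p v \<Longrightarrow> v = endv Q u p" for u v
    by (induction p arbitrary: u) (auto simp: pre_digraph.cas.simps)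
  show ?thesis using assms cas end_eq unfolding qpaths_def pre_digraph.awalk_def by fastforce
qed

abbreviation PA :: "('v, 'e) pre_digraph \<Rightarrow> (('v, 'e) qpath \<Rightarrow>\<^sub>0 'k::field) set" where
  "PA Q \<equiv> carrier (path_algebra Q)"

lemma PA_iff: "f \<in> PA Q \<longleftrightarrow> Poly_Mapping.keys f \<subseteq> qpaths Q"
  by (simp add: path_algebra_def)

lemma path_algebra_simps [simp]:
  "add (path_algebra Q) = (+)" "mult (path_algebra Q) = path_mult Q" "zero (path_algebra Q) = 0"
  by (simp_all add: path_algebra_def)

lemma PA_zero [simp]: "0 \<in> PA Q"
  by (simp add: PA_iff)

lemma PA_add: "f \<in> PA Q \<Longrightarrow> g \<in> PA Q \<Longrightarrow> f + g \<in> PA Q"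
  unfolding PA_iff using Poly_Mapping.keys_add[of f g] by blast

lemma PA_uminus: "f \<in> PA Q \<Longrightarrow> - f \<in> PA Q"
  by (simp add: PA_iff)

lemma PA_diff: "f \<in> PA Q \<Longrightarrow> g \<in> PA Q \<Longrightarrow> f - g \<in> PA Q"
  using PA_add[of f Q "- g"] PA_uminus[of g Q] by simp

lemma PA_single: "k \<in> qpaths Q \<Longrightarrow> sg k c \<in> PA Q"
  by (simp add: PA_iff)

lemma PA_mult: "f \<in> PA Q \<Longrightarrow> g \<in> PA Q \<Longrightarrow> path_mult Q f g \<in> PA Q"
proof -
  assume f: "f \<in> PA Q" and g: "g \<in> PA Q"
  have *: "path_mult Q (sg k c) g \<in> PA Q" if k: "k \<in> qpaths Q" for k c
    using g[unfolded PA_iff]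
  proof (induction rule: poly_mapping_keys_induct)
    case (single l d)
    then show ?case using k
      by (cases k; cases l) (auto simp: path_mult_single intro!: PA_single qpaths_append)
  qed (auto simp: path_mult_add_right intro: PA_add)
  show ?thesis using f[unfolded PA_iff]
    by (induction rule: poly_mapping_keys_induct) (auto simp: path_mult_add_left intro: PA_add *)
qed

lemma PA_abelian_group: "abelian_group (path_algebra Q)"
proof (rule abelian_groupI)
  fix f assume "f \<in> PA Q"
  then show "\<exists>g\<in>PA Q. g \<oplus>\<^bsub>path_algebra Q\<^esub> f = \<zero>\<^bsub>path_algebra Q\<^esub>"
    by (intro bexI[of _ "- f"]) (auto intro: PA_uminus)
qed (auto simp: PA_add add_ac)

lemma additive_subgroup_iff:
  assumes "abelian_group R"
  shows "additive_subgroup N R \<longleftrightarrow> N \<subseteq> carrier R \<and> \<zero>\<^bsub>R\<^esub> \<in> N \<and> (\<forall>x\<in>N. \<forall>y\<in>N. x \<oplus>\<^bsub>R\<^esub> y \<in> N)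
    \<and> (\<forall>x\<in>N. \<ominus>\<^bsub>R\<^esub> x \<in> N)"
  unfolding additive_subgroup_def subgroup_def a_inv_def by auto

lemma PA_a_inv: "f \<in> PA Q \<Longrightarrow> \<ominus>\<^bsub>path_algebra Q\<^esub> f = - f"
  by (rule abelian_group.minus_equality[OF PA_abelian_group]) (simp_all add: PA_uminus)

lemma two_sided_ideal_iff:
  "two_sided_ideal I (path_algebra Q) \<longleftrightarrow> I \<subseteq> PA Q \<and> 0 \<in> I \<and> (\<forall>f\<in>I. \<forall>g\<in>I. f + g \<in> I)
    \<and> (\<forall>f\<in>I. - f \<in> I) \<and> (\<forall>f\<in>I. \<forall>r\<in>PA Q. path_mult Q r f \<in> I \<and> path_mult Q f r \<in> I)"
  unfolding two_sided_ideal_def additive_subgroup_iff[OF PA_abelian_group]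
  by (auto simp: PA_a_inv subset_iff)

lemma ideal_gen_two_sided:
  assumes "S \<subseteq> PA Q"
  shows "two_sided_ideal (ideal_gen (path_algebra Q) S) (path_algebra Q)"
proof -
  have "two_sided_ideal (PA Q) (path_algebra Q)"
    unfolding two_sided_ideal_iff by (auto intro: PA_add PA_mult PA_uminus)
  then have "ideal_gen (path_algebra Q) S \<subseteq> PA Q" unfolding ideal_gen_def using assms by blast
  then show ?thesis unfolding two_sided_ideal_iff[of "ideal_gen (path_algebra Q) S"]
    by (auto simp: ideal_gen_def two_sided_ideal_iff)
qed

lemma ideal_gen_subset: "S \<subseteq> ideal_gen R S"
  by (auto simp: ideal_gen_def)

lemma ideal_gen_least: "two_sided_ideal J R \<Longrightarrow> S \<subseteq> J \<Longrightarrow> ideal_gen R S \<subseteq> J"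
  by (auto simp: ideal_gen_def)

text \<open>The second assumption makes the trivial path at the end of any path available; local
  units of the quotient are built from these.\<close>

locale path_quotient =
  fixes Q :: "('v, 'e) pre_digraph" and I :: "(('v, 'e) qpath \<Rightarrow>\<^sub>0 'k::field) set"
  assumes ideal: "two_sided_ideal I (path_algebra Q)"
    and endv_qpath: "(u, p) \<in> qpaths Q \<Longrightarrow> (endv Q u p, []) \<in> qpaths Q"
begin

lemma I_PA: "f \<in> I \<Longrightarrow> f \<in> PA Q"
  and I_0: "0 \<in> I"
  and I_add: "f \<in> I \<Longrightarrow> g \<in> I \<Longrightarrow> f + g \<in> I"
  and I_uminus: "f \<in> I \<Longrightarrow> - f \<in> I"
  and I_mult_left: "f \<in> I \<Longrightarrow> r \<in> PA Q \<Longrightarrow> path_mult Q r f \<in> I"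
  and I_mult_right: "f \<in> I \<Longrightarrow> r \<in> PA Q \<Longrightarrow> path_mult Q f r \<in> I"
  using ideal unfolding two_sided_ideal_iff by auto

lemma I_diff: "f \<in> I \<Longrightarrow> g \<in> I \<Longrightarrow> f - g \<in> I"
  using I_add[of f "- g"] I_uminus[of g] by simp

definition cls :: "(('v, 'e) qpath \<Rightarrow>\<^sub>0 'k) \<Rightarrow> (('v, 'e) qpath \<Rightarrow>\<^sub>0 'k) set" where
  "cls f = I +>\<^bsub>path_algebra Q\<^esub> f"

abbreviation A where "A \<equiv> path_algebra Q Quot I"

lemma cls_def': "cls f = {i + f | i. i \<in> I}"
  by (auto simp: cls_def a_r_coset_def r_coset_def)

lemma mem_cls: "g \<in> cls f \<longleftrightarrow> g - f \<in> I"
  unfolding cls_def' by (auto intro!: exI[of _ "g - f"])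

lemma cls_self: "f \<in> cls f"
  by (simp add: mem_cls I_0)

lemma cls_eq: "cls f = cls g \<longleftrightarrow> f - g \<in> I"
proof
  assume "cls f = cls g"
  then show "f - g \<in> I" using cls_self[of f] mem_cls by blast
next
  assume fg: "f - g \<in> I"
  have "h - f \<in> I \<longleftrightarrow> h - g \<in> I" for h
    using I_add[OF _ fg, of "h - f"] I_diff[OF _ fg, of "h - g"] by auto
  then show "cls f = cls g" by (auto simp: mem_cls)
qed

lemma A_carrier: "carrier A = cls ` PA Q"
  by (auto simp: FactRing_def A_RCOSETS_def' cls_def)

lemma cls_carrier [intro]: "f \<in> PA Q \<Longrightarrow> cls f \<in> carrier A"
  by (simp add: A_carrier)

lemma A_zero: "\<zero>\<^bsub>A\<^esub> = cls 0"
  by (simp add: FactRing_def cls_def')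

lemma cls_0: "cls f = cls 0 \<longleftrightarrow> f \<in> I"
  by (simp add: cls_eq)

lemma cls_add: "cls f \<oplus>\<^bsub>A\<^esub> cls g = cls (f + g)"
proof -
  have "cls f \<oplus>\<^bsub>A\<^esub> cls g = {(i + f) + (j + g) | i j. i \<in> I \<and> j \<in> I}"
    by (auto simp: FactRing_def set_add_def set_mult_def cls_def')
  also have "\<dots> = cls (f + g)"
  proof (intro equalityI subsetI)
    fix h assume "h \<in> {(i + f) + (j + g) | i j. i \<in> I \<and> j \<in> I}"
    then obtain i j where ij: "h = (i + f) + (j + g)" "i \<in> I" "j \<in> I" by blast
    have "h - (f + g) = i + j" by (simp add: ij(1))
    then show "h \<in> cls (f + g)" unfolding mem_cls using I_add ij by simp
  next
    fix h assume "h \<in> cls (f + g)"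
    then have "h = (h - (f + g) + f) + (0 + g)" "h - (f + g) \<in> I" by (auto simp: mem_cls)
    then show "h \<in> {(i + f) + (j + g) | i j. i \<in> I \<and> j \<in> I}" using I_0 by blast
  qed
  finally show ?thesis .
qed

lemma cls_mult:
  assumes "f \<in> PA Q" "g \<in> PA Q"
  shows "cls f \<otimes>\<^bsub>A\<^esub> cls g = cls (path_mult Q f g)"
proof -
  have eq: "cls (path_mult Q f' g') = cls (path_mult Q f g)" if "f' \<in> cls f" "g' \<in> cls g" for f' g'
  proof -
    have f': "f' - f \<in> I" "g' - g \<in> I" using that by (auto simp: mem_cls)
    have "f' \<in> PA Q" using PA_add[OF I_PA[OF f'(1)] assms(1)] by simp
    have "path_mult Q f' g' - path_mult Q f g = path_mult Q f' (g' - g) + path_mult Q (f' - f) g"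
      by (simp add: path_mult_diff_left path_mult_diff_right)
    also have "\<dots> \<in> I" using f' \<open>f' \<in> PA Q\<close> assms by (intro I_add I_mult_left I_mult_right)
    finally show ?thesis by (simp add: cls_eq)
  qed
  have "cls f \<otimes>\<^bsub>A\<^esub> cls g = (\<Union>f'\<in>cls f. \<Union>g'\<in>cls g. cls (path_mult Q f' g'))"
    by (simp add: FactRing_def rcoset_mult_def cls_def)
  also have "\<dots> = cls (path_mult Q f g)" using eq cls_self by blast
  finally show ?thesis .
qed

lemma cls_uminus_add: "cls (- f) \<oplus>\<^bsub>A\<^esub> cls f = \<zero>\<^bsub>A\<^esub>"
  by (simp add: cls_add A_zero)

lemma A_abelian_group: "abelian_group A"
proof (rule abelian_groupI)
  fix X assume "X \<in> carrier A"
  then show "\<exists>Y\<in>carrier A. Y \<oplus>\<^bsub>A\<^esub> X = \<zero>\<^bsub>A\<^esub>"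
    unfolding A_carrier using cls_uminus_add PA_uminus by blast
qed (auto simp: A_carrier A_zero cls_add add_ac intro!: imageI PA_add)

text \<open>A local right unit for \<open>f\<close>: the sum of the trivial paths at all end
  vertices that occur in \<open>f\<close>, each taken once. It witnesses that the regular module is
  unital.\<close>

definition endpoint_idem :: "(('v, 'e) qpath \<Rightarrow>\<^sub>0 'k) \<Rightarrow> (('v, 'e) qpath \<Rightarrow>\<^sub>0 'k)" where
  "endpoint_idem f = (\<Sum>v\<in>(\<lambda>(u, p). endv Q u p) ` Poly_Mapping.keys f. sg (v, []) 1)"

lemma endpoint_idem_lookup:
  "cf (endpoint_idem f) (v, q) = (if q = [] \<and> (\<exists>(u, p)\<in>Poly_Mapping.keys f. v = endv Q u p) then 1 else 0)"
proof -
  have "cf (endpoint_idem f) (v, q)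
      = (\<Sum>w\<in>(\<lambda>(u, p). endv Q u p) ` Poly_Mapping.keys f. if w = v then (if q = [] then 1 else 0) else 0)"
    unfolding endpoint_idem_def by (auto simp: lookup_sum lookup_single when_def intro!: sum.cong)
  then show ?thesis by (auto simp: split_beta)
qed

lemma mult_endpoint_idem: "path_mult Q f (endpoint_idem f) = f"
proof (rule path_mult_eqI)
  fix u :: 'v and p :: "'e list"
  have "cf (path_mult Q f (endpoint_idem f)) (u, p)
      = (\<Sum>i\<le>length p. if i = length p then cf f (u, p) * cf (endpoint_idem f) (endv Q u p, []) else 0)"
    unfolding path_mult_lookup by (intro sum.cong) (auto simp: endpoint_idem_lookup)
  also have "\<dots> = cf f (u, p)"
    by (cases "cf f (u, p) = 0") (auto simp: endpoint_idem_lookup in_keys_iff intro!: bexI[of _ "(u, p)"])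
  finally show "cf (path_mult Q f (endpoint_idem f)) (u, p) = cf f (u, p)" .
qed

lemma endpoint_idem_PA: "f \<in> PA Q \<Longrightarrow> endpoint_idem f \<in> PA Q"
proof -
  assume f: "f \<in> PA Q"
  have "cf (endpoint_idem f) k = 0" if "k \<notin> qpaths Q" for k
  proof (cases k)
    case (Pair v q)
    have "\<not> (q = [] \<and> (\<exists>(u, p)\<in>Poly_Mapping.keys f. v = endv Q u p))"
      using that f endv_qpath unfolding Pair PA_iff by auto
    then show ?thesis unfolding Pair endpoint_idem_lookup by simp
  qed
  then show ?thesis unfolding PA_iff by (metis in_keys_iff subsetI)
qed

lemma regular_right_module: "right_module A (regular_mod A)"
proof -
  interpret A: abelian_group A by (rule A_abelian_group)
  have "abelian_group (regular_mod A)"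
  proof (rule abelian_groupI)
    fix X assume "X \<in> carrier (regular_mod A)"
    then show "\<exists>Y\<in>carrier (regular_mod A). Y \<oplus>\<^bsub>regular_mod A\<^esub> X = \<zero>\<^bsub>regular_mod A\<^esub>"
      by (intro bexI[of _ "\<ominus>\<^bsub>A\<^esub> X"]) (simp_all add: regular_mod_def A.l_neg)
  qed (simp_all add: regular_mod_def A.a_ac)
  moreover have "\<exists>a\<in>carrier A. X \<otimes>\<^bsub>A\<^esub> a = X" if "X \<in> carrier A" for X
  proof -
    obtain f where f: "X = cls f" "f \<in> PA Q" using \<open>X \<in> carrier A\<close> A_carrier by auto
    then have "X \<otimes>\<^bsub>A\<^esub> cls (endpoint_idem f) = X"
      by (simp add: cls_mult endpoint_idem_PA mult_endpoint_idem)
    then show ?thesis using endpoint_idem_PA[OF f(2)] by blast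
  qed
  ultimately show ?thesis
    unfolding right_module_def right_module_axioms_def
    by (auto simp: regular_mod_def A_carrier cls_mult cls_add PA_mult PA_add path_mult_add_left
        path_mult_add_right path_mult_assoc intro!: imageI)
qed

end

section \<open>Right modules\<close>

lemma right_moduleI:
  assumes "abelian_group M"
    and "\<And>m a. m \<in> carrier M \<Longrightarrow> a \<in> carrier A \<Longrightarrow> m \<cdot>\<^bsub>M\<^esub> a \<in> carrier M"
    and "\<And>m m' a. m \<in> carrier M \<Longrightarrow> m' \<in> carrier M \<Longrightarrow> a \<in> carrier A \<Longrightarrow>
      (m \<oplus>\<^bsub>M\<^esub> m') \<cdot>\<^bsub>M\<^esub> a = m \<cdot>\<^bsub>M\<^esub> a \<oplus>\<^bsub>M\<^esub> m' \<cdot>\<^bsub>M\<^esub> a"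
    and "\<And>m a a'. m \<in> carrier M \<Longrightarrow> a \<in> carrier A \<Longrightarrow> a' \<in> carrier A \<Longrightarrow>
      m \<cdot>\<^bsub>M\<^esub> (a \<oplus>\<^bsub>A\<^esub> a') = m \<cdot>\<^bsub>M\<^esub> a \<oplus>\<^bsub>M\<^esub> m \<cdot>\<^bsub>M\<^esub> a'"
    and "\<And>m a a'. m \<in> carrier M \<Longrightarrow> a \<in> carrier A \<Longrightarrow> a' \<in> carrier A \<Longrightarrow>
      m \<cdot>\<^bsub>M\<^esub> (a \<otimes>\<^bsub>A\<^esub> a') = (m \<cdot>\<^bsub>M\<^esub> a) \<cdot>\<^bsub>M\<^esub> a'"
    and "\<And>m. m \<in> carrier M \<Longrightarrow> \<exists>a\<in>carrier A. m \<cdot>\<^bsub>M\<^esub> a = m"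
  shows "right_module A M"
  using assms unfolding right_module_def right_module_axioms_def by blast

lemma submod_iff:
  assumes "abelian_group M"
  shows "submod A N M \<longleftrightarrow> N \<subseteq> carrier M \<and> \<zero>\<^bsub>M\<^esub> \<in> N \<and> (\<forall>x\<in>N. \<forall>y\<in>N. x \<oplus>\<^bsub>M\<^esub> y \<in> N)
    \<and> (\<forall>x\<in>N. \<ominus>\<^bsub>M\<^esub> x \<in> N) \<and> (\<forall>m\<in>N. \<forall>a\<in>carrier A. m \<cdot>\<^bsub>M\<^esub> a \<in> N)"
  unfolding submod_def additive_subgroup_iff[OF assms] by blast

lemma restrict_mod_simps [simp]:
  "carrier (restrict_mod M N) = N" "zero (restrict_mod M N) = zero M"
  "add (restrict_mod M N) = add M" "ract (restrict_mod M N) = ract M"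
  by (simp_all add: restrict_mod_def)

lemma restrict_right_module:
  assumes M: "right_module A M" and N: "submod A N M"
  shows "right_module A (restrict_mod M N)"
proof -
  interpret right_module A M by (rule M)
  note N' = N[unfolded submod_iff[OF abelian_group_axioms]]
  have sub: "x \<in> N \<Longrightarrow> x \<in> carrier M" for x using N' by blast
  have "abelian_group (restrict_mod M N)"
  proof (rule abelian_groupI)
    fix x assume "x \<in> carrier (restrict_mod M N)"
    then show "\<exists>y\<in>carrier (restrict_mod M N). y \<oplus>\<^bsub>restrict_mod M N\<^esub> x = \<zero>\<^bsub>restrict_mod M N\<^esub>"
      using N' sub by (intro bexI[of _ "\<ominus>\<^bsub>M\<^esub> x"]) (auto simp: l_neg)
  qed (use N' sub in \<open>auto simp: a_ac\<close>)
  then show ?thesis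
  proof (rule right_moduleI)
    fix m assume "m \<in> carrier (restrict_mod M N)"
    then show "\<exists>a\<in>carrier A. m \<cdot>\<^bsub>restrict_mod M N\<^esub> a = m" using ract_unital sub by simp
  qed (use N' sub ract_add_left ract_add_right ract_assoc in auto)
qed

lemma restrict_a_inv:
  assumes "abelian_group M" "abelian_group (restrict_mod M N)" "N \<subseteq> carrier M" "x \<in> N"
  shows "\<ominus>\<^bsub>restrict_mod M N\<^esub> x = \<ominus>\<^bsub>M\<^esub> x"
proof -
  interpret M: abelian_group M by fact
  interpret N: abelian_group "restrict_mod M N" by fact
  have x: "x \<in> carrier M" "x \<in> carrier (restrict_mod M N)" using assms by auto
  have "\<ominus>\<^bsub>restrict_mod M N\<^esub> x \<in> carrier M" using N.a_inv_closed[OF x(2)] assms(3) by auto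
  moreover have "\<ominus>\<^bsub>restrict_mod M N\<^esub> x \<oplus>\<^bsub>M\<^esub> x = \<zero>\<^bsub>M\<^esub>" using N.l_neg[OF x(2)] by simp
  ultimately have "\<ominus>\<^bsub>M\<^esub> x = \<ominus>\<^bsub>restrict_mod M N\<^esub> x" using x(1) by (intro M.minus_equality)
  then show ?thesis by (rule sym)
qed

lemma restrict_submod:
  assumes "right_module A M" "submod A N M" "submod A N' M" "N \<subseteq> N'"
  shows "submod A N (restrict_mod M N')"
proof -
  have ag: "abelian_group M" "abelian_group (restrict_mod M N')"
    using right_module.axioms(1)[OF assms(1)]
      right_module.axioms(1)[OF restrict_right_module[OF assms(1,3)]] .
  have "N' \<subseteq> carrier M" using assms(3) unfolding submod_iff[OF ag(1)] by simp
  then have "\<ominus>\<^bsub>restrict_mod M N'\<^esub> x = \<ominus>\<^bsub>M\<^esub> x" if "x \<in> N" for x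
    using restrict_a_inv[OF ag] that assms(4) by blast
  then show ?thesis using assms(2,4) unfolding submod_iff[OF ag(1)] submod_iff[OF ag(2)] by simp
qed

context
  fixes A :: "'a ring" and M :: "('a, 'm) rmod" and N :: "'m set"
  assumes M: "right_module A M" and N: "submod A N M"
    and A_closed: "\<And>a b. a \<in> carrier A \<Longrightarrow> b \<in> carrier A \<Longrightarrow> a \<oplus>\<^bsub>A\<^esub> b \<in> carrier A"
      "\<And>a b. a \<in> carrier A \<Longrightarrow> b \<in> carrier A \<Longrightarrow> a \<otimes>\<^bsub>A\<^esub> b \<in> carrier A"
begin

interpretation right_module A M by (rule M)

interpretation abelian_subgroup N M
  using N abelian_subgroupI3[OF _ abelian_group_axioms] by (simp add: submod_def)

lemma quot_carrier: "carrier (quot_mod M N) = (\<lambda>m. N +>\<^bsub>M\<^esub> m) ` carrier M"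
  by (auto simp: quot_mod_def A_RCOSETS_def')

lemma quot_add: "m \<in> carrier M \<Longrightarrow> m' \<in> carrier M \<Longrightarrow>
    (N +>\<^bsub>M\<^esub> m) \<oplus>\<^bsub>quot_mod M N\<^esub> (N +>\<^bsub>M\<^esub> m') = N +>\<^bsub>M\<^esub> (m \<oplus>\<^bsub>M\<^esub> m')"
  by (simp add: quot_mod_def a_rcos_sum)

lemma quot_coset_eq: "m \<in> carrier M \<Longrightarrow> m' \<in> N +>\<^bsub>M\<^esub> m \<Longrightarrow> N +>\<^bsub>M\<^esub> m' = N +>\<^bsub>M\<^esub> m"
  using a_repr_independence[OF _ _ a_subgroup] by metis

lemma quot_ract:
  assumes m: "m \<in> carrier M" and a: "a \<in> carrier A"
  shows "(N +>\<^bsub>M\<^esub> m) \<cdot>\<^bsub>quot_mod M N\<^esub> a = N +>\<^bsub>M\<^esub> (m \<cdot>\<^bsub>M\<^esub> a)"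
proof -
  have "N +>\<^bsub>M\<^esub> (m' \<cdot>\<^bsub>M\<^esub> a) = N +>\<^bsub>M\<^esub> (m \<cdot>\<^bsub>M\<^esub> a)" if m': "m' \<in> N +>\<^bsub>M\<^esub> m" for m'
  proof -
    obtain h where h: "h \<in> N" "m' = h \<oplus>\<^bsub>M\<^esub> m" using m' by (auto simp: a_r_coset_def')
    then have "m' \<cdot>\<^bsub>M\<^esub> a = h \<cdot>\<^bsub>M\<^esub> a \<oplus>\<^bsub>M\<^esub> m \<cdot>\<^bsub>M\<^esub> a" using ract_add_left m a by simp
    moreover have "h \<cdot>\<^bsub>M\<^esub> a \<in> N" using N h(1) a by (simp add: submod_def)
    ultimately have "m' \<cdot>\<^bsub>M\<^esub> a \<in> N +>\<^bsub>M\<^esub> (m \<cdot>\<^bsub>M\<^esub> a)" by (auto simp: a_r_coset_def')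
    then show ?thesis using quot_coset_eq ract_closed m a by blast
  qed
  moreover have "m \<in> N +>\<^bsub>M\<^esub> m" using m by (rule a_rcos_self)
  ultimately have "(\<Union>m'\<in>N +>\<^bsub>M\<^esub> m. N +>\<^bsub>M\<^esub> (m' \<cdot>\<^bsub>M\<^esub> a)) = N +>\<^bsub>M\<^esub> (m \<cdot>\<^bsub>M\<^esub> a)"
    by (intro UN_constant_eq) blast+
  then show ?thesis by (simp add: quot_mod_def)
qed

lemma quot_right_module: "right_module A (quot_mod M N)"
proof (rule right_moduleI)
  show "abelian_group (quot_mod M N)"
  proof (rule abelian_groupI)
    have z: "\<zero>\<^bsub>quot_mod M N\<^esub> = N +>\<^bsub>M\<^esub> \<zero>\<^bsub>M\<^esub>"
      using a_coset_add_zero[OF a_subset] by (simp add: quot_mod_def)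
    show "\<zero>\<^bsub>quot_mod M N\<^esub> \<in> carrier (quot_mod M N)" by (simp add: z quot_carrier)
    fix X assume "X \<in> carrier (quot_mod M N)"
    then obtain m where m: "m \<in> carrier M" "X = N +>\<^bsub>M\<^esub> m" by (auto simp: quot_carrier)
    show "\<zero>\<^bsub>quot_mod M N\<^esub> \<oplus>\<^bsub>quot_mod M N\<^esub> X = X" using m by (simp add: z quot_add)
    have "(N +>\<^bsub>M\<^esub> (\<ominus>\<^bsub>M\<^esub> m)) \<oplus>\<^bsub>quot_mod M N\<^esub> X = \<zero>\<^bsub>quot_mod M N\<^esub>"
      using m by (simp add: z quot_add l_neg)
    then show "\<exists>Y\<in>carrier (quot_mod M N). Y \<oplus>\<^bsub>quot_mod M N\<^esub> X = \<zero>\<^bsub>quot_mod M N\<^esub>"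
      using m by (intro bexI[of _ "N +>\<^bsub>M\<^esub> (\<ominus>\<^bsub>M\<^esub> m)"]) (auto simp: quot_carrier)
  qed (auto simp: quot_carrier quot_add a_ac)
next
  fix X assume "X \<in> carrier (quot_mod M N)"
  then obtain m where m: "m \<in> carrier M" "X = N +>\<^bsub>M\<^esub> m" by (auto simp: quot_carrier)
  obtain a where "a \<in> carrier A" "m \<cdot>\<^bsub>M\<^esub> a = m" using ract_unital[OF m(1)] by blast
  then show "\<exists>a\<in>carrier A. X \<cdot>\<^bsub>quot_mod M N\<^esub> a = X" using m quot_ract by metis
qed (auto simp: quot_carrier quot_add quot_ract ract_closed ract_add_left ract_add_right ract_assoc A_closed)

text \<open>First isomorphism theorem. The induced map applies \<open>g\<close> to an arbitrarily
  chosen member of a coset; \<open>g\<close> is constant on cosets because \<open>N\<close> is its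
  kernel.\<close>

lemma quot_iso:
  assumes G: "abelian_group L" and g: "g \<in> mod_hom A M L" "g ` carrier M = carrier L"
    and K: "N = a_kernel M L g"
  shows "mod_iso A (quot_mod M N) L"
proof -
  interpret L: abelian_group L by (rule G)
  have gc: "g m \<in> carrier L" if "m \<in> carrier M" for m using g(2) that by blast
  have ga: "g (m \<oplus>\<^bsub>M\<^esub> m') = g m \<oplus>\<^bsub>L\<^esub> g m'" if "m \<in> carrier M" "m' \<in> carrier M" for m m'
    using g(1) that unfolding mod_hom_def hom_def by simp
  have gr: "g (m \<cdot>\<^bsub>M\<^esub> a) = g m \<cdot>\<^bsub>L\<^esub> a" if "m \<in> carrier M" "a \<in> carrier A" for m a
    using g(1) that by (simp add: mod_hom_def)
  have ker: "m \<in> N \<longleftrightarrow> m \<in> carrier M \<and> g m = \<zero>\<^bsub>L\<^esub>" for m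
    unfolding K a_kernel_def kernel_def by simp
  define \<phi> where "\<phi> X = g (SOME m. m \<in> X)" for X
  have gX: "g m' = g m" if gm: "m \<in> carrier M" "m' \<in> N +>\<^bsub>M\<^esub> m" for m m'
  proof -
    obtain h where h: "h \<in> N" "m' = h \<oplus>\<^bsub>M\<^esub> m" using gm(2) by (auto simp: a_r_coset_def')
    then show ?thesis using ga[of h m] ker gm(1) gc by simp
  qed
  have \<phi>: "\<phi> (N +>\<^bsub>M\<^esub> m) = g m" if "m \<in> carrier M" for m
    unfolding \<phi>_def using gX[OF that someI[of "\<lambda>m'. m' \<in> N +>\<^bsub>M\<^esub> m", OF a_rcos_self[OF that]]] .
  have inj: "N +>\<^bsub>M\<^esub> m = N +>\<^bsub>M\<^esub> m'" if mm: "m \<in> carrier M" "m' \<in> carrier M" "g m = g m'" for m m'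
  proof -
    have "g (m \<oplus>\<^bsub>M\<^esub> \<ominus>\<^bsub>M\<^esub> m') \<oplus>\<^bsub>L\<^esub> g m' = g m"
      using ga[of "m \<oplus>\<^bsub>M\<^esub> \<ominus>\<^bsub>M\<^esub> m'" m'] mm by (simp add: a_assoc l_neg)
    then have "g (m \<oplus>\<^bsub>M\<^esub> \<ominus>\<^bsub>M\<^esub> m') \<oplus>\<^bsub>L\<^esub> g m' = \<zero>\<^bsub>L\<^esub> \<oplus>\<^bsub>L\<^esub> g m'"
      unfolding L.l_zero[OF gc[OF mm(2)]] using mm(3) by (rule trans)
    then have "g (m \<oplus>\<^bsub>M\<^esub> \<ominus>\<^bsub>M\<^esub> m') = \<zero>\<^bsub>L\<^esub>"
      by (rule L.add.right_cancel[THEN iffD1, rotated 3]) (use mm gc in simp_all)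
    then have "m \<oplus>\<^bsub>M\<^esub> \<ominus>\<^bsub>M\<^esub> m' \<in> N" using ker mm by simp
    then have "(m \<oplus>\<^bsub>M\<^esub> \<ominus>\<^bsub>M\<^esub> m') \<oplus>\<^bsub>M\<^esub> m' \<in> N +>\<^bsub>M\<^esub> m'"
      unfolding a_r_coset_def' by (intro UN_I) simp_all
    moreover have "(m \<oplus>\<^bsub>M\<^esub> \<ominus>\<^bsub>M\<^esub> m') \<oplus>\<^bsub>M\<^esub> m' = m" using mm by (simp add: a_assoc l_neg)
    ultimately have "m \<in> N +>\<^bsub>M\<^esub> m'" by simp
    then show ?thesis by (rule quot_coset_eq[OF mm(2)])
  qed
  have "\<phi> \<in> mod_hom A (quot_mod M N) L"
  proof -
    have "\<phi> X \<in> carrier L" if X: "X \<in> carrier (quot_mod M N)" for X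
    proof -
      obtain m where "m \<in> carrier M" "X = N +>\<^bsub>M\<^esub> m" using X unfolding quot_carrier by blast
      then show ?thesis by (simp add: \<phi> gc)
    qed
    moreover have "\<phi> (X \<oplus>\<^bsub>quot_mod M N\<^esub> Y) = \<phi> X \<oplus>\<^bsub>L\<^esub> \<phi> Y"
      if XY: "X \<in> carrier (quot_mod M N)" "Y \<in> carrier (quot_mod M N)" for X Y
    proof -
      obtain m m' where "m \<in> carrier M" "X = N +>\<^bsub>M\<^esub> m" "m' \<in> carrier M" "Y = N +>\<^bsub>M\<^esub> m'"
        using XY(1,2) unfolding quot_carrier by blast
      then show ?thesis by (simp add: quot_add \<phi> ga)
    qed
    moreover have "\<phi> (X \<cdot>\<^bsub>quot_mod M N\<^esub> a) = \<phi> X \<cdot>\<^bsub>L\<^esub> a"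
      if Xa: "X \<in> carrier (quot_mod M N)" "a \<in> carrier A" for X a
    proof -
      obtain m where "m \<in> carrier M" "X = N +>\<^bsub>M\<^esub> m" using Xa(1) unfolding quot_carrier by blast
      then show ?thesis using Xa(2) by (simp add: quot_ract \<phi> gr ract_closed)
    qed
    ultimately show ?thesis unfolding mod_hom_def hom_def by simp
  qed
  moreover have "bij_betw \<phi> (carrier (quot_mod M N)) (carrier L)"
    unfolding bij_betw_def
  proof
    show "inj_on \<phi> (carrier (quot_mod M N))"
    proof (rule inj_onI)
      fix X Y assume XY: "X \<in> carrier (quot_mod M N)" "Y \<in> carrier (quot_mod M N)" "\<phi> X = \<phi> Y"
      obtain m m' where m: "m \<in> carrier M" "X = N +>\<^bsub>M\<^esub> m" "m' \<in> carrier M" "Y = N +>\<^bsub>M\<^esub> m'"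
        using XY(1,2) unfolding quot_carrier by blast
      then show "X = Y" using inj[of m m'] XY(3) by (simp add: \<phi>)
    qed
    show "\<phi> ` carrier (quot_mod M N) = carrier L"
      unfolding quot_carrier image_image g(2)[symmetric] by (rule image_cong) (simp_all add: \<phi>)
  qed
  ultimately show ?thesis unfolding mod_iso_def by blast
qed

end

section \<open>Paths in the Rauzy quiver as words in directions\<close>

abbreviation RQ where "RQ \<equiv> rauzy_quiver"

primrec walk :: "point \<Rightarrow> dir list \<Rightarrow> (point \<times> point) list" where
  "walk p [] = []"
| "walk p (d # ds) = (p, p + dvec d) # walk (p + dvec d) ds"

primrec dest :: "point \<Rightarrow> dir list \<Rightarrow> point" where
  "dest p [] = p"
| "dest p (d # ds) = dest (p + dvec d) ds"

primrec valid :: "point \<Rightarrow> dir list \<Rightarrow> bool" where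
  "valid p [] \<longleftrightarrow> p \<in> rauzy_vertices"
| "valid p (d # ds) \<longleftrightarrow> valid_step p d \<and> valid (p + dvec d) ds"

primrec hvalid :: "real \<Rightarrow> dir list \<Rightarrow> bool" where
  "hvalid h [] \<longleftrightarrow> slab h"
| "hvalid h (d # ds) \<longleftrightarrow> slab h \<and> hvalid (h + dht d) ds"

lemma hvalid_slab: "hvalid h ds \<Longrightarrow> slab h"
  by (cases ds) auto

text \<open>Whether a word is a path of the quiver depends on the starting vertex through its height
  alone. Existence of paths thus becomes arithmetic on partial sums of weights.\<close>

lemma valid_iff: "valid p ds \<longleftrightarrow> p \<in> rauzy_vertices \<and> hvalid (ht p) ds"
proof (induction ds arbitrary: p)
  case Nil
  then show ?case using slab_ht by auto
next
  case (Cons d ds)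
  show ?case
  proof (cases "valid_step p d")
    case True
    then show ?thesis using Cons.IH[of "p + dvec d"] valid_stepD[OF True] slab_ht by simp
  next
    case False
    then show ?thesis using hvalid_slab by (auto simp: valid_step_def)
  qed
qed

lemma valid_vertex: "valid p ds \<Longrightarrow> p \<in> rauzy_vertices"
  by (simp add: valid_iff)

lemma dest_append [simp]: "dest p (ds @ es) = dest (dest p ds) es"
  by (induction ds arbitrary: p) auto

lemma walk_append: "walk p (ds @ es) = walk p ds @ walk (dest p ds) es"
  by (induction ds arbitrary: p) auto

lemma valid_append: "valid p (ds @ es) \<longleftrightarrow> valid p ds \<and> valid (dest p ds) es"
  using valid_vertex by (induction ds arbitrary: p) auto

lemma valid_dest: "valid p ds \<Longrightarrow> dest p ds \<in> rauzy_vertices"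
  by (induction ds arbitrary: p) auto

lemma walk_inj: "walk p ds = walk p es \<longleftrightarrow> ds = es"
proof (induction ds arbitrary: p es)
  case Nil
  then show ?case by (cases es) auto
next
  case (Cons d ds)
  then show ?case by (cases es) (auto simp: dvec_inj)
qed

lemma RQ_simps [simp]: "head RQ e = snd e" "tail RQ e = fst e" "verts RQ = rauzy_vertices"
  "e \<in> arcs RQ \<longleftrightarrow> {fst e, snd e} \<in> rauzy_edges"
  by (auto simp: rauzy_quiver_def)

lemma endv_walk: "endv RQ p (walk p ds) = dest p ds"
  by (induction ds arbitrary: p) auto

lemma qpaths_iff: "(p, es) \<in> qpaths RQ \<longleftrightarrow> (\<exists>ds. valid p ds \<and> es = walk p ds)"
proof -
  have "(\<exists>v. p \<in> rauzy_vertices \<and> set es \<subseteq> arcs RQ \<and> pre_digraph.cas RQ p es v)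
    \<longleftrightarrow> (\<exists>ds. valid p ds \<and> es = walk p ds)"
  proof (induction es arbitrary: p)
    case Nil
    have "(\<exists>ds. valid p ds \<and> [] = walk p ds) \<longleftrightarrow> valid p []"
      by (metis walk_inj walk.simps(1))
    then show ?case by (simp add: pre_digraph.cas.simps)
  next
    case (Cons e es)
    obtain a b where e: "e = (a, b)" by force
    have "(\<exists>v. p \<in> rauzy_vertices \<and> set (e # es) \<subseteq> arcs RQ \<and> pre_digraph.cas RQ p (e # es) v)
      \<longleftrightarrow> p \<in> rauzy_vertices \<and> a = p \<and> {p, b} \<in> rauzy_edges
        \<and> (\<exists>v. b \<in> rauzy_vertices \<and> set es \<subseteq> arcs RQ \<and> pre_digraph.cas RQ b es v)"
      using valid_stepD edge_iff by (auto simp: e pre_digraph.cas.simps)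
    also have "\<dots> \<longleftrightarrow> a = p \<and> (\<exists>d. valid_step p d \<and> b = p + dvec d) \<and> (\<exists>ds. valid b ds \<and> es = walk b ds)"
      unfolding Cons.IH edge_iff using valid_stepD by blast
    also have "\<dots> \<longleftrightarrow> (\<exists>d ds. valid p (d # ds) \<and> e # es = walk p (d # ds))"
      by (auto simp: e)
    also have "\<dots> \<longleftrightarrow> (\<exists>ds. valid p ds \<and> e # es = walk p ds)"
    proof
      assume "\<exists>ds. valid p ds \<and> e # es = walk p ds"
      then obtain ds where ds: "valid p ds" "e # es = walk p ds" by blast
      then obtain d ds' where "ds = d # ds'" by (cases ds) auto
      then show "\<exists>d ds. valid p (d # ds) \<and> e # es = walk p (d # ds)" using ds by blast
    qed blast
    finally show ?case .
  qed
  then show ?thesis unfolding qpaths_def pre_digraph.awalk_def by auto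
qed

text \<open>A word that leaves the slab of heights stands for zero. With this convention steps along
  different axes commute modulo the relations without exception, see \<open>eqv_swap\<close>.\<close>

definition wpath :: "'k::field \<Rightarrow> point \<Rightarrow> dir list \<Rightarrow> 'k rauzy_paths" where
  "wpath c p ds = (if valid p ds then sg (p, walk p ds) c else 0)"

lemma wpath_PA [simp]: "wpath c p ds \<in> PA RQ"
  by (auto simp: wpath_def qpaths_iff intro!: PA_single)

lemma wpath_mult: "path_mult RQ (wpath a p ds) (wpath b q es) = (if q = dest p ds then wpath (a * b) p (ds @ es) else 0)"
  by (auto simp: wpath_def path_mult_single endv_walk valid_append walk_append)

lemma wpath_add: "wpath (a + b) p ds = wpath a p ds + wpath b p ds"
  by (simp add: wpath_def single_add)

lemma wpath_0 [simp]: "wpath 0 p ds = 0"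
  by (simp add: wpath_def)

lemma PA_RQ_induct [consumes 1, case_names zero add wpath]:
  assumes "f \<in> PA RQ" "P 0" "\<And>f g. P f \<Longrightarrow> P g \<Longrightarrow> P (f + g)" "\<And>c p ds. valid p ds \<Longrightarrow> P (wpath c p ds)"
  shows "P f"
  using assms(1)[unfolded PA_iff]
proof (induction rule: poly_mapping_keys_induct)
  case (single k c)
  obtain p ds where "k = (p, walk p ds)" "valid p ds" using single qpaths_iff by (cases k) auto
  then show ?case using assms(4)[of p ds c] by (simp add: wpath_def)
qed (use assms in auto)

lemma path2_wpath: "valid x [d, e] \<Longrightarrow> path2 x (x + dvec d) (x + dvec d + dvec e) = wpath 1 x [d, e]"
  by (simp add: path2_def wpath_def)

lemma valid_2: "valid x [d, e] \<longleftrightarrow> valid_step x d \<and> valid_step (x + dvec d) e"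
  using valid_stepD(2)[of "x + dvec d" e] by auto

lemma square_valid: "square (ht x) d e \<Longrightarrow> x \<in> rauzy_vertices \<Longrightarrow> valid x [d, e]"
  by (simp add: valid_iff square_def)

lemma valid_back: "valid_step x d \<Longrightarrow> valid x [d, opp d]"
  using slab_ht valid_stepD(1) by (auto simp: valid_iff valid_step_def)

lemma not_tile_path:
  assumes "valid x [d, e]" "e \<noteq> opp d" "\<not> square (ht x) d e"
  shows "x \<noteq> x + dvec d + dvec e"
    and "\<not> (\<exists>t\<in>rauzy_tiling. {x, x + dvec d} \<in> tile_edges t \<and> {x + dvec d, x + dvec d + dvec e} \<in> tile_edges t)"
proof -
  show ne: "x \<noteq> x + dvec d + dvec e"
  proof
    assume "x = x + dvec d + dvec e"
    then have "dvec e = dvec (opp d)" by (simp add: eq_neg_iff_add_eq_0 add.assoc add.commute)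
    then show False using assms(2) dvec_inj by blast
  qed
  show "\<not> (\<exists>t\<in>rauzy_tiling. {x, x + dvec d} \<in> tile_edges t \<and> {x + dvec d, x + dvec d + dvec e} \<in> tile_edges t)"
  proof
    assume "\<exists>t\<in>rauzy_tiling. {x, x + dvec d} \<in> tile_edges t \<and> {x + dvec d, x + dvec d + dvec e} \<in> tile_edges t"
    then obtain t where t: "t \<in> stepped_surface" "{x, x + dvec d} \<in> tile_edges t"
      "{x + dvec d, x + dvec d + dvec e} \<in> tile_edges t" unfolding rauzy_tiling_eq by blast
    from tile_path_square[OF t ne] obtain q d' e' where q: "x = pr q" "x + dvec d = pr (q + dint d')"
      "x + dvec d + dvec e = pr (q + dint d' + dint e')" "square (ht x) d' e'" by metis
    then have "d' = d" "e' = e" by (auto simp: pr_add dvec_inj)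
    then show False using q(4) assms(3) by simp
  qed
qed

lemma out_back_wpath: "out_back z (z + dvec d) = wpath 1 z [d, opp d]"
proof (cases "valid_step z d")
  case True
  then have "{z, z + dvec d} \<in> rauzy_edges" using edge_iff by blast
  then show ?thesis using path2_wpath[OF valid_back[OF True]] by (simp add: out_back_def)
next
  case False
  then have "{z, z + dvec d} \<notin> rauzy_edges" using edge_iff dvec_inj by auto
  then show ?thesis using False by (simp add: out_back_def wpath_def)
qed

lemma map_wpath_diff:
  "Poly_Mapping.map ((*) c) (wpath a p ds - wpath b q es) = wpath (c * a) p ds - wpath (c * b) q es"
  by (rule poly_mapping_eqI)
    (simp add: Poly_Mapping.map.rep_eq wpath_def lookup_minus lookup_single when_def algebra_simps)

lemma signed_D_wpath:
  fixes s :: "3 \<Rightarrow> point \<Rightarrow> 'k::field"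
  shows "signed_D s a z = wpath (s a z) z [(a, True), (a, False)] - wpath (s a z) z [(a, False), (a, True)]"
proof -
  have pe: "z + pe a = z + dvec (a, True)" "z - pe a = z + dvec (a, False)" by (auto simp: dvec_def)
  have D: "(rauzy_D a z :: 'k rauzy_paths)
      = wpath 1 z [(a, True), (a, False)] - wpath 1 z [(a, False), (a, True)]"
    unfolding rauzy_D_def pe out_back_wpath by simp
  show ?thesis unfolding signed_D_def D map_wpath_diff by simp
qed

text \<open>The generators of the ideal rewritten as words. In the square case only the difference
  of the axes is recorded: the linear form constructed later is invariant under all such exchanges,
  whether or not there is a rhombus.\<close>

lemma rauzy_relations_cases [consumes 1, case_names zero square loops]:
  fixes s :: "3 \<Rightarrow> point \<Rightarrow> 'k::field"
  assumes "r \<in> rauzy_relations s"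
  obtains x d e where "r = wpath 1 x [d, e]" "x \<in> rauzy_vertices" "e \<noteq> opp d" "\<not> square (ht x) d e"
    | x d e where "r = wpath 1 x [d, e] - wpath 1 x [e, d]" "x \<in> rauzy_vertices" "fst d \<noteq> fst e"
    | x a c where "r = (wpath (s a x) x [(a, True), (a, False)] - wpath (s a x) x [(a, False), (a, True)])
        - (wpath (s c x) x [(c, True), (c, False)] - wpath (s c x) x [(c, False), (c, True)])"
      "x \<in> rauzy_vertices"
  using assms
proof cases
  case (zero_path x u w)
  obtain d where d: "valid_step x d" "u = x + dvec d" using zero_path edge_iff by blast
  obtain e where e: "valid_step u e" "w = u + dvec e" using zero_path edge_iff by blast
  have v: "valid x [d, e]" unfolding valid_2 using d e by simp
  have "\<not> square (ht x) d e"
  proof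
    assume "square (ht x) d e"
    from square_tile[OF valid_vertex[OF v] this] show False using zero_path d e by metis
  qed
  moreover have "e \<noteq> opp d" using zero_path(4) d e by auto
  ultimately show ?thesis using that(1)[of x d e] zero_path(1) d e path2_wpath[OF v] valid_vertex[OF v] by simp
next
  case (commutative_square x u w v)
  obtain d e where de: "x \<in> rauzy_vertices" "square (ht x) d e" "u = x + dvec d" "v = x + dvec e"
    "w = x + dvec d + dvec e" using commutative_square(2) rhombus_iff by blast
  have "(path2 x u w :: 'k rauzy_paths) = wpath 1 x [d, e]" using path2_wpath[OF square_valid[OF de(2,1)]] de by simp
  moreover have "(path2 x v w :: 'k rauzy_paths) = wpath 1 x [e, d]"
    using path2_wpath[OF square_valid[of x e d]] de square_commute by (simp add: add_ac)
  ultimately have "r = wpath 1 x [d, e] - wpath 1 x [e, d]" using commutative_square(1) by (simp only:)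
  moreover have "fst d \<noteq> fst e" using de(2) by (simp add: square_def)
  ultimately show ?thesis using that(2) de(1) by blast
next
  case (loops x a c)
  then show ?thesis using that(3)[of a x c] by (simp add: signed_D_wpath)
qed

lemma rauzy_relations_PA: "rauzy_relations s \<subseteq> PA RQ"
proof
  fix r assume "r \<in> rauzy_relations s"
  then show "r \<in> PA RQ" by (cases rule: rauzy_relations_cases) (auto intro!: PA_diff)
qed

interpretation rq: path_quotient RQ "rauzy_ideal s" for s :: "3 \<Rightarrow> point \<Rightarrow> 'k::field"
proof
  show "two_sided_ideal (rauzy_ideal s) (path_algebra RQ)"
    unfolding rauzy_ideal_def by (rule ideal_gen_two_sided[OF rauzy_relations_PA])
  show "(endv RQ u p, []) \<in> qpaths RQ" if up: "(u, p) \<in> qpaths RQ" for u p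
  proof -
    obtain ds where "valid u ds" "p = walk u ds" using up qpaths_iff by blast
    then show ?thesis using valid_dest[of u ds] unfolding qpaths_iff
      by (intro exI[of _ "[]"]) (simp add: endv_walk)
  qed
qed

section \<open>Calculus of words modulo the relations\<close>

text \<open>The coefficient is quantified so that the statement can be used for any multiple of the
  word. \<open>nulI\<close> reduces it to coefficient 1, since scalars are absorbed into trivial
  paths.\<close>

definition nul :: "(3 \<Rightarrow> point \<Rightarrow> 'k::field) \<Rightarrow> point \<Rightarrow> dir list \<Rightarrow> bool" where
  "nul s p ds \<longleftrightarrow> (\<forall>c. wpath c p ds \<in> rauzy_ideal s)"

definition eqv :: "(3 \<Rightarrow> point \<Rightarrow> 'k::field) \<Rightarrow> point \<Rightarrow> dir list \<Rightarrow> dir list \<Rightarrow> bool" where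
  "eqv s p ds es \<longleftrightarrow> (\<forall>c. wpath c p ds - wpath c p es \<in> rauzy_ideal s)"

lemma rel_ideal: "r \<in> rauzy_relations s \<Longrightarrow> r \<in> rauzy_ideal s"
  unfolding rauzy_ideal_def by (rule subsetD[OF ideal_gen_subset])

lemma eqv_refl [simp]: "eqv s p ds ds"
  by (simp add: eqv_def rq.I_0)

lemma eqv_sym: "eqv s p ds es \<Longrightarrow> eqv s p es ds"
  unfolding eqv_def
proof
  fix c
  assume "\<forall>c. wpath c p ds - wpath c p es \<in> rauzy_ideal s"
  then have "- (wpath c p ds - wpath c p es) \<in> rauzy_ideal s" by (intro rq.I_uminus) blast
  then show "wpath c p es - wpath c p ds \<in> rauzy_ideal s" by simp
qed

lemma nul_eqv: "eqv s p ds es \<Longrightarrow> nul s p es \<Longrightarrow> nul s p ds"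
  unfolding nul_def eqv_def
proof
  fix c
  assume "\<forall>c. wpath c p ds - wpath c p es \<in> rauzy_ideal s" "\<forall>c. wpath c p es \<in> rauzy_ideal s"
  then have "(wpath c p ds - wpath c p es) + wpath c p es \<in> rauzy_ideal s" by (intro rq.I_add) blast+
  then show "wpath c p ds \<in> rauzy_ideal s" by simp
qed

lemma nul_invalid: "\<not> valid p ds \<Longrightarrow> nul s p ds"
  by (simp add: nul_def wpath_def rq.I_0)

lemma wpath_context:
  "path_mult RQ (path_mult RQ (wpath 1 p us) (wpath c (dest p us) vs)) (wpath 1 (dest p (us @ vs)) ws)
    = wpath c p (us @ vs @ ws)"
  by (simp add: wpath_mult)

lemma nul_context: "nul s (dest p us) vs \<Longrightarrow> nul s p (us @ vs @ ws)"
  unfolding nul_def wpath_context[symmetric, of _ p us vs ws]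
  by (intro allI rq.I_mult_left rq.I_mult_right) auto

lemma nul_prefix: "nul s p us \<Longrightarrow> nul s p (us @ ws)"
  using nul_context[of s p "[]" us ws] by simp

text \<open>\<open>eqv\<close> does not compare the end vertices of the two words. With different
  ends the right-hand factor would compose with only one of them, hence the first
  assumption.\<close>

lemma eqv_context:
  fixes s :: "3 \<Rightarrow> point \<Rightarrow> 'k::field"
  assumes "dest (dest p us) vs = dest (dest p us) vs'" "eqv s (dest p us) vs vs'"
  shows "eqv s p (us @ vs @ ws) (us @ vs' @ ws)"
proof -
  have "wpath c p (us @ vs @ ws) - wpath c p (us @ vs' @ ws) = path_mult RQ (path_mult RQ (wpath 1 p us)
      (wpath c (dest p us) vs - wpath c (dest p us) vs')) (wpath 1 (dest p (us @ vs)) ws)" for c :: 'k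
    using wpath_context[of p us c vs ws] wpath_context[of p us c vs' ws] assms(1)
    by (simp add: path_mult_diff_left path_mult_diff_right)
  moreover have "path_mult RQ (path_mult RQ (wpath 1 p us) (wpath c (dest p us) vs - wpath c (dest p us) vs'))
      (wpath 1 (dest p (us @ vs)) ws) \<in> rauzy_ideal s" for c
    by (intro rq.I_mult_left rq.I_mult_right wpath_PA) (use assms(2) in \<open>simp add: eqv_def\<close>)
  ultimately show ?thesis unfolding eqv_def by simp
qed

lemma wpath_scale: "wpath c p ds = path_mult RQ (wpath c p []) (wpath 1 p ds)"
  by (simp add: wpath_mult)

lemma nulI: "wpath 1 p ds \<in> rauzy_ideal s \<Longrightarrow> nul s p ds"
  unfolding nul_def by (subst wpath_scale) (intro allI rq.I_mult_left wpath_PA)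

lemma nul_two: "e \<noteq> opp d \<Longrightarrow> \<not> square (ht p) d e \<Longrightarrow> nul s p [d, e]"
proof (cases "valid p [d, e]")
  case True
  assume "e \<noteq> opp d" "\<not> square (ht p) d e"
  note n = not_tile_path[OF True this]
  have "{p, p + dvec d} \<in> rauzy_edges" "{p + dvec d, p + dvec d + dvec e} \<in> rauzy_edges"
    using True unfolding edge_iff valid_2 by blast+
  from rauzy_relations.zero_path[OF this n] have "wpath 1 p [d, e] \<in> rauzy_ideal s"
    using path2_wpath[OF True] rel_ideal by metis
  then show ?thesis by (rule nulI)
qed (simp add: nul_invalid)

lemma nul_double: "nul s p (us @ d # d # ws)"
  using nul_context[OF nul_two[of d d "dest p us" s], of ws] by (simp add: square_def)

text \<open>If the two directions span a rhombus at \<open>p\<close>, this is a defining relation.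
  If not, neither order runs along a rhombus or turns back, so both words are zero.\<close>

lemma eqv_two: "fst d \<noteq> fst e \<Longrightarrow> eqv s p [d, e] [e, d]"
proof (cases "p \<in> rauzy_vertices \<and> square (ht p) d e")
  case True
  then have v: "valid p [d, e]" "valid p [e, d]" using square_valid square_commute by blast+
  have "rhombus p (p + dvec d) (p + dvec d + dvec e) (p + dvec e)" using True rhombus_iff by blast
  note r = rel_ideal[OF rauzy_relations.commutative_square[OF this, of s]]
  have e: "p + dvec e + dvec d = p + dvec d + dvec e" by simp
  have "wpath 1 p [d, e] - wpath 1 p [e, d] \<in> rauzy_ideal s"
    unfolding path2_wpath[OF v(1), symmetric] path2_wpath[OF v(2), symmetric] e by (rule r)
  then have "path_mult RQ (wpath c p []) (wpath 1 p [d, e] - wpath 1 p [e, d]) \<in> rauzy_ideal s" for c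
    by (intro rq.I_mult_left wpath_PA)
  then show ?thesis unfolding eqv_def path_mult_diff_right wpath_scale[symmetric] by blast
next
  case False
  assume "fst d \<noteq> fst e"
  then have ne: "e \<noteq> opp d" "d \<noteq> opp e" by auto
  have "nul s p [d, e] \<and> nul s p [e, d]"
  proof (cases "p \<in> rauzy_vertices")
    case True
    then have "\<not> square (ht p) d e" "\<not> square (ht p) e d" using False square_commute by blast+
    then show ?thesis using nul_two ne by blast
  next
    case False
    then have "\<not> valid p [d, e]" "\<not> valid p [e, d]" using valid_vertex by blast+
    then show ?thesis using nul_invalid by blast
  qed
  then show ?thesis unfolding nul_def eqv_def by (simp add: rq.I_diff)
qed

lemma eqv_swap:
  assumes "fst d \<noteq> fst e"
  shows "eqv s p (us @ d # e # ws) (us @ e # d # ws)"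
  using eqv_context[OF _ eqv_two[OF assms, of s "dest p us"], of ws] by (simp add: add_ac)

text \<open>Of the six orders in which three steps along different axes can be taken, one leaves the
  slab of heights, see \<open>no_cube\<close>.\<close>

lemma nul_three:
  assumes "fst d \<noteq> fst e" "fst d \<noteq> fst f" "fst e \<noteq> fst f"
  shows "nul s p (us @ d # e # f # ws)"
proof -
  define q where "q = dest p us"
  have "nul s q [d, e, f]"
  proof (rule ccontr)
    assume n: "\<not> nul s q [d, e, f]"
    have sw: "\<not> nul s q (us @ b # a # ws)" if "\<not> nul s q (us @ a # b # ws)" "fst a \<noteq> fst b" for a b us ws
      using nul_eqv[OF eqv_swap[OF that(2)]] that(1) by blast
    have 1: "\<not> nul s q [e, d, f]" using sw[of "[]" d e "[f]"] n assms by simp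
    have 2: "\<not> nul s q [d, f, e]" using sw[of "[d]" e f "[]"] n assms by simp
    have 3: "\<not> nul s q [e, f, d]" using sw[of "[e]" d f "[]"] 1 assms by simp
    have 4: "\<not> nul s q [f, d, e]" using sw[of "[]" d f "[e]"] 2 assms by simp
    have "valid q [d, e, f]" "valid q [d, f, e]" "valid q [e, f, d]" "valid q [f, d, e]"
      using n 2 3 4 nul_invalid by blast+
    then show False using no_cube[OF assms, of "ht q"] unfolding valid_iff by simp
  qed
  then show ?thesis using nul_context[of s p us "[d, e, f]" ws] by (simp add: q_def)
qed

subsection \<open>The relations at the loops\<close>

text \<open>This is the expression s_a D_a of the loop relation, taken at the end of
  \<open>us\<close> and multiplied by \<open>us\<close> on the left and by \<open>ws\<close> on the
  right.\<close>

definition loop_diff :: "(3 \<Rightarrow> point \<Rightarrow> 'k::field) \<Rightarrow> 'k \<Rightarrow> point \<Rightarrow> dir list \<Rightarrow> dir list \<Rightarrow> 3 \<Rightarrow> 'k rauzy_paths" where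
  "loop_diff s c p us ws a = wpath (c * s a (dest p us)) p (us @ (a, True) # (a, False) # ws)
     - wpath (c * s a (dest p us)) p (us @ (a, False) # (a, True) # ws)"

lemma loop_diff_ideal: "loop_diff s c p us ws a - loop_diff s c p us ws b \<in> rauzy_ideal s"
proof (cases "dest p us \<in> rauzy_vertices")
  case True
  define x where "x = dest p us"
  define r where "r = signed_D s a x - signed_D s b x"
  have "r \<in> rauzy_ideal s" unfolding r_def
    by (rule rel_ideal[OF rauzy_relations.loops]) (use True in \<open>simp add: x_def\<close>)
  then have "path_mult RQ (path_mult RQ (wpath c p us) r) (wpath 1 x ws) \<in> rauzy_ideal s"
    by (intro rq.I_mult_left rq.I_mult_right) auto
  also have "path_mult RQ (path_mult RQ (wpath c p us) r) (wpath 1 x ws)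
      = loop_diff s c p us ws a - loop_diff s c p us ws b"
    by (simp add: r_def signed_D_wpath path_mult_diff_left path_mult_diff_right wpath_mult loop_diff_def
        x_def dvec_def)
  finally show ?thesis .
next
  case False
  then have "\<not> valid p (us @ vs)" for vs using valid_append valid_vertex by blast
  then show ?thesis by (simp add: loop_diff_def wpath_def rq.I_0)
qed

lemma sign_unit:
  assumes "sign_choice s" "p \<in> rauzy_vertices"
  shows "s a p * s a p = 1"
proof -
  have "s a p \<in> {1, -1}" using assms by (simp add: sign_choice_def)
  then show ?thesis by auto
qed

text \<open>Loops along the third axis, inserted between \<open>d\<close> and \<open>e\<close>,
  vanish: after an exchange the word begins with steps along three axes. By the loop relation the
  signed difference of the loops along the axis of \<open>e\<close> vanishes in the same place. One
  of its two terms repeats \<open>e\<close>, so the other is zero as well.\<close>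

lemma nul_loop:
  assumes s: "sign_choice s" and fst: "fst d \<noteq> fst e"
  shows "nul s p [d, e, opp e, e]"
proof (cases "p + dvec d \<in> rauzy_vertices")
  case True
  obtain c where c: "c \<noteq> fst d" "c \<noteq> fst e" using other_axis by blast
  have *: "nul s p [d, (c, t), (c, \<not> t), e]" for t
  proof -
    have "eqv s p ([d, (c, t)] @ (c, \<not> t) # e # []) ([d, (c, t)] @ e # (c, \<not> t) # [])"
      by (rule eqv_swap) (use c in simp)
    moreover have "nul s p ([] @ d # (c, t) # e # [(c, \<not> t)])" by (rule nul_three) (use c fst in auto)
    ultimately show ?thesis using nul_eqv by fastforce
  qed
  have lc: "loop_diff s k p [d] [e] c \<in> rauzy_ideal s" for k
    using *[of True] *[of False] unfolding loop_diff_def nul_def by (simp add: rq.I_diff)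
  have le: "loop_diff s k p [d] [e] (fst e) \<in> rauzy_ideal s" for k
    using rq.I_add[OF loop_diff_ideal[of s k p "[d]" "[e]" "fst e" c] lc[of k]] by simp
  have n: "nul s p [d, opp e, e, e]" using nul_double[of s p "[d, opp e]" e "[]"] by simp
  let ?s = "s (fst e) (p + dvec d)"
  have "wpath k p [d, e, opp e, e] \<in> rauzy_ideal s" for k
  proof (cases "snd e")
    case True
    then have e: "(fst e, True) = e" "(fst e, False) = opp e" by (auto simp: prod_eq_iff)
    have "loop_diff s (k * ?s) p [d] [e] (fst e) = wpath k p [d, e, opp e, e] - wpath k p [d, opp e, e, e]"
      using sign_unit[OF s \<open>p + dvec d \<in> rauzy_vertices\<close>] unfolding loop_diff_def e by (simp add: mult.assoc)
    then show ?thesis using rq.I_add[OF le[of "k * ?s"], of "wpath k p [d, opp e, e, e]"] n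
      by (simp add: nul_def)
  next
    case False
    then have e: "(fst e, True) = opp e" "(fst e, False) = e" by (auto simp: prod_eq_iff)
    have "loop_diff s (k * ?s) p [d] [e] (fst e) = wpath k p [d, opp e, e, e] - wpath k p [d, e, opp e, e]"
      using sign_unit[OF s \<open>p + dvec d \<in> rauzy_vertices\<close>] unfolding loop_diff_def e by (simp add: mult.assoc)
    then show ?thesis using rq.I_diff[OF _ le[of "k * ?s"], of "wpath k p [d, opp e, e, e]"] n
      by (simp add: nul_def)
  qed
  then show ?thesis by (simp add: nul_def)
next
  case False
  then have "\<not> valid p [d, e, opp e, e]" using valid_stepD(2)[of p d] by auto
  then show ?thesis by (rule nul_invalid)
qed

subsection \<open>Continuations of a path along a rhombus\<close>

text \<open>A further step \<open>d\<close> can be moved next to the first one, and a step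
  \<open>e\<close> already stands next to its copy; a repetition is zero. A step along the third
  axis gives a word in three axes.\<close>

lemma nul_square1:
  assumes "fst d \<noteq> fst e" "g \<noteq> opp d" "g \<noteq> opp e"
  shows "nul s p [d, e, g]"
proof -
  consider "g = d" | "g = e" | "fst g \<noteq> fst d" "fst g \<noteq> fst e"
    using assms same_axis by metis
  then show ?thesis
  proof cases
    case 1
    have "eqv s p ([d] @ e # d # []) ([d] @ d # e # [])" by (rule eqv_swap) (use assms in simp)
    moreover have "nul s p ([] @ d # d # [e])" by (rule nul_double)
    ultimately show ?thesis using nul_eqv 1 by fastforce
  next
    case 2
    then show ?thesis using nul_double[of s p "[d]" e "[]"] by simp
  next
    case 3
    then show ?thesis using nul_three[of d e g s p "[]" "[]"] assms by simp
  qed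
qed

text \<open>A step off the axis of \<open>e\<close> moves in front of \<open>opp e\<close>, where
  \<open>nul_square1\<close> applies. On the axis of \<open>e\<close> there is either a repetition
  or the word of \<open>nul_loop\<close>.\<close>

lemma nul_square2:
  assumes s: "sign_choice s" and de: "fst d \<noteq> fst e" and g: "g \<noteq> opp d"
  shows "nul s p [d, e, opp e, g]"
proof -
  consider "g = d" | "g = e" | "g = opp e" | "fst g \<noteq> fst d" "fst g \<noteq> fst e"
    using g same_axis by metis
  then show ?thesis
  proof cases
    case 1
    have "eqv s p ([d, e] @ opp e # d # []) ([d, e] @ d # opp e # [])" by (rule eqv_swap) (use de in simp)
    moreover have "nul s p [d, e, d]" by (rule nul_square1) (use de in auto)
    then have "nul s p ([d, e, d] @ [opp e])" by (rule nul_prefix)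
    ultimately show ?thesis using nul_eqv 1 by fastforce
  next
    case 2
    then show ?thesis using nul_loop[OF s de] by simp
  next
    case 3
    then show ?thesis using nul_double[of s p "[d, e]" "opp e" "[]"] by simp
  next
    case 4
    have "eqv s p ([d, e] @ opp e # g # []) ([d, e] @ g # opp e # [])" by (rule eqv_swap) (use 4 in simp)
    moreover have "nul s p ([d, e, g] @ [opp e])"
      by (rule nul_prefix, rule nul_square1) (use de 4 in auto)
    ultimately show ?thesis using nul_eqv by fastforce
  qed
qed

lemma eqv_square: "fst d \<noteq> fst e \<Longrightarrow> eqv s p (d # e # ws) (e # d # ws)"
  using eqv_swap[of d e s p "[]" ws] by simp

lemma nul_square2':
  assumes "sign_choice s" "fst d \<noteq> fst e" "g \<noteq> opp e"
  shows "nul s p [d, e, opp d, g]"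
  using nul_eqv[OF eqv_square[OF assms(2)]] nul_square2[of s e d g p] assms by simp

lemma eqv_square_back:
  "fst d \<noteq> fst e \<Longrightarrow> eqv s p (d # e # opp d # opp e # ws) (d # e # opp e # opp d # ws)"
  using eqv_swap[of "opp d" "opp e" s p "[d, e]" ws] by simp

text \<open>The boundary of the rhombus ends in the socle. The new step is moved forward past the
  last one and meets \<open>nul_square2\<close>. For \<open>g = d\<close> the last two steps are
  exchanged first, since \<open>g\<close> cannot pass \<open>opp d\<close>.\<close>

lemma nul_square3:
  assumes s: "sign_choice s" and de: "fst d \<noteq> fst e"
  shows "nul s p [d, e, opp e, opp d, g]"
proof (cases "g = d")
  case True
  have 1: "eqv s p [d, e, opp e, opp d, g] [d, e, opp d, opp e, g]"
    using eqv_sym[OF eqv_square_back[OF de, of s p "[g]"]] by simp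
  have 2: "eqv s p ([d, e, opp d] @ opp e # g # []) ([d, e, opp d] @ g # opp e # [])"
    by (rule eqv_swap) (use True de in simp)
  have "nul s p [d, e, opp d, g]" by (rule nul_square2'[OF s de]) (use True de in auto)
  then have "nul s p ([d, e, opp d, g] @ [opp e])" by (rule nul_prefix)
  then have "nul s p [d, e, opp d, opp e, g]" using nul_eqv[OF 2] by simp
  then show ?thesis using nul_eqv[OF 1] by simp
next
  case False
  show ?thesis
  proof (cases "g = opp d")
    case True
    then show ?thesis using nul_double[of s p "[d, e, opp e]" "opp d" "[]"] by simp
  next
    case g: False
    then have "fst g \<noteq> fst d" using False same_axis by metis
    then have 2: "eqv s p ([d, e, opp e] @ opp d # g # []) ([d, e, opp e] @ g # opp d # [])"
      by (intro eqv_swap) simp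
    have "nul s p ([d, e, opp e, g] @ [opp d])" by (rule nul_prefix, rule nul_square2[OF s de g])
    then show ?thesis using nul_eqv[OF 2] by simp
  qed
qed

lemma nul_square:
  assumes s: "sign_choice s" and de: "fst d \<noteq> fst e"
    and ws: "ws \<noteq> []" "ws \<noteq> [opp e]" "ws \<noteq> [opp d]" "ws \<noteq> [opp e, opp d]" "ws \<noteq> [opp d, opp e]"
  shows "nul s p (d # e # ws)"
proof -
  obtain g ws1 where ws1: "ws = g # ws1" using ws by (cases ws) auto
  show ?thesis
  proof (cases "g = opp d \<or> g = opp e")
    case False
    then have "nul s p ([d, e, g] @ ws1)" using nul_square1[OF de] nul_prefix by blast
    then show ?thesis by (simp add: ws1)
  next
    case g: True
    obtain g2 ws2 where ws2: "ws1 = g2 # ws2" using ws g ws1 by (cases ws1) auto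
    show ?thesis
    proof (cases "g = opp e")
      case True
      show ?thesis
      proof (cases "g2 = opp d")
        case g2: True
        obtain g3 ws3 where ws3: "ws2 = g3 # ws3" using ws g2 True ws1 ws2 by (cases ws2) auto
        have "nul s p ([d, e, opp e, opp d, g3] @ ws3)" using nul_square3[OF s de] nul_prefix by blast
        then show ?thesis by (simp add: ws1 ws2 ws3 True g2)
      next
        case False
        then have "nul s p ([d, e, opp e, g2] @ ws2)" using nul_square2[OF s de] nul_prefix by blast
        then show ?thesis by (simp add: ws1 ws2 True)
      qed
    next
      case False
      then have gd: "g = opp d" using g by blast
      show ?thesis
      proof (cases "g2 = opp e")
        case g2: True
        obtain g3 ws3 where ws3: "ws2 = g3 # ws3" using ws g2 gd ws1 ws2 by (cases ws2) auto
        have "nul s p ([d, e, opp e, opp d, g3] @ ws3)" using nul_square3[OF s de] nul_prefix by blast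
        then have "nul s p (d # e # opp d # opp e # g3 # ws3)"
          using nul_eqv[OF eqv_square_back[OF de, of s p "g3 # ws3"]] by simp
        then show ?thesis by (simp add: ws1 ws2 ws3 gd g2)
      next
        case False
        then have "nul s p ([d, e, opp d, g2] @ ws2)" using nul_square2'[OF s de] nul_prefix by blast
        then show ?thesis by (simp add: ws1 ws2 gd)
      qed
    qed
  qed
qed

lemma cf_wpath: "valid q ws \<Longrightarrow> cf (wpath c q ws) (y, walk y vs) = (if q = y \<and> ws = vs then c else 0)"
  by (auto simp: wpath_def lookup_single when_def walk_inj)

text \<open>Upper bound for the right ideal of a path along a rhombus: five continuations survive,
  and the two that return to \<open>p\<close> are equal. This identification is the reason for the
  sum of two coefficients in the last term.\<close>

lemma square_decomp:
  fixes s :: "3 \<Rightarrow> point \<Rightarrow> 'k::field"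
  assumes s: "sign_choice s" and de: "fst d \<noteq> fst e" and y: "y = p + dvec d + dvec e" and f: "f \<in> PA RQ"
  shows "path_mult RQ (wpath 1 p [d, e]) f -
    (wpath (cf f (y, walk y [])) p [d, e] + wpath (cf f (y, walk y [opp e])) p [d, e, opp e]
      + wpath (cf f (y, walk y [opp d])) p [d, e, opp d]
      + wpath (cf f (y, walk y [opp e, opp d]) + cf f (y, walk y [opp d, opp e])) p [d, e, opp e, opp d])
    \<in> rauzy_ideal s" (is "path_mult RQ ?P f - ?E f \<in> _")
  using f
proof (induction rule: PA_RQ_induct)
  case zero
  show ?case by (simp add: rq.I_0)
next
  case (add f g)
  have "path_mult RQ ?P (f + g) - ?E (f + g) = (path_mult RQ ?P f - ?E f) + (path_mult RQ ?P g - ?E g)"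
    by (simp add: path_mult_add_right lookup_add wpath_add algebra_simps)
  then show ?case using rq.I_add[OF add] by (simp only:)
next
  case (wpath c q ws)
  show ?case
  proof (cases "q = y")
    case False
    then have "path_mult RQ ?P (wpath c q ws) = 0" by (simp add: wpath_mult y)
    moreover have "?E (wpath c q ws) = 0" unfolding cf_wpath[OF wpath] using False by simp
    ultimately show ?thesis by (simp add: rq.I_0)
  next
    case True
    have P: "path_mult RQ ?P (wpath c q ws) = wpath c p (d # e # ws)" using True by (simp add: wpath_mult y)
    have ne: "opp d \<noteq> opp e" "opp e \<noteq> opp d" using de by (metis opp_simps(1))+
    consider "ws = []" | "ws = [opp e]" | "ws = [opp d]" | "ws = [opp e, opp d]" | "ws = [opp d, opp e]"
      | "ws \<noteq> []" "ws \<noteq> [opp e]" "ws \<noteq> [opp d]" "ws \<noteq> [opp e, opp d]" "ws \<noteq> [opp d, opp e]" by blast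
    then show ?thesis
    proof cases
      case 5
      have "eqv s p (d # e # ws) [d, e, opp e, opp d]" unfolding 5 using eqv_square_back[OF de, of s p "[]"] by simp
      then show ?thesis unfolding P cf_wpath[OF wpath] eqv_def using 5 True ne by simp
    next
      case 6
      have "nul s p (d # e # ws)" by (rule nul_square[OF s de 6])
      then show ?thesis unfolding P cf_wpath[OF wpath] nul_def using 6 True by simp
    qed (unfold P cf_wpath[OF wpath], use True ne rq.I_0 in simp_all)
  qed
qed

text \<open>The preimage in the path algebra of the right ideal generated by the class of
  \<open>b\<close>. It allows membership to be tested on words.\<close>

definition right_ideal_mod :: "(3 \<Rightarrow> point \<Rightarrow> 'k::field) \<Rightarrow> 'k rauzy_paths \<Rightarrow> 'k rauzy_paths set" where
  "right_ideal_mod s b = {f. \<exists>h\<in>PA RQ. f - path_mult RQ b h \<in> rauzy_ideal s}"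

lemma right_ideal_mod_ideal: "f \<in> rauzy_ideal s \<Longrightarrow> f \<in> right_ideal_mod s b"
  unfolding right_ideal_mod_def by (intro CollectI bexI[of _ 0]) auto

lemma right_ideal_mod_add:
  assumes "f \<in> right_ideal_mod s b" "g \<in> right_ideal_mod s b"
  shows "f + g \<in> right_ideal_mod s b"
proof -
  obtain h k where h: "h \<in> PA RQ" "f - path_mult RQ b h \<in> rauzy_ideal s"
    and k: "k \<in> PA RQ" "g - path_mult RQ b k \<in> rauzy_ideal s"
    using assms unfolding right_ideal_mod_def by blast
  have eq: "(f + g) - path_mult RQ b (h + k) = (f - path_mult RQ b h) + (g - path_mult RQ b k)"
    by (simp add: path_mult_add_right)
  have "(f + g) - path_mult RQ b (h + k) \<in> rauzy_ideal s" unfolding eq by (rule rq.I_add[OF h(2) k(2)])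
  then show ?thesis unfolding right_ideal_mod_def using PA_add[OF h(1) k(1)] by blast
qed

lemma right_ideal_mod_uminus:
  assumes "f \<in> right_ideal_mod s b"
  shows "- f \<in> right_ideal_mod s b"
proof -
  obtain h where h: "h \<in> PA RQ" "f - path_mult RQ b h \<in> rauzy_ideal s"
    using assms unfolding right_ideal_mod_def by blast
  have "- f - path_mult RQ b (- h) \<in> rauzy_ideal s"
    using rq.I_uminus[OF h(2)] by (simp add: path_mult_minus_right)
  then show ?thesis unfolding right_ideal_mod_def using PA_uminus[OF h(1)] by blast
qed

lemma right_ideal_mod_diff:
  "f \<in> right_ideal_mod s b \<Longrightarrow> g \<in> right_ideal_mod s b \<Longrightarrow> f - g \<in> right_ideal_mod s b"
  using right_ideal_mod_add[of f s b "- g"] right_ideal_mod_uminus[of g s b] by simp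

lemma right_ideal_mod_mult:
  assumes "f \<in> right_ideal_mod s b" "r \<in> PA RQ"
  shows "path_mult RQ f r \<in> right_ideal_mod s b"
proof -
  obtain h where h: "h \<in> PA RQ" "f - path_mult RQ b h \<in> rauzy_ideal s"
    using assms(1) unfolding right_ideal_mod_def by blast
  have "path_mult RQ f r - path_mult RQ b (path_mult RQ h r) \<in> rauzy_ideal s"
    using rq.I_mult_right[OF h(2) assms(2)] by (simp add: path_mult_diff_left path_mult_assoc)
  then show ?thesis unfolding right_ideal_mod_def using PA_mult[OF h(1) assms(2)] by blast
qed

section \<open>Continuations of an arrow modulo one of the two rhombi at its edge\<close>

context
  fixes s :: "3 \<Rightarrow> point \<Rightarrow> 'k::field" and p d e1 e2
  assumes s: "sign_choice s" and sq: "square (ht p) d e1" "square (ht p) d e2" and ne: "e1 \<noteq> e2"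
begin

abbreviation "J \<equiv> right_ideal_mod s (wpath 1 p [d, e2])"

lemma J_start: "wpath c p (d # e2 # ws) \<in> J"
proof -
  have "wpath c p (d # e2 # ws) = path_mult RQ (wpath 1 p [d, e2]) (wpath c (p + dvec d + dvec e2) ws)"
    by (simp add: wpath_mult)
  then have "wpath c p (d # e2 # ws) - path_mult RQ (wpath 1 p [d, e2]) (wpath c (p + dvec d + dvec e2) ws)
      \<in> rauzy_ideal s" by (simp add: rq.I_0)
  then show ?thesis unfolding right_ideal_mod_def by (intro CollectI bexI) auto
qed

lemma J_nul: "nul s p ws \<Longrightarrow> wpath c p ws \<in> J"
  by (intro right_ideal_mod_ideal) (simp add: nul_def)

lemma J_eqv: "eqv s p vs ws \<Longrightarrow> wpath c p ws \<in> J \<Longrightarrow> wpath c p vs \<in> J"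
proof -
  assume "eqv s p vs ws" and ws: "wpath c p ws \<in> J"
  then have "wpath c p vs - wpath c p ws \<in> J" by (intro right_ideal_mod_ideal) (simp add: eqv_def)
  then show ?thesis using right_ideal_mod_add[OF _ ws] by fastforce
qed

lemma J_append: "wpath c p vs \<in> J \<Longrightarrow> wpath c p (vs @ ws) \<in> J"
  using right_ideal_mod_mult[of "wpath c p vs" s _ "wpath 1 (dest p vs) ws"] by (simp add: wpath_mult)

lemma nul_continue:
  assumes "g \<noteq> opp d" "g \<noteq> e1" "g \<noteq> e2"
  shows "nul s p [d, g]"
proof -
  have "\<not> square (ht p) d g" using square_two[OF sq(1,2) _ ne] assms by blast
  then show ?thesis using nul_two assms(1) by blast
qed

text \<open>The edge along \<open>d\<close> lies only in the rhombi with \<open>e1\<close> and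
  \<open>e2\<close>. A step along \<open>e2\<close> enters \<open>J\<close> by definition, and any
  other step allowed here gives a zero path.\<close>

lemma J_continue:
  assumes "g \<noteq> opp d" "g \<noteq> e1"
  shows "wpath c p (d # g # ws) \<in> J"
proof (cases "g = e2")
  case True
  then show ?thesis using J_start by simp
next
  case False
  then have "nul s p ([d, g] @ ws)" using nul_continue assms nul_prefix by blast
  then show ?thesis using J_nul by fastforce
qed

text \<open>Take an axis different from those of \<open>d\<close> and \<open>e1\<close>. Both loops
  along it leave the end of \<open>d\<close> by a step as in \<open>J_continue\<close>, so its loop
  difference is in \<open>J\<close>. The loop relation carries this over to every axis.\<close>

lemma J_loop_diff: "loop_diff s c p [d] [] a \<in> J"
proof -
  obtain b where b: "b \<noteq> fst d" "b \<noteq> fst e1" using other_axis by blast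
  have "(b, t) \<noteq> opp d" "(b, t) \<noteq> e1" for t using b by (auto simp: prod_eq_iff)
  then have "loop_diff s c p [d] [] b \<in> J"
    unfolding loop_diff_def append_Cons append_Nil by (intro right_ideal_mod_diff J_continue)
  from right_ideal_mod_add[OF right_ideal_mod_ideal[OF loop_diff_ideal[of s c p "[d]" "[]" a b]] this]
  show ?thesis by simp
qed

text \<open>Modulo \<open>J\<close> the two loops along an axis become equal, because their
  difference multiplied by an invertible sign is in \<open>J\<close>. Thus it suffices to treat
  either of them.\<close>

lemma J_loop:
  assumes "\<And>c. wpath c p [d, opp g, g] \<in> J"
  shows "wpath c p [d, g, opp g] \<in> J"
proof (cases "p + dvec d \<in> rauzy_vertices")
  case True
  let ?s = "s (fst g) (p + dvec d)"
  note u = sign_unit[OF s True, of "fst g"]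
  note l = J_loop_diff[of "c * ?s" "fst g"]
  show ?thesis
  proof (cases "snd g")
    case True
    then have g: "(fst g, True) = g" "(fst g, False) = opp g" by (auto simp: prod_eq_iff)
    have "loop_diff s (c * ?s) p [d] [] (fst g) = wpath c p [d, g, opp g] - wpath c p [d, opp g, g]"
      using u unfolding loop_diff_def g by (simp add: mult.assoc)
    then show ?thesis using right_ideal_mod_add[OF l assms[of c]] by simp
  next
    case False
    then have g: "(fst g, True) = opp g" "(fst g, False) = g" by (auto simp: prod_eq_iff)
    have "loop_diff s (c * ?s) p [d] [] (fst g) = wpath c p [d, opp g, g] - wpath c p [d, g, opp g]"
      using u unfolding loop_diff_def g by (simp add: mult.assoc)
    then show ?thesis using right_ideal_mod_diff[OF assms[of c] l] by simp
  qed
next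
  case False
  then have "\<not> valid p [d, g, opp g]" using valid_stepD(2)[of p d] by auto
  then show ?thesis by (intro J_nul nul_invalid)
qed

lemma J_back: "wpath c p [d, opp d, d] \<in> J"
  using J_loop[of "opp d" c] nul_double[of s p "[]" d "[opp d]"] J_nul by simp

lemma axes: "fst d \<noteq> fst e1" "fst d \<noteq> fst e2"
  using sq by (auto simp: square_def)

text \<open>The opposite loop begins with \<open>opp e1\<close>, which is neither
  \<open>opp d\<close> nor \<open>e1\<close>, and therefore lies in \<open>J\<close>;
  \<open>J_loop\<close> turns it around.\<close>

lemma J_e1: "wpath c p [d, e1, opp e1] \<in> J"
proof (rule J_loop)
  have "opp e1 \<noteq> opp d" using axes by (metis opp_simps(1))
  moreover have "opp e1 \<noteq> e1" by simp
  ultimately show "wpath c p [d, opp e1, e1] \<in> J" for c by (rule J_continue)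
qed

lemma J_long: "wpath c p (d # e1 # opp d # g # ws) \<in> J"
proof (cases "g = opp e1")
  case True
  have 1: "eqv s p (d # e1 # opp d # g # ws) (d # e1 # opp e1 # opp d # ws)"
    using eqv_square_back[OF axes(1)] True by simp
  show ?thesis using J_eqv[OF 1] J_append[OF J_e1, of c "opp d # ws"] by simp
next
  case False
  have "nul s p ([d, e1, opp d, g] @ ws)" using nul_square2'[OF s axes(1) False] nul_prefix by blast
  then show ?thesis using J_nul by fastforce
qed

lemma J_word:
  assumes ws: "ws \<noteq> []" "ws \<noteq> [opp d]" "ws \<noteq> [e1]" "ws \<noteq> [opp d, e1]" "ws \<noteq> [e1, opp d]"
  shows "wpath c p (d # ws) \<in> J"
proof -
  obtain g ws1 where ws1: "ws = g # ws1" using ws by (cases ws) auto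
  have sw: "eqv s p (d # opp d # g2 # ws2) (d # g2 # opp d # ws2)" if "fst g2 \<noteq> fst d" for g2 ws2
    using eqv_swap[of "opp d" g2 s p "[d]" ws2] that by simp
  consider "g = opp d" | "g = e1" | "g \<noteq> opp d" "g \<noteq> e1" by blast
  then show ?thesis
  proof cases
    case 1
    obtain g2 ws2 where ws2: "ws1 = g2 # ws2" using ws 1 ws1 by (cases ws1) auto
    consider "g2 = d" | "g2 = opp d" | "g2 = e1" | "fst g2 \<noteq> fst d" "g2 \<noteq> e1" using same_axis by blast
    then show ?thesis
    proof cases
      case a: 1
      then show ?thesis using J_append[OF J_back, of c ws2] 1 ws1 ws2 by simp
    next
      case a: 2
      then show ?thesis using J_nul[OF nul_double[of s p "[d]" "opp d" ws2]] 1 ws1 ws2 by simp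
    next
      case a: 3
      obtain g3 ws3 where ws3: "ws2 = g3 # ws3" using ws 1 a ws1 ws2 by (cases ws2) auto
      show ?thesis using J_eqv[OF sw[of e1 ws2] J_long[of c g3 ws3, folded ws3]] 1 a ws1 ws2 axes by simp
    next
      case a: 4
      then have "g2 \<noteq> opp d" by auto
      then show ?thesis using J_eqv[OF sw[of g2 ws2] J_continue[of g2 c "opp d # ws2"]] 1 a ws1 ws2 by simp
    qed
  next
    case 2
    obtain g2 ws2 where ws2: "ws1 = g2 # ws2" using ws 2 ws1 by (cases ws1) auto
    consider "g2 = opp d" | "g2 = opp e1" | "g2 \<noteq> opp d" "g2 \<noteq> opp e1" by blast
    then show ?thesis
    proof cases
      case a: 1
      obtain g3 ws3 where ws3: "ws2 = g3 # ws3" using ws 2 a ws1 ws2 by (cases ws2) auto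
      show ?thesis using J_long[of c g3 ws3] 2 a ws1 ws2 ws3 by simp
    next
      case a: 2
      then show ?thesis using J_append[OF J_e1, of c ws2] 2 ws1 ws2 by simp
    next
      case a: 3
      then have "nul s p ([d, e1, g2] @ ws2)" using nul_square1[OF axes(1)] nul_prefix by blast
      then show ?thesis using J_nul[of "[d, e1, g2] @ ws2"] 2 ws1 ws2 by simp
    qed
  next
    case 3
    then show ?thesis using J_continue ws1 by simp
  qed
qed

text \<open>The surviving continuations are those that \<open>square_decomp\<close> gives for the
  path that arrives at \<open>x\<close> from \<open>p + dvec e1\<close> through \<open>p\<close>.
  This coincidence makes left multiplication by the arrow from \<open>p + dvec e1\<close> to
  \<open>p\<close> injective modulo \<open>J\<close>.\<close>

lemma arrow_decomp:
  assumes x: "x = p + dvec d" and f: "f \<in> PA RQ"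
  shows "path_mult RQ (wpath 1 p [d]) f -
    (wpath (cf f (x, walk x [])) p [d] + wpath (cf f (x, walk x [opp d])) p [d, opp d]
      + wpath (cf f (x, walk x [e1])) p [d, e1]
      + wpath (cf f (x, walk x [opp d, e1]) + cf f (x, walk x [e1, opp d])) p [d, e1, opp d])
    \<in> J" (is "path_mult RQ ?P f - ?E f \<in> _")
  using f
proof (induction rule: PA_RQ_induct)
  case zero
  show ?case using right_ideal_mod_ideal[OF rq.I_0] by simp
next
  case (add f g)
  have "path_mult RQ ?P (f + g) - ?E (f + g) = (path_mult RQ ?P f - ?E f) + (path_mult RQ ?P g - ?E g)"
    by (simp add: path_mult_add_right lookup_add wpath_add algebra_simps)
  then show ?case using right_ideal_mod_add[OF add] by (simp only:)
next
  case (wpath c q ws)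
  have J0: "0 \<in> J" using right_ideal_mod_ideal[OF rq.I_0] .
  show ?case
  proof (cases "q = x")
    case False
    then have "path_mult RQ ?P (wpath c q ws) = 0" by (simp add: wpath_mult x)
    moreover have "?E (wpath c q ws) = 0" unfolding cf_wpath[OF wpath] using False by simp
    ultimately show ?thesis using J0 by simp
  next
    case True
    have P: "path_mult RQ ?P (wpath c q ws) = wpath c p (d # ws)" using True by (simp add: wpath_mult x)
    have ne': "opp d \<noteq> e1" "e1 \<noteq> opp d" using axes by auto
    consider "ws = []" | "ws = [opp d]" | "ws = [e1]" | "ws = [opp d, e1]" | "ws = [e1, opp d]"
      | "ws \<noteq> []" "ws \<noteq> [opp d]" "ws \<noteq> [e1]" "ws \<noteq> [opp d, e1]" "ws \<noteq> [e1, opp d]" by blast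
    then show ?thesis
    proof cases
      case 4
      have "eqv s p (d # ws) [d, e1, opp d]"
        unfolding 4 using eqv_swap[of "opp d" e1 s p "[d]" "[]"] axes by simp
      then show ?thesis unfolding P cf_wpath[OF wpath] using 4 True ne'
        by (intro right_ideal_mod_ideal) (simp add: eqv_def)
    next
      case 6
      have "wpath c p (d # ws) \<in> J" by (rule J_word[OF 6])
      then show ?thesis unfolding P cf_wpath[OF wpath] using 6 True by simp
    qed (unfold P cf_wpath[OF wpath], use True ne' J0 in simp_all)
  qed
qed

end

section \<open>A linear form that does not vanish on the paths around a rhombus\<close>

text \<open>The closed paths of length two at a vertex \<open>p\<close>, modulo the relations, behave like the torus
  invariant divisors of the toric surface whose fan has the directions of the edges at \<open>p\<close> as rays.
  The form below is the intersection form; \<open>self_square\<close> is the self-intersection number.\<close>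

definition sgn_dir :: "dir \<Rightarrow> 'k::field" where
  "sgn_dir d = (if snd d then 1 else -1)"

definition square_ind :: "real \<Rightarrow> dir \<Rightarrow> dir \<Rightarrow> 'k::field" where
  "square_ind h d e = (if square h d e then 1 else 0)"

text \<open>The value is forced by linear equivalence: the loop along \<open>d\<close> must pair
  equally with the difference of opposite loops along every axis. For the axis of \<open>d\<close>
  this is the self-intersection up to sign, as opposite rays do not meet; any other axis then
  computes it by counting adjacent rhombi.\<close>

definition self_square :: "real \<Rightarrow> dir \<Rightarrow> 'k::field" where
  "self_square h d = (let a = (SOME a. a \<noteq> fst d) in
     sgn_dir d * (square_ind h (a, True) d - square_ind h (a, False) d))"

text \<open>The first branch pairs two loops at \<open>p\<close>. The last nonzero case is a walk
  around a rhombus or out and back along it; by exchanging steps this equals the product of the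
  loops along \<open>d1\<close> and \<open>d2\<close>, and it receives the same value.\<close>

definition psi4 :: "(3 \<Rightarrow> point \<Rightarrow> 'k::field) \<Rightarrow> point \<Rightarrow> dir \<Rightarrow> dir \<Rightarrow> dir \<Rightarrow> dir \<Rightarrow> 'k" where
  "psi4 s p d1 d2 d3 d4 =
    (if d2 = opp d1 then
       if d4 = opp d3 then
         if d3 = d1 then self_square (ht p) d1 else s (fst d1) p * s (fst d3) p * square_ind (ht p) d1 d3
       else 0
     else if d3 = opp d1 \<and> d4 = opp d2 \<or> d3 = opp d2 \<and> d4 = opp d1 then
       s (fst d1) p * s (fst d2) p * square_ind (ht p) d1 d2
     else 0)"

lemma square_ind_commute: "square_ind h d e = square_ind h e d"
  by (simp add: square_ind_def square_commute)

lemma square_ind_same: "fst d = fst e \<Longrightarrow> square_ind h d e = 0"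
  by (simp add: square_ind_def square_def)

lemma sgn_dir_square: "sgn_dir d * sgn_dir d = (1::'k::field)"
  by (simp add: sgn_dir_def)

text \<open>By \<open>square_third\<close> the indicator of \<open>(a, True)\<close> is one minus
  that of \<open>(b, False)\<close>, and conversely, so the differences agree and
  \<open>self_square\<close> does not depend on the axis chosen in it.\<close>

lemma square_ind_diff:
  assumes "a \<noteq> fst d" "b \<noteq> fst d"
  shows "square_ind h (a, True) d - square_ind h (a, False) d
    = (square_ind h (b, True) d - square_ind h (b, False) d :: 'k::field)"
proof (cases "a = b \<or> \<not> (slab h \<and> slab (h + dht d))")
  case True
  then show ?thesis by (auto simp: square_ind_def square_def)
next
  case False
  then have *: "square h d (a, t) \<longleftrightarrow> \<not> square h d (b, \<not> t)" for t
    using assms by (intro square_third) auto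
  show ?thesis unfolding square_ind_def square_commute[of h _ d]
    using *[of True] *[of False] by simp
qed

lemma self_square_eq:
  assumes "a \<noteq> fst d"
  shows "self_square h d = (sgn_dir d * (square_ind h (a, True) d - square_ind h (a, False) d) :: 'k::field)"
proof -
  define b where "b = (SOME b. b \<noteq> fst d)"
  have "b \<noteq> fst d" unfolding b_def by (rule someI[of _ a]) (rule assms)
  then show ?thesis unfolding self_square_def Let_def b_def[symmetric]
    by (simp only: square_ind_diff[OF assms \<open>b \<noteq> fst d\<close>])
qed

lemma self_square_zero:
  "\<not> (slab h \<and> slab (h + dht d)) \<Longrightarrow> self_square h d = 0"
  by (auto simp: self_square_def square_ind_def square_def Let_def)

lemma psi4_nonzero:
  fixes s :: "3 \<Rightarrow> point \<Rightarrow> 'k::field"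
  assumes "psi4 s p d1 d2 d3 d4 \<noteq> 0"
  shows "d2 = opp d1 \<and> d3 = d1 \<and> d4 = opp d1 \<and> slab (ht p) \<and> slab (ht p + dht d1)
    \<or> d2 = opp d1 \<and> d4 = opp d3 \<and> square (ht p) d1 d3
    \<or> d3 = opp d1 \<and> d4 = opp d2 \<and> square (ht p) d1 d2
    \<or> d3 = opp d2 \<and> d4 = opp d1 \<and> square (ht p) d1 d2"
  using assms self_square_zero[of "ht p" d1, where 'a = 'k] unfolding psi4_def
  by (auto simp: square_ind_def split: if_splits)

lemma psi4_valid:
  assumes "psi4 s p d1 d2 d3 d4 \<noteq> 0" "p \<in> rauzy_vertices"
  shows "valid p [d1, d2, d3, d4]"
  using psi4_nonzero[OF assms(1)] assms(2)
  by (elim disjE conjE) (simp_all add: valid_iff square_def algebra_simps)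

definition psi :: "(3 \<Rightarrow> point \<Rightarrow> 'k::field) \<Rightarrow> point \<Rightarrow> dir list \<Rightarrow> 'k" where
  "psi s p ds = (if length ds = 4 then psi4 s p (ds!0) (ds!1) (ds!2) (ds!3) else 0)"

lemma psi_simp: "psi s p [a, b, c, d] = psi4 s p a b c d"
  by (simp add: psi_def numeral_2_eq_2 numeral_3_eq_3)

lemma length_4E:
  assumes "length ds = 4"
  obtains a b c d where "ds = [a, b, c, d]"
proof -
  have "length ds = Suc (Suc (Suc (Suc 0)))" using assms by simp
  then show ?thesis using that by (auto simp: length_Suc_conv)
qed

text \<open>This fits the convention that words leaving the slab stand for zero: \<open>psi\<close>
  vanishes on them, so \<open>Phi_wpath\<close> needs no assumption of validity.\<close>

lemma psi_valid: "psi s p ds \<noteq> 0 \<Longrightarrow> p \<in> rauzy_vertices \<Longrightarrow> valid p ds"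
proof -
  assume a: "psi s p ds \<noteq> 0" "p \<in> rauzy_vertices"
  then have "length ds = 4" by (auto simp: psi_def split: if_splits)
  then obtain d1 d2 d3 d4 where "ds = [d1, d2, d3, d4]" by (rule length_4E)
  then show ?thesis using a psi4_valid psi_simp by metis
qed

definition dirs :: "(point \<times> point) list \<Rightarrow> dir list" where
  "dirs es = map (\<lambda>(p, q). THE d. q = p + dvec d) es"

lemma dirs_walk: "dirs (walk p ds) = ds"
  by (induction ds arbitrary: p) (auto simp: dirs_def dvec_inj)

definition Phi :: "(3 \<Rightarrow> point \<Rightarrow> 'k::field) \<Rightarrow> 'k rauzy_paths \<Rightarrow> 'k" where
  "Phi s f = (\<Sum>k\<in>Poly_Mapping.keys f. cf f k * psi s (fst k) (dirs (snd k)))"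

lemma Phi_superset:
  assumes "finite K" "Poly_Mapping.keys f \<subseteq> K"
  shows "Phi s f = (\<Sum>k\<in>K. cf f k * psi s (fst k) (dirs (snd k)))"
  unfolding Phi_def using assms by (intro sum.mono_neutral_left) (auto simp: in_keys_iff)

lemma Phi_add: "Phi s (f + g) = Phi s f + Phi s g"
proof -
  let ?K = "Poly_Mapping.keys f \<union> Poly_Mapping.keys g"
  have "Phi s f = (\<Sum>k\<in>?K. cf f k * psi s (fst k) (dirs (snd k)))"
    "Phi s g = (\<Sum>k\<in>?K. cf g k * psi s (fst k) (dirs (snd k)))"
    "Phi s (f + g) = (\<Sum>k\<in>?K. cf (f + g) k * psi s (fst k) (dirs (snd k)))"
    using Poly_Mapping.keys_add[of f g] by (intro Phi_superset; auto)+
  then show ?thesis by (simp add: lookup_add distrib_right sum.distrib)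
qed

lemma Phi_0 [simp]: "Phi s 0 = 0"
  by (simp add: Phi_def)

lemma Phi_uminus: "Phi s (- f) = - Phi s f"
  using Phi_add[of s f "- f"] by (simp add: eq_neg_iff_add_eq_0 add.commute)

lemma Phi_diff: "Phi s (f - g) = Phi s f - Phi s g"
  using Phi_add[of s f "- g"] by (simp add: Phi_uminus)

lemma Phi_wpath: "Phi s (wpath c p ds) = (if p \<in> rauzy_vertices then c * psi s p ds else 0)"
proof (cases "valid p ds")
  case True
  then show ?thesis using valid_vertex by (auto simp: Phi_def wpath_def dirs_walk)
next
  case False
  then show ?thesis using psi_valid[of s p ds] by (auto simp: wpath_def)
qed

lemma length_split_4:
  assumes "length (us @ [d, e] @ ws) = 4"
  shows "(\<exists>a b. us = [] \<and> ws = [a, b]) \<or> (\<exists>a b. us = [a] \<and> ws = [b]) \<or> (\<exists>a b. us = [a, b] \<and> ws = [])"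
proof -
  have "length us + length ws = 2" using assms by simp
  then consider "us = []" "length ws = 2" | "length us = 1" "length ws = 1" | "length us = 2" "ws = []"
    by (cases us; cases "tl us") (auto, linarith?)
  then show ?thesis by cases (auto simp: length_Suc_conv numeral_2_eq_2)
qed

lemma square_shift: "square (h + dht d + dht e) (opp d) (opp e) \<longleftrightarrow> square h d e"
  by (auto simp: square_def algebra_simps)

text \<open>If \<open>psi\<close> were nonzero, the word would be supported on a rhombus at
  \<open>p\<close>, or on one edge. Two consecutive steps that do not turn back then run along that
  rhombus; \<open>square_opp\<close> and \<open>square_shift\<close> express this from its other
  corners, where the two steps may begin.\<close>

lemma psi_zero:
  assumes p: "p \<in> rauzy_vertices" and e: "e \<noteq> opp d" and sq: "\<not> square (ht (dest p us)) d e"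
  shows "psi s p (us @ [d, e] @ ws) = 0"
proof (rule ccontr)
  assume n: "psi s p (us @ [d, e] @ ws) \<noteq> 0"
  then have v: "valid p (us @ [d, e] @ ws)" using psi_valid p by blast
  have "length (us @ [d, e] @ ws) = 4" using n unfolding psi_def by (metis (full_types))
  from length_split_4[OF this] show False
  proof (elim disjE exE conjE)
    fix a b assume us: "us = []" "ws = [a, b]"
    then have "psi4 s p d e a b \<noteq> 0" using n psi_simp by (metis append_Cons append_Nil)
    from psi4_nonzero[OF this] show False using e sq us by auto
  next
    fix a b assume us: "us = [a]" "ws = [b]"
    then have "psi4 s p a d e b \<noteq> 0" using n psi_simp by (metis append_Cons append_Nil)
    note nz = psi4_nonzero[OF this]
    have h: "ht (dest p us) = ht p + dht a" using v us valid_stepD(3) by simp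
    have e': "d \<noteq> opp e" using e by auto
    from nz have "d = opp a \<and> square (ht p) a e \<or> e = opp a \<and> square (ht p) a d"
      using e e' by auto
    then show False using sq square_opp[of "ht p" a e] square_opp[of "ht p" a d] square_commute unfolding h by metis
  next
    fix a b assume us: "us = [a, b]" "ws = []"
    then have "psi4 s p a b d e \<noteq> 0" using n psi_simp by (metis append_Cons append_Nil append_Nil2)
    note nz = psi4_nonzero[OF this]
    have h: "ht (dest p us) = ht p + dht a + dht b"
      using v us valid_stepD(3)[of p a] valid_stepD(3)[of "p + dvec a" b] by simp
    from nz have "(d = opp a \<and> e = opp b \<or> d = opp b \<and> e = opp a) \<and> square (ht p) a b"
      using e by auto
    then show False using sq square_shift[of "ht p" a b] square_commute unfolding h by metis
  qed
qed

lemma psi_swap: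
  assumes de: "fst d \<noteq> fst e"
  shows "psi s p (us @ [d, e] @ ws) = psi s p (us @ [e, d] @ ws)"
proof (cases "length (us @ [d, e] @ ws) = 4")
  case False
  then show ?thesis by (simp add: psi_def)
next
  case True
  have ne: "d \<noteq> opp e" "e \<noteq> opp d" "d \<noteq> e" using de by auto
  from length_split_4[OF True] show ?thesis
  proof (elim disjE exE conjE)
    fix a b assume us: "us = []" "ws = [a, b]"
    have "psi4 s p d e a b = psi4 s p e d a b"
      unfolding psi4_def using ne by (auto simp: square_ind_commute[of _ d e])
    then show ?thesis by (simp add: us psi_simp)
  next
    fix a b assume us: "us = [a]" "ws = [b]"
    consider "d = opp a" | "e = opp a" | "d \<noteq> opp a" "e \<noteq> opp a" by blast
    then have "psi4 s p a d e b = psi4 s p a e d b"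
    proof cases
      case 1
      then have "e \<noteq> a" "e \<noteq> opp a" using de by auto
      then show ?thesis unfolding psi4_def using 1 ne by auto
    next
      case 2
      then have "d \<noteq> a" "d \<noteq> opp a" using de by auto
      then show ?thesis unfolding psi4_def using 2 ne by auto
    next
      case 3
      then show ?thesis unfolding psi4_def using ne by auto
    qed
    then show ?thesis by (simp add: us psi_simp)
  next
    fix a b assume us: "us = [a, b]" "ws = []"
    have "psi4 s p a b d e = psi4 s p a b e d" unfolding psi4_def using ne by auto
    then show ?thesis by (simp add: us psi_simp)
  qed
qed

text \<open>Invariance under linear equivalence. The common value is zero unless the rest of the
  word is a loop along some \<open>g\<close>; in that case it is the self-intersection along
  \<open>g\<close> up to sign. For axes other than that of \<open>g\<close>,
  \<open>self_square_eq\<close> gives this value; on the axis of \<open>g\<close> only the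
  self-intersection itself contributes.\<close>

lemma psi_loop:
  assumes s: "sign_choice s" and p: "p \<in> rauzy_vertices"
  shows "\<exists>k. \<forall>a. s a (dest p us) * (psi s p (us @ [(a, True), (a, False)] @ ws)
    - psi s p (us @ [(a, False), (a, True)] @ ws)) = k"
proof (cases "length us + length ws = 2")
  case False
  then show ?thesis by (simp add: psi_def)
next
  case True
  then have "length (us @ [undefined, undefined] @ ws) = 4" by simp
  have ss: "s a p * s a p = 1" for a using sign_unit[OF s p] .
  define k where "k g = s (fst g) p * sgn_dir g * self_square (ht p) g" for g
  have diff: "square_ind (ht p) (a, True) g - square_ind (ht p) (a, False) g = sgn_dir g * self_square (ht p) g"
    if "a \<noteq> fst g" for a g
    unfolding self_square_eq[OF that] mult.assoc[symmetric] sgn_dir_square by simp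
  have cross: "s a p * (s a p * s (fst g) p * square_ind (ht p) (a, True) g
      - s a p * s (fst g) p * square_ind (ht p) (a, False) g) = k g" if "a \<noteq> fst g" for a g
  proof -
    have "s a p * (s a p * s (fst g) p * square_ind (ht p) (a, True) g
        - s a p * s (fst g) p * square_ind (ht p) (a, False) g)
      = (s a p * s a p) * s (fst g) p * (square_ind (ht p) (a, True) g - square_ind (ht p) (a, False) g)"
      by (simp add: algebra_simps)
    then show ?thesis unfolding ss diff[OF that] k_def by simp
  qed
  from length_split_4[OF \<open>length (us @ [undefined, undefined] @ ws) = 4\<close>] show ?thesis
  proof (elim disjE exE conjE)
    fix g h assume us: "us = []" "ws = [g, h]"
    have "s a p * (psi4 s p (a, True) (a, False) g h - psi4 s p (a, False) (a, True) g h)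
      = (if h = opp g then k g else 0)" for a
    proof (cases "h = opp g")
      case h: True
      show ?thesis
      proof (cases "a = fst g")
        case True
        then obtain t where "g = (a, t)" by (cases g) auto
        then show ?thesis using h
          by (cases t) (auto simp: psi4_def k_def sgn_dir_def square_ind_same)
      next
        case False
        then have "g \<noteq> (a, True)" "g \<noteq> (a, False)" by auto
        then show ?thesis using cross[OF False] h by (simp add: psi4_def)
      qed
    qed (simp add: psi4_def)
    then show ?thesis by (simp add: us psi_simp)
  next
    fix g h assume us: "us = [g, h]" "ws = []"
    have "s a (dest p us) * (psi4 s p g h (a, True) (a, False) - psi4 s p g h (a, False) (a, True))
      = (if h = opp g then k g else 0)" for a
    proof (cases "h = opp g")
      case h: True
      have x: "dest p us = p" by (simp add: us h)
      show ?thesis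
      proof (cases "a = fst g")
        case True
        then obtain t where "g = (a, t)" by (cases g) auto
        then show ?thesis unfolding x using h
          by (cases t) (auto simp: psi4_def k_def sgn_dir_def square_ind_same)
      next
        case False
        then have "g \<noteq> (a, True)" "g \<noteq> (a, False)" by auto
        then show ?thesis unfolding x using cross[OF False] h
          by (simp add: psi4_def square_ind_commute[of _ g] mult.commute[of "s (fst g) p"])
      qed
    next
      case False
      then have "psi4 s p g h (a, t) (a, \<not> t) = 0" for t
        using psi4_nonzero[of s p g h "(a, t)" "(a, \<not> t)"] by (metis opp_simps(3,4))
      from this[of True] this[of False] show ?thesis using False by simp
    qed
    then show ?thesis by (simp add: us psi_simp)
  next
    fix g h assume us: "us = [g]" "ws = [h]"
    have "s a (p + dvec g) * (psi4 s p g (a, True) (a, False) h - psi4 s p g (a, False) (a, True) h)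
      = (if h = opp g \<and> valid_step p g then k g else 0)" for a
    proof (cases "h = opp g \<and> valid_step p g")
      case h: True
      \<comment> \<open>When the loop is inserted in the middle, the relation is taken at the far
        end of \<open>g\<close>. There \<open>g\<close> points backwards, so the two loops on its
        axis change places; the sign rule, which reverses the sign of that axis and keeps the
        others, compensates exactly for this.\<close>
      have edge: "{p, p + dvec g} \<in> rauzy_edges" using h edge_iff by blast
      have dv: "p + dvec g = p + pe (fst g) \<or> p + dvec g = p - pe (fst g)" by (auto simp: dvec_def)
      have "s (fst g) (p + dvec g) = - s (fst g) p \<and> (\<forall>c. c \<noteq> fst g \<longrightarrow> s c (p + dvec g) = s c p)"
        using s[unfolded sign_choice_def, THEN conjunct2, rule_format, OF conjI, OF edge dv] by blast
      then have sg: "s (fst g) (p + dvec g) = - s (fst g) p" "c \<noteq> fst g \<Longrightarrow> s c (p + dvec g) = s c p" for c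
        by blast+
      show ?thesis
      proof (cases "a = fst g")
        case True
        then obtain t where "g = (a, t)" by (cases g) auto
        then show ?thesis using h sg(1)
          by (cases t) (auto simp: psi4_def k_def sgn_dir_def square_ind_same)
      next
        case False
        then have "opp g \<noteq> (a, True)" "opp g \<noteq> (a, False)" by (auto simp: opp_def)
        then show ?thesis using cross[OF False] h sg(2)[OF False]
          by (simp add: psi4_def square_ind_commute[of _ g] mult.commute[of "s (fst g) p"])
      qed
    next
      case False
      have "psi4 s p g (a, t) (a, \<not> t) h = 0" for t
      proof (rule ccontr)
        assume n: "psi4 s p g (a, t) (a, \<not> t) h \<noteq> 0"
        have "h = opp g" using psi4_nonzero[OF n] by (auto simp: opp_def prod_eq_iff)
        moreover have "valid_step p g" using psi4_valid[OF n p] by simp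
        ultimately show False using False by blast
      qed
      from this[of True] this[of False] show ?thesis using False by auto
    qed
    then show ?thesis by (simp add: us psi_simp)
  qed
qed

lemma Phi_relation:
  fixes s :: "3 \<Rightarrow> point \<Rightarrow> 'k::field"
  assumes s: "sign_choice s" and r: "r \<in> rauzy_relations s"
  shows "Phi s (path_mult RQ (path_mult RQ (wpath c p us) r) (wpath b q ws)) = 0"
proof -
  have m: "path_mult RQ (path_mult RQ (wpath c p us) (wpath k x vs)) (wpath b q ws)
      = (if x = dest p us \<and> q = dest x vs then wpath (c * k * b) p (us @ vs @ ws) else 0)" for k x vs
    by (simp add: wpath_mult)
  have sub: "path_mult RQ (path_mult RQ (wpath c p us) (f - g)) (wpath b q ws)
      = path_mult RQ (path_mult RQ (wpath c p us) f) (wpath b q ws)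
        - path_mult RQ (path_mult RQ (wpath c p us) g) (wpath b q ws)" for f g
    by (simp add: path_mult_diff_left path_mult_diff_right)
  show ?thesis
  proof (cases "p \<in> rauzy_vertices")
    case False
    then have "wpath c p us = 0" using valid_vertex by (auto simp: wpath_def)
    then show ?thesis by simp
  next
    case p: True
    from r show ?thesis
    proof (cases rule: rauzy_relations_cases)
      case (zero x d e)
      have "psi s p (us @ [d, e] @ ws) = 0" if x: "x = dest p us"
        by (rule psi_zero[OF p zero(3)]) (use zero(4) in \<open>simp add: x\<close>)
      then have "Phi s (wpath (c * 1 * b) p (us @ [d, e] @ ws)) = 0" if "x = dest p us"
        using that unfolding Phi_wpath by simp
      then show ?thesis unfolding zero(1) m by (simp only: if_distrib[of "Phi s"] Phi_0) simp
    next
      case (square x d e)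
      have "dest x [d, e] = dest x [e, d]" by (simp add: add_ac)
      moreover have "Phi s (wpath (c * 1 * b) p (us @ [d, e] @ ws)) = Phi s (wpath (c * 1 * b) p (us @ [e, d] @ ws))"
        unfolding Phi_wpath psi_swap[OF square(3), of s p us ws] ..
      ultimately show ?thesis unfolding square(1) sub m Phi_diff by (simp only: if_distrib[of "Phi s"] Phi_0) simp
    next
      case (loops x a' c')
      have d: "dest x [(a, True), (a, False)] = x" "dest x [(a, False), (a, True)] = x" for a
        by (simp_all add: dvec_def)
      obtain k where k: "s a (dest p us) * (psi s p (us @ [(a, True), (a, False)] @ ws)
        - psi s p (us @ [(a, False), (a, True)] @ ws)) = k" for a using psi_loop[OF s p] by blast
      show ?thesis
      proof (cases "x = dest p us \<and> q = x")
        case True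
        have "Phi s (path_mult RQ (path_mult RQ (wpath c p us) r) (wpath b q ws))
          = c * b * (s a' x * (psi s p (us @ [(a', True), (a', False)] @ ws) - psi s p (us @ [(a', False), (a', True)] @ ws)))
          - c * b * (s c' x * (psi s p (us @ [(c', True), (c', False)] @ ws) - psi s p (us @ [(c', False), (c', True)] @ ws)))"
        proof -
          have c: "(x = dest p us \<and> q = x) = True" using True by blast
          show ?thesis unfolding loops(1) sub m d
            by (simp only: c if_True Phi_diff Phi_wpath p) (simp add: algebra_simps)
        qed
        also have "\<dots> = 0" using True k[of a'] k[of c'] by simp
        finally show ?thesis .
      next
        case False
        then show ?thesis unfolding loops(1) sub m d by auto
      qed
    qed
  qed
qed

text \<open>The elements on which \<open>Phi\<close> vanishes between any two words form a two-sided
  ideal, whatever the form. So it is enough to test the generators, which is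
  \<open>Phi_relation\<close>.\<close>

lemma Phi_ideal:
  fixes s :: "3 \<Rightarrow> point \<Rightarrow> 'k::field"
  assumes s: "sign_choice s"
  shows "f \<in> rauzy_ideal s \<Longrightarrow> Phi s (path_mult RQ (path_mult RQ (wpath c p us) f) (wpath b q ws)) = 0"
proof -
  define K where "K = {f \<in> PA RQ. \<forall>c p us b q ws.
    Phi s (path_mult RQ (path_mult RQ (wpath c p us) f) (wpath b q ws)) = 0}"
  have K: "f \<in> PA RQ" "Phi s (path_mult RQ (path_mult RQ (wpath c p us) f) (wpath b q ws)) = 0"
    if "f \<in> K" for f c p us b q ws using that by (simp_all add: K_def)
  have KI: "f \<in> K" if "f \<in> PA RQ"
    "\<And>c p us b q ws. Phi s (path_mult RQ (path_mult RQ (wpath c p us) f) (wpath b q ws)) = 0" for f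
    using that by (simp add: K_def)
  have left: "path_mult RQ r f \<in> K" if f: "f \<in> K" and r: "r \<in> PA RQ" for f r
  proof (rule KI)
    show "path_mult RQ r f \<in> PA RQ" using PA_mult[OF r K(1)[OF f]] .
    fix c p us b q ws
    show "Phi s (path_mult RQ (path_mult RQ (wpath c p us) (path_mult RQ r f)) (wpath b q ws)) = 0"
      using r
    proof (induction rule: PA_RQ_induct)
      case (wpath k x vs)
      have "path_mult RQ (wpath c p us) (path_mult RQ (wpath k x vs) f)
        = path_mult RQ (path_mult RQ (wpath c p us) (wpath k x vs)) f" by (simp add: path_mult_assoc)
      then show ?case unfolding wpath_mult using K(2)[OF f] by simp
    qed (simp_all add: path_mult_add_left path_mult_add_right Phi_add)
  qed
  have right: "path_mult RQ f r \<in> K" if f: "f \<in> K" and r: "r \<in> PA RQ" for f r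
  proof (rule KI)
    show "path_mult RQ f r \<in> PA RQ" using PA_mult[OF K(1)[OF f] r] .
    fix c p us b q ws
    show "Phi s (path_mult RQ (path_mult RQ (wpath c p us) (path_mult RQ f r)) (wpath b q ws)) = 0"
      using r
    proof (induction rule: PA_RQ_induct)
      case (wpath k x vs)
      have "path_mult RQ (path_mult RQ (wpath c p us) (path_mult RQ f (wpath k x vs))) (wpath b q ws)
        = path_mult RQ (path_mult RQ (wpath c p us) f) (path_mult RQ (wpath k x vs) (wpath b q ws))"
        by (simp add: path_mult_assoc)
      then show ?case unfolding wpath_mult using K(2)[OF f] by simp
    qed (simp_all add: path_mult_add_left path_mult_add_right Phi_add)
  qed
  have add: "f + g \<in> K" if fg: "f \<in> K" "g \<in> K" for f g
    using PA_add[OF K(1)[OF fg(1)] K(1)[OF fg(2)]]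
    by (rule KI) (simp add: path_mult_add_left path_mult_add_right Phi_add K(2)[OF fg(1)] K(2)[OF fg(2)])
  have uminus: "- f \<in> K" if f: "f \<in> K" for f
    using PA_uminus[OF K(1)[OF f]]
    by (rule KI) (simp add: path_mult_minus_left path_mult_minus_right Phi_uminus K(2)[OF f])
  have zero: "0 \<in> K" by (simp add: K_def)
  have "two_sided_ideal K (path_algebra RQ)"
    unfolding two_sided_ideal_iff
    by (intro conjI ballI subsetI) (erule K(1), rule zero, erule (1) add, erule uminus, erule (1) left, erule (1) right)
  moreover have "rauzy_relations s \<subseteq> K"
  proof
    fix r assume r: "r \<in> rauzy_relations s"
    then have "r \<in> PA RQ" using rauzy_relations_PA by blast
    then show "r \<in> K" using Phi_relation[OF s r] by (rule KI)
  qed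
  ultimately have "rauzy_ideal s \<subseteq> K" unfolding rauzy_ideal_def by (rule ideal_gen_least)
  then show "f \<in> rauzy_ideal s \<Longrightarrow> Phi s (path_mult RQ (path_mult RQ (wpath c p us) f) (wpath b q ws)) = 0"
    using K(2) by blast
qed

section \<open>A criterion for rhombus modules\<close>

lemma rauzy_algebra_eq: "rauzy_algebra s = path_algebra RQ Quot rauzy_ideal s"
  by (simp add: rauzy_algebra_def)

text \<open>Elements without trivial paths form a two-sided ideal that contains all relations.
  Coefficients at trivial paths are therefore well defined on the algebra, as the action on simple
  modules requires.\<close>

lemma ideal_trivial_path: "f \<in> rauzy_ideal s \<Longrightarrow> cf f (z, []) = 0"
proof -
  define K where "K = {f \<in> PA RQ. \<forall>z. cf f (z, []) = (0::'a::field)}"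
  have K0: "cf f (z, []) = 0" if "f \<in> K" for f z using that by (simp add: K_def)
  have KI: "f \<in> K" if "f \<in> PA RQ" "\<And>z. cf f (z, []) = 0" for f using that by (simp add: K_def)
  have KPA: "f \<in> PA RQ" if "f \<in> K" for f using that by (simp add: K_def)
  have "path_mult RQ r f \<in> K" "path_mult RQ f r \<in> K" if f: "f \<in> K" and r: "r \<in> PA RQ" for f r
    by (rule KI; simp add: PA_mult KPA[OF f] r path_mult_lookup K0[OF f])+
  moreover have "f + g \<in> K" if f: "f \<in> K" and g: "g \<in> K" for f g
    by (rule KI) (simp_all add: PA_add KPA[OF f] KPA[OF g] lookup_add K0[OF f] K0[OF g])
  moreover have "- f \<in> K" if f: "f \<in> K" for f
    by (rule KI) (simp_all add: PA_uminus KPA[OF f] K0[OF f])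
  moreover have "0 \<in> K" by (rule KI) simp_all
  ultimately have "two_sided_ideal K (path_algebra RQ)"
    unfolding two_sided_ideal_iff using KPA by (intro conjI ballI subsetI) simp_all
  moreover have "r \<in> K" if r: "r \<in> rauzy_relations s" for r
  proof (rule KI)
    show "r \<in> PA RQ" using r rauzy_relations_PA by blast
    have w: "cf (wpath c x (d # ds)) (z, []) = 0" for c x d ds z
      by (simp add: wpath_def lookup_single when_def)
    show "cf r (z, []) = 0" for z
      using r by (cases rule: rauzy_relations_cases) (simp_all add: lookup_minus w)
  qed
  ultimately have "rauzy_ideal s \<subseteq> K" unfolding rauzy_ideal_def by (intro ideal_gen_least) auto
  then show "f \<in> rauzy_ideal s \<Longrightarrow> ?thesis" using K0 by blast
qed

lemma simple_mod_act: "c \<cdot>\<^bsub>simple_mod z\<^esub> rq.cls s f = c * cf f (z, [])"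
proof -
  define g where "g = (SOME g. g \<in> rq.cls s f)"
  have "g \<in> rq.cls s f" unfolding g_def using rq.cls_self by (rule someI)
  then have "g - f \<in> rauzy_ideal s" using rq.mem_cls by blast
  from ideal_trivial_path[OF this] have "cf g (z, []) = cf f (z, [])" by (simp add: lookup_minus)
  then show ?thesis by (simp add: simple_mod_def g_def)
qed

lemma simple_mod_simps [simp]: "carrier (simple_mod z) = UNIV" "zero (simple_mod z) = 0"
  "add (simple_mod z) = (+)"
  by (simp_all add: simple_mod_def)

lemma simple_mod_abelian_group: "abelian_group (simple_mod z)"
proof (rule abelian_groupI)
  fix x assume "x \<in> carrier (simple_mod z)"
  show "\<exists>y\<in>carrier (simple_mod z). y \<oplus>\<^bsub>simple_mod z\<^esub> x = \<zero>\<^bsub>simple_mod z\<^esub>"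
    by (rule bexI[of _ "- x"]) simp_all
qed (simp_all add: add_ac)

lemma direct_sum_simps [simp]: "carrier (direct_sum M N) = carrier M \<times> carrier N"
  "zero (direct_sum M N) = (\<zero>\<^bsub>M\<^esub>, \<zero>\<^bsub>N\<^esub>)"
  "(m, n) \<oplus>\<^bsub>direct_sum M N\<^esub> (m', n') = (m \<oplus>\<^bsub>M\<^esub> m', n \<oplus>\<^bsub>N\<^esub> n')"
  "(m, n) \<cdot>\<^bsub>direct_sum M N\<^esub> a = (m \<cdot>\<^bsub>M\<^esub> a, n \<cdot>\<^bsub>N\<^esub> a)"
  by (simp_all add: direct_sum_def)

lemma direct_sum_simple_abelian_group: "abelian_group (direct_sum (simple_mod u) (simple_mod v))"
proof (rule abelian_groupI)
  fix x assume "x \<in> carrier (direct_sum (simple_mod u) (simple_mod v))"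
  then show "\<exists>y\<in>carrier (direct_sum (simple_mod u) (simple_mod v)).
      y \<oplus>\<^bsub>direct_sum (simple_mod u) (simple_mod v)\<^esub> x = \<zero>\<^bsub>direct_sum (simple_mod u) (simple_mod v)\<^esub>"
    by (intro bexI[of _ "(- fst x, - snd x)"]; cases x) simp_all
qed (auto simp: add_ac)

lemma A_closed:
  "a \<in> carrier (rauzy_algebra s) \<Longrightarrow> b \<in> carrier (rauzy_algebra s) \<Longrightarrow>
    a \<oplus>\<^bsub>rauzy_algebra s\<^esub> b \<in> carrier (rauzy_algebra s)"
  "a \<in> carrier (rauzy_algebra s) \<Longrightarrow> b \<in> carrier (rauzy_algebra s) \<Longrightarrow>
    a \<otimes>\<^bsub>rauzy_algebra s\<^esub> b \<in> carrier (rauzy_algebra s)"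
proof -
  assume "a \<in> carrier (rauzy_algebra s)" "b \<in> carrier (rauzy_algebra s)"
  then obtain f g where f: "a = rq.cls s f" "f \<in> PA RQ" and g: "b = rq.cls s g" "g \<in> PA RQ"
    unfolding rauzy_algebra_eq rq.A_carrier by blast
  show "a \<oplus>\<^bsub>rauzy_algebra s\<^esub> b \<in> carrier (rauzy_algebra s)"
    unfolding rauzy_algebra_eq f(1) g(1) rq.cls_add using PA_add[OF f(2) g(2)] by (rule rq.cls_carrier)
  show "a \<otimes>\<^bsub>rauzy_algebra s\<^esub> b \<in> carrier (rauzy_algebra s)"
    unfolding rauzy_algebra_eq f(1) g(1) rq.cls_mult[OF f(2) g(2)] using PA_mult[OF f(2) g(2)]
    by (rule rq.cls_carrier)
qed

lemma A_cls: "a \<in> carrier (rauzy_algebra s) \<longleftrightarrow> (\<exists>f\<in>PA RQ. a = rq.cls s f)"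
  unfolding rauzy_algebra_eq rq.A_carrier by blast

text \<open>The coordinates \<open>cz\<close>, \<open>cu\<close>, \<open>cy\<close>, \<open>cv\<close> belong to basis elements at the corners
  \<open>z = p\<close>, \<open>u = p + dvec d\<close>, \<open>y = p + dvec d + dvec e\<close>, \<open>v = p + dvec e\<close>.\<close>

locale rhombus_coords = right_module "rauzy_algebra s" M
  for s :: "3 \<Rightarrow> point \<Rightarrow> 'k::field" and M :: "('k rauzy_paths set, 'm) rmod" (structure) +
  fixes p :: point and d e :: dir and cy cu cv cz :: "'m \<Rightarrow> 'k"
  assumes vertex: "p \<in> rauzy_vertices" and square: "square (ht p) d e"
    and add_coords: "m \<in> carrier M \<Longrightarrow> m' \<in> carrier M \<Longrightarrow> cy (m \<oplus> m') = cy m + cy m'"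
      "m \<in> carrier M \<Longrightarrow> m' \<in> carrier M \<Longrightarrow> cu (m \<oplus> m') = cu m + cu m'"
      "m \<in> carrier M \<Longrightarrow> m' \<in> carrier M \<Longrightarrow> cv (m \<oplus> m') = cv m + cv m'"
      "m \<in> carrier M \<Longrightarrow> m' \<in> carrier M \<Longrightarrow> cz (m \<oplus> m') = cz m + cz m'"
    and coords_surj: "\<exists>m\<in>carrier M. cy m = ky \<and> cu m = ku \<and> cv m = kv \<and> cz m = kz"
    and coords_inj: "m \<in> carrier M \<Longrightarrow> m' \<in> carrier M \<Longrightarrow> cy m = cy m' \<Longrightarrow> cu m = cu m' \<Longrightarrow>
      cv m = cv m' \<Longrightarrow> cz m = cz m' \<Longrightarrow> m = m'"
    and act_coords: "m \<in> carrier M \<Longrightarrow> f \<in> PA RQ \<Longrightarrow>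
        cy (m \<cdot> rq.cls s f) = cy m * cf f (p + dvec d + dvec e, [])"
      "m \<in> carrier M \<Longrightarrow> f \<in> PA RQ \<Longrightarrow> cu (m \<cdot> rq.cls s f)
        = cy m * cf f (p + dvec d + dvec e, walk (p + dvec d + dvec e) [opp e]) + cu m * cf f (p + dvec d, [])"
      "m \<in> carrier M \<Longrightarrow> f \<in> PA RQ \<Longrightarrow> cv (m \<cdot> rq.cls s f)
        = cy m * cf f (p + dvec d + dvec e, walk (p + dvec d + dvec e) [opp d]) + cv m * cf f (p + dvec e, [])"
      "m \<in> carrier M \<Longrightarrow> f \<in> PA RQ \<Longrightarrow> cz (m \<cdot> rq.cls s f)
        = cy m * (cf f (p + dvec d + dvec e, walk (p + dvec d + dvec e) [opp e, opp d])
                + cf f (p + dvec d + dvec e, walk (p + dvec d + dvec e) [opp d, opp e]))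
          + cu m * cf f (p + dvec d, walk (p + dvec d) [opp d])
          + cv m * cf f (p + dvec e, walk (p + dvec e) [opp e]) + cz m * cf f (p, [])"
begin

abbreviation "y \<equiv> p + dvec d + dvec e"

lemma zero_additive:
  assumes "\<And>m m'. m \<in> carrier M \<Longrightarrow> m' \<in> carrier M \<Longrightarrow> c (m \<oplus> m') = c m + (c m' :: 'k)"
  shows "c \<zero> = 0" "m \<in> carrier M \<Longrightarrow> c (\<ominus> m) = - c m"
proof -
  have "c (\<zero> \<oplus> \<zero>) = c \<zero> + c \<zero>" by (rule assms) auto
  then have "c \<zero> = c \<zero> + c \<zero>" by (simp only: l_zero zero_closed)
  then show z: "c \<zero> = 0" by (simp only: add_cancel_right_right)
  assume m: "m \<in> carrier M"
  then have "c (\<ominus> m \<oplus> m) = c (\<ominus> m) + c m" by (intro assms) auto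
  then show "c (\<ominus> m) = - c m" using m z by (simp add: l_neg eq_neg_iff_add_eq_0)
qed

lemmas zero_coords [simp] = zero_additive(1)[of cy, OF add_coords(1)] zero_additive(1)[of cu, OF add_coords(2)]
  zero_additive(1)[of cv, OF add_coords(3)] zero_additive(1)[of cz, OF add_coords(4)]

lemmas uminus_coords = zero_additive(2)[of cy, OF add_coords(1)] zero_additive(2)[of cu, OF add_coords(2)]
  zero_additive(2)[of cv, OF add_coords(3)] zero_additive(2)[of cz, OF add_coords(4)]

lemma axes: "fst d \<noteq> fst e"
  using square by (simp add: square_def)

lemma dvec_ne: "dvec d \<noteq> dvec e" "dvec e \<noteq> dvec d" "opp d \<noteq> opp e" "opp e \<noteq> opp d"
  using axes unfolding dvec_inj by (auto simp: opp_def)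

lemma corner_ne: "y \<noteq> p" "p \<noteq> y"
  using not_tile_path(1)[of p d "opp d"] dvec_inj[of d "opp e"] axes
  by (auto simp: add.assoc eq_neg_iff_add_eq_0)

lemma valid_words: "valid y []" "valid y [opp e]" "valid y [opp d]" "valid y [opp e, opp d]"
  "valid (p + dvec d) [opp d]" "valid (p + dvec e) [opp e]" "valid p []"
proof -
  have v: "valid p [d, e, opp e, opp d]" "valid p [d, e, opp d, opp e]" "valid p [d, opp d]" "valid p [e, opp e]"
    using vertex square by (simp_all add: valid_iff square_def algebra_simps)
  then show "valid y []" "valid y [opp e]" "valid y [opp d]" "valid y [opp e, opp d]"
    "valid (p + dvec d) [opp d]" "valid (p + dvec e) [opp e]" "valid p []"
    using valid_stepD(1)[of y "opp e"] valid_stepD(1)[of "p + dvec d" e] valid_stepD(1)[of "p + dvec e" "opp e"]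
    by auto
qed

lemma cf_trivial: "valid q ws \<Longrightarrow> cf (wpath c q ws) (x, []) = (if q = x \<and> ws = [] then c else 0)"
  using cf_wpath[of q ws c x "[]"] by simp

lemma act_carrier: "m \<in> carrier M \<Longrightarrow> f \<in> PA RQ \<Longrightarrow> m \<cdot> rq.cls s f \<in> carrier M"
  by (rule ract_closed) (auto simp: A_cls)

text \<open>The element \<open>f\<close> is supported on paths that start at \<open>y\<close>, so
  the coordinates of \<open>m\<close> at the other corners do not contribute. Division by
  \<open>cy m\<close> then yields any prescribed element, and \<open>Rad\<close> is the only maximal
  submodule.\<close>

lemma submod_full:
  assumes N: "submod (rauzy_algebra s) N M" and m: "m \<in> N" "cy m \<noteq> 0"
  shows "N = carrier M"
proof
  note N' = N[unfolded submod_iff[OF abelian_group_axioms]]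
  show "N \<subseteq> carrier M" using N' by blast
  then have mM: "m \<in> carrier M" using m by blast
  show "carrier M \<subseteq> N"
  proof
    fix t assume t: "t \<in> carrier M"
    define f where "f = wpath (cy t / cy m) y [] + wpath ((cu t) / cy m) y [opp e]
      + wpath ((cv t) / cy m) y [opp d] + wpath ((cz t) / cy m) y [opp e, opp d]"
    have f: "f \<in> PA RQ" unfolding f_def by (intro PA_add wpath_PA)
    note c = cf_wpath[OF valid_words(1)] cf_wpath[OF valid_words(2)] cf_wpath[OF valid_words(3)]
      cf_wpath[OF valid_words(4)] cf_trivial[OF valid_words(1)] cf_trivial[OF valid_words(2)]
      cf_trivial[OF valid_words(3)] cf_trivial[OF valid_words(4)]
    have "m \<cdot> rq.cls s f = t"
    proof (rule coords_inj[OF act_carrier[OF mM f] t])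
      show "cy (m \<cdot> rq.cls s f) = cy t" unfolding act_coords(1)[OF mM f] unfolding f_def lookup_add c
        using m(2) by simp
      show "cu (m \<cdot> rq.cls s f) = cu t" unfolding act_coords(2)[OF mM f] unfolding f_def lookup_add c
        using m(2) dvec_ne by simp
      show "cv (m \<cdot> rq.cls s f) = cv t" unfolding act_coords(3)[OF mM f] unfolding f_def lookup_add c
        using m(2) dvec_ne by simp
      show "cz (m \<cdot> rq.cls s f) = cz t" unfolding act_coords(4)[OF mM f] unfolding f_def lookup_add c
        using m(2) dvec_ne corner_ne by simp
    qed
    moreover have "m \<cdot> rq.cls s f \<in> N" using N' m(1) f A_cls by blast
    ultimately show "t \<in> N" by simp
  qed
qed

definition "Rad = {m \<in> carrier M. cy m = 0}"
definition "Soc = {m \<in> carrier M. cy m = 0 \<and> cu m = 0 \<and> cv m = 0}"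

lemma submod_Rad: "submod (rauzy_algebra s) Rad M"
  unfolding submod_iff[OF abelian_group_axioms]
proof (intro conjI ballI subsetI)
  fix m a assume m: "m \<in> Rad" and a: "a \<in> carrier (rauzy_algebra s)"
  obtain f where f: "f \<in> PA RQ" "a = rq.cls s f" using a A_cls by blast
  show "m \<cdot> a \<in> Rad" using m act_carrier[OF _ f(1)] act_coords(1)[OF _ f(1)] by (simp add: Rad_def f(2))
qed (auto simp: Rad_def add_coords uminus_coords)

lemma submod_Soc: "submod (rauzy_algebra s) Soc M"
  unfolding submod_iff[OF abelian_group_axioms]
proof (intro conjI ballI subsetI)
  fix m a assume m: "m \<in> Soc" and a: "a \<in> carrier (rauzy_algebra s)"
  obtain f where f: "f \<in> PA RQ" "a = rq.cls s f" using a A_cls by blast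
  show "m \<cdot> a \<in> Soc" using m act_carrier[OF _ f(1)] act_coords(1-3)[OF _ f(1)] by (simp add: Soc_def f(2))
qed (auto simp: Soc_def add_coords uminus_coords)

lemma submod_proper: "submod (rauzy_algebra s) N M \<Longrightarrow> N \<noteq> carrier M \<Longrightarrow> N \<subseteq> Rad"
  using submod_full submod_iff[OF abelian_group_axioms, of "rauzy_algebra s" N] unfolding Rad_def by blast

lemma Rad_ne: "Rad \<noteq> carrier M"
proof -
  obtain m where "m \<in> carrier M" "cy m = 1" using coords_surj[of 1 0 0 0] by blast
  then have "m \<notin> Rad" by (simp add: Rad_def)
  then show ?thesis using \<open>m \<in> carrier M\<close> by blast
qed

lemma radical_eq: "radical (rauzy_algebra s) M = Rad"
proof -
  have "{N. maximal_submod (rauzy_algebra s) N M} = {Rad}"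
  proof (intro equalityI subsetI)
    fix N assume "N \<in> {N. maximal_submod (rauzy_algebra s) N M}"
    then have N: "submod (rauzy_algebra s) N M" "N \<noteq> carrier M"
      "\<And>N'. submod (rauzy_algebra s) N' M \<Longrightarrow> N \<subseteq> N' \<Longrightarrow> N' = N \<or> N' = carrier M"
      unfolding maximal_submod_def by blast+
    have "Rad = N" using N(3)[OF submod_Rad submod_proper[OF N(1,2)]] Rad_ne by blast
    then show "N \<in> {Rad}" by simp
  next
    fix N assume "N \<in> {Rad}"
    moreover have "maximal_submod (rauzy_algebra s) Rad M"
      unfolding maximal_submod_def using submod_Rad Rad_ne submod_proper by blast
    ultimately show "N \<in> {N. maximal_submod (rauzy_algebra s) N M}" by simp
  qed
  then show ?thesis unfolding radical_def by (auto simp: Rad_def)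
qed

text \<open>From the first nonzero coordinate of an element, in the order \<open>y\<close>,
  \<open>u\<close>, \<open>v\<close>, \<open>z\<close>, a path leads to the corner \<open>p\<close>
  and gives any multiple of the socle vector. So \<open>Soc\<close> is the only simple
  submodule.\<close>

lemma Soc_subset:
  assumes N: "submod (rauzy_algebra s) N M" and ne: "N \<noteq> {\<zero>}"
  shows "Soc \<subseteq> N"
proof -
  note N' = N[unfolded submod_iff[OF abelian_group_axioms]]
  obtain m where m: "m \<in> N" "m \<noteq> \<zero>" using N' ne by blast
  have mM: "m \<in> carrier M" using m N' by blast
  have reach: "Soc \<subseteq> N" if f: "\<And>k. f k \<in> PA RQ" and c: "\<And>k. cy (m \<cdot> rq.cls s (f k)) = 0"
    "\<And>k. cu (m \<cdot> rq.cls s (f k)) = 0" "\<And>k. cv (m \<cdot> rq.cls s (f k)) = 0"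
    "\<And>k. cz (m \<cdot> rq.cls s (f k)) = k" for f
  proof
    fix t assume t: "t \<in> Soc"
    then have "m \<cdot> rq.cls s (f (cz t)) = t"
      by (intro coords_inj[OF act_carrier[OF mM f]]) (simp_all add: c Soc_def)
    moreover have "m \<cdot> rq.cls s (f (cz t)) \<in> N" using N' m(1) f A_cls by blast
    ultimately show "t \<in> N" by simp
  qed
  have ne': "cy m \<noteq> 0 \<or> cu m \<noteq> 0 \<or> cv m \<noteq> 0 \<or> cz m \<noteq> 0"
    using coords_inj[OF mM zero_closed] m(2) by auto
  consider "cy m \<noteq> 0" | "cy m = 0" "cu m \<noteq> 0" | "cy m = 0" "cu m = 0" "cv m \<noteq> 0"
    | "cy m = 0" "cu m = 0" "cv m = 0" "cz m \<noteq> 0" using ne' by blast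
  then show ?thesis
  proof cases
    case 1
    then show ?thesis using submod_full[OF N m(1)] by (auto simp: Soc_def)
  next
    case 2
    note c = cf_wpath[OF valid_words(5)] cf_trivial[OF valid_words(5)]
    show ?thesis
      by (rule reach[of "\<lambda>k. wpath (k / cu m) (p + dvec d) [opp d]"])
        (use 2 dvec_ne in \<open>simp_all only: act_coords[OF mM wpath_PA] c, simp_all\<close>)
  next
    case 3
    note c = cf_wpath[OF valid_words(6)] cf_trivial[OF valid_words(6)]
    show ?thesis
      by (rule reach[of "\<lambda>k. wpath (k / cv m) (p + dvec e) [opp e]"])
        (use 3 dvec_ne in \<open>simp_all only: act_coords[OF mM wpath_PA] c, simp_all\<close>)
  next
    case 4
    note c = cf_wpath[OF valid_words(7)] cf_trivial[OF valid_words(7)]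
    show ?thesis
      by (rule reach[of "\<lambda>k. wpath (k / cz m) p []"])
        (use 4 dvec_ne corner_ne in \<open>simp_all only: act_coords[OF mM wpath_PA] c, simp_all\<close>)
  qed
qed

lemma Soc_ne: "Soc \<noteq> {\<zero>}"
proof -
  obtain m where "m \<in> carrier M" "cy m = 0" "cu m = 0" "cv m = 0" "cz m = 1"
    using coords_surj[of 0 0 0 1] by blast
  then have "m \<in> Soc" "m \<noteq> \<zero>" by (auto simp: Soc_def)
  then show ?thesis by blast
qed

lemma socle_eq: "socle (rauzy_algebra s) M = Soc"
proof -
  have z: "\<zero> \<in> N" if "submod (rauzy_algebra s) N M" for N
    using that submod_iff[OF abelian_group_axioms] by blast
  have simple: "simple_submod (rauzy_algebra s) Soc M"
    unfolding simple_submod_def using submod_Soc Soc_ne Soc_subset by blast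
  have "T = Soc" if T: "simple_submod (rauzy_algebra s) T M" for T
  proof -
    have "submod (rauzy_algebra s) T M" "T \<noteq> {\<zero>}"
      "\<And>N'. submod (rauzy_algebra s) N' M \<Longrightarrow> N' \<subseteq> T \<Longrightarrow> N' = {\<zero>} \<or> N' = T"
      using T unfolding simple_submod_def by blast+
    from this(3)[OF submod_Soc Soc_subset[OF this(1,2)]] show "T = Soc" using Soc_ne by blast
  qed
  then have "{N. submod (rauzy_algebra s) N M \<and> (\<forall>S. simple_submod (rauzy_algebra s) S M \<longrightarrow> S \<subseteq> N)}
    = {N. submod (rauzy_algebra s) N M \<and> Soc \<subseteq> N}"
    using simple by blast
  then show ?thesis unfolding socle_def using submod_Soc by blast
qed

lemma Soc_Rad: "Soc \<subseteq> Rad"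
  by (auto simp: Soc_def Rad_def)

lemma top_iso: "mod_iso (rauzy_algebra s) (quot_mod M Rad) (simple_mod y)"
proof (rule quot_iso[OF right_module_axioms submod_Rad A_closed simple_mod_abelian_group])
  show "cy \<in> mod_hom (rauzy_algebra s) M (simple_mod y)"
    unfolding mod_hom_def hom_def
    by (auto simp: add_coords A_cls simple_mod_act act_coords(1))
  show "cy ` carrier M = carrier (simple_mod y)"
  proof -
    have "k \<in> cy ` carrier M" for k using coords_surj[of k 0 0 0] by blast
    then show ?thesis by auto
  qed
  show "Rad = a_kernel M (simple_mod y) cy"
    by (simp add: Rad_def a_kernel_def kernel_def)
qed

lemma middle_iso: "mod_iso (rauzy_algebra s) (quot_mod (restrict_mod M Rad) Soc)
  (direct_sum (simple_mod (p + dvec d)) (simple_mod (p + dvec e)))"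
proof (rule quot_iso[OF restrict_right_module[OF right_module_axioms submod_Rad]
      restrict_submod[OF right_module_axioms submod_Soc submod_Rad Soc_Rad] A_closed
      direct_sum_simple_abelian_group])
  let ?g = "\<lambda>m. (cu m, cv m)"
  show "?g \<in> mod_hom (rauzy_algebra s) (restrict_mod M Rad)
    (direct_sum (simple_mod (p + dvec d)) (simple_mod (p + dvec e)))"
    unfolding mod_hom_def hom_def
    by (auto simp: Rad_def add_coords A_cls simple_mod_act act_coords(2,3))
  show "?g ` carrier (restrict_mod M Rad)
    = carrier (direct_sum (simple_mod (p + dvec d)) (simple_mod (p + dvec e)))"
  proof -
    have "(k, l) \<in> ?g ` Rad" for k l using coords_surj[of 0 k l 0] by (auto simp: Rad_def)
    then show ?thesis by auto
  qed
  show "Soc = a_kernel (restrict_mod M Rad) (direct_sum (simple_mod (p + dvec d)) (simple_mod (p + dvec e))) ?g"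
    by (auto simp: Soc_def Rad_def a_kernel_def kernel_def)
qed

lemma socle_iso: "mod_iso (rauzy_algebra s) (restrict_mod M Soc) (simple_mod p)"
  unfolding mod_iso_def
proof (intro bexI[of _ cz])
  show "cz \<in> mod_hom (rauzy_algebra s) (restrict_mod M Soc) (simple_mod p)"
    unfolding mod_hom_def hom_def
    by (auto simp: Soc_def add_coords A_cls simple_mod_act act_coords(4))
  show "bij_betw cz (carrier (restrict_mod M Soc)) (carrier (simple_mod p))"
    unfolding bij_betw_def
  proof
    show "inj_on cz (carrier (restrict_mod M Soc))"
      by (rule inj_onI) (auto simp: Soc_def intro: coords_inj)
    have "k \<in> cz ` Soc" for k using coords_surj[of 0 0 0 k] by (auto simp: Soc_def)
    then show "cz ` carrier (restrict_mod M Soc) = carrier (simple_mod p)" by auto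
  qed
qed

theorem is_rhombus_module: "is_rhombus_module_of s p (p + dvec d) y (p + dvec e) M"
proof -
  have "rhombus p (p + dvec d) y (p + dvec e)" using rhombus_iff vertex square by blast
  then show ?thesis
    unfolding is_rhombus_module_of_def Let_def radical_eq socle_eq
    using right_module_axioms top_iso socle_iso Soc_Rad middle_iso by blast
qed

end

text \<open>The quotients of the filtration are only isomorphic to principal right modules; this
  pulls the coordinates back to them.\<close>

lemma rhombus_coords_transfer:
  assumes N: "rhombus_coords s N p d e cy cu cv cz" and M: "right_module (rauzy_algebra s) M"
    and \<phi>: "\<phi> \<in> mod_hom (rauzy_algebra s) M N" "bij_betw \<phi> (carrier M) (carrier N)"
  shows "rhombus_coords s M p d e (cy \<circ> \<phi>) (cu \<circ> \<phi>) (cv \<circ> \<phi>) (cz \<circ> \<phi>)"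
proof -
  interpret N: rhombus_coords s N p d e cy cu cv cz by (rule N)
  interpret M: right_module "rauzy_algebra s" M by (rule M)
  have c: "\<phi> m \<in> carrier N" if "m \<in> carrier M" for m using \<phi>(2) that bij_betwE by blast
  have a: "\<phi> (m \<oplus>\<^bsub>M\<^esub> m') = \<phi> m \<oplus>\<^bsub>N\<^esub> \<phi> m'" if "m \<in> carrier M" "m' \<in> carrier M" for m m'
    using \<phi>(1) that unfolding mod_hom_def hom_def by simp
  have r: "\<phi> (m \<cdot>\<^bsub>M\<^esub> rq.cls s f) = \<phi> m \<cdot>\<^bsub>N\<^esub> rq.cls s f" if "m \<in> carrier M" "f \<in> PA RQ" for m f
    using \<phi>(1) that A_cls unfolding mod_hom_def by blast
  show ?thesis
  proof
    fix ky ku kv kz :: 'a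
    obtain n where n: "n \<in> carrier N" "cy n = ky" "cu n = ku" "cv n = kv" "cz n = kz"
      using N.coords_surj by blast
    then obtain m where "m \<in> carrier M" "n = \<phi> m" using \<phi>(2) unfolding bij_betw_def by blast
    then show "\<exists>m\<in>carrier M. (cy \<circ> \<phi>) m = ky \<and> (cu \<circ> \<phi>) m = ku \<and> (cv \<circ> \<phi>) m = kv \<and> (cz \<circ> \<phi>) m = kz"
      using n by auto
  next
    fix m m' assume "m \<in> carrier M" "m' \<in> carrier M" "(cy \<circ> \<phi>) m = (cy \<circ> \<phi>) m'" "(cu \<circ> \<phi>) m = (cu \<circ> \<phi>) m'"
      "(cv \<circ> \<phi>) m = (cv \<circ> \<phi>) m'" "(cz \<circ> \<phi>) m = (cz \<circ> \<phi>) m'"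
    then have "\<phi> m = \<phi> m'" using c by (intro N.coords_inj) simp_all
    then show "m = m'" using \<phi>(2) \<open>m \<in> carrier M\<close> \<open>m' \<in> carrier M\<close> unfolding bij_betw_def inj_on_def by blast
  qed (simp_all only: N.vertex N.square comp_apply a r c N.add_coords N.act_coords)
qed

lemma rhombus_module_iso:
  assumes "rhombus_coords s N p d e cy cu cv cz" "right_module (rauzy_algebra s) M"
    "mod_iso (rauzy_algebra s) M N"
  shows "rhombus_module s M"
proof -
  obtain \<phi> where \<phi>: "\<phi> \<in> mod_hom (rauzy_algebra s) M N" "bij_betw \<phi> (carrier M) (carrier N)"
    using assms(3) unfolding mod_iso_def by blast
  from rhombus_coords.is_rhombus_module[OF rhombus_coords_transfer[OF assms(1,2) \<phi>]]
  show ?thesis unfolding rhombus_module_def by blast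
qed

section \<open>Principal right modules\<close>

abbreviation "reg s \<equiv> regular_mod (rauzy_algebra s)"

lemma reg_right_module: "right_module (rauzy_algebra s) (reg s)"
  unfolding rauzy_algebra_eq by (rule rq.regular_right_module)

lemma reg_simps [simp]: "carrier (reg s) = carrier (rauzy_algebra s)" "zero (reg s) = rq.cls s 0"
  "add (reg s) = add (rauzy_algebra s)" "ract (reg s) = mult (rauzy_algebra s)"
  by (simp_all add: regular_mod_def rauzy_algebra_eq rq.A_zero)

lemma A_add: "rq.cls s f \<oplus>\<^bsub>rauzy_algebra s\<^esub> rq.cls s g = rq.cls s (f + g)"
  unfolding rauzy_algebra_eq by (rule rq.cls_add)

lemma A_mult: "f \<in> PA RQ \<Longrightarrow> g \<in> PA RQ \<Longrightarrow>
    rq.cls s f \<otimes>\<^bsub>rauzy_algebra s\<^esub> rq.cls s g = rq.cls s (path_mult RQ f g)"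
  unfolding rauzy_algebra_eq by (rule rq.cls_mult)

lemma A_cls_closed: "f \<in> PA RQ \<Longrightarrow> rq.cls s f \<in> carrier (rauzy_algebra s)"
  unfolding A_cls by blast

lemma reg_abelian_group: "abelian_group (reg s)"
  by (rule right_module.axioms(1)[OF reg_right_module])

lemma reg_a_inv: "f \<in> PA RQ \<Longrightarrow> \<ominus>\<^bsub>reg s\<^esub> rq.cls s f = rq.cls s (- f)"
  by (rule abelian_group.minus_equality[OF reg_abelian_group])
    (auto simp: A_add A_cls intro: PA_uminus)

lemma principal_right_cls:
  "b \<in> PA RQ \<Longrightarrow> principal_right (rauzy_algebra s) (rq.cls s b) = (\<lambda>f. rq.cls s (path_mult RQ b f)) ` PA RQ"
proof -
  assume b: "b \<in> PA RQ"
  have "principal_right (rauzy_algebra s) (rq.cls s b)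
      = (\<lambda>a. rq.cls s b \<otimes>\<^bsub>rauzy_algebra s\<^esub> a) ` (rq.cls s ` PA RQ)"
    unfolding principal_right_def using A_cls by blast
  also have "\<dots> = (\<lambda>f. rq.cls s (path_mult RQ b f)) ` PA RQ"
    unfolding image_image by (rule image_cong) (simp_all add: A_mult b)
  finally show ?thesis .
qed

lemma submod_regI:
  assumes "\<And>m. m \<in> N \<Longrightarrow> \<exists>f\<in>F. m = rq.cls s f" "\<And>f. f \<in> F \<Longrightarrow> rq.cls s f \<in> N" "F \<subseteq> PA RQ"
    and "0 \<in> F" "\<And>f g. f \<in> F \<Longrightarrow> g \<in> F \<Longrightarrow> f + g \<in> F" "\<And>f. f \<in> F \<Longrightarrow> - f \<in> F"
    and "\<And>f r. f \<in> F \<Longrightarrow> r \<in> PA RQ \<Longrightarrow> path_mult RQ f r \<in> F"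
  shows "submod (rauzy_algebra s) N (reg s)"
  unfolding submod_iff[OF reg_abelian_group]
proof (intro conjI ballI subsetI)
  fix m assume "m \<in> N"
  then obtain f where f: "f \<in> F" "m = rq.cls s f" using assms(1) by blast
  then have fPA: "f \<in> PA RQ" using assms(3) by blast
  then show "m \<in> carrier (reg s)" unfolding f(2) by (simp add: A_cls_closed)
  show "\<ominus>\<^bsub>reg s\<^esub> m \<in> N" unfolding f(2) reg_a_inv[OF fPA] by (rule assms(2)[OF assms(6)[OF f(1)]])
  fix g assume "g \<in> N"
  then obtain h where "h \<in> F" "g = rq.cls s h" using assms(1) by blast
  then show "m \<oplus>\<^bsub>reg s\<^esub> g \<in> N" using assms(2)[OF assms(5)[OF f(1), of h]] by (simp add: f(2) A_add)
next
  fix m a assume m: "m \<in> N" and a: "a \<in> carrier (rauzy_algebra s)"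
  obtain r where r: "r \<in> PA RQ" "a = rq.cls s r" using a unfolding A_cls by blast
  obtain f where "f \<in> F" "m = rq.cls s f" using assms(1)[OF m] by blast
  note f = this r
  have "f \<in> PA RQ" using f(1) assms(3) by blast
  then show "m \<cdot>\<^bsub>reg s\<^esub> a \<in> N" using assms(2)[OF assms(7)[OF f(1,3)]] f by (simp add: A_mult)
next
  show "\<zero>\<^bsub>reg s\<^esub> \<in> N" using assms(2)[OF assms(4)] by simp
qed

lemma principal_submod:
  assumes b: "b \<in> PA RQ"
  shows "submod (rauzy_algebra s) (principal_right (rauzy_algebra s) (rq.cls s b)) (reg s)"
proof (rule submod_regI[where F = "path_mult RQ b ` PA RQ"])
  show "path_mult RQ b ` PA RQ \<subseteq> PA RQ" using PA_mult[OF b] by blast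
  show "0 \<in> path_mult RQ b ` PA RQ" by (rule image_eqI[of _ _ 0]) simp_all
  fix f assume f: "f \<in> path_mult RQ b ` PA RQ"
  then obtain h where h: "f = path_mult RQ b h" "h \<in> PA RQ" by blast
  show "- f \<in> path_mult RQ b ` PA RQ"
    unfolding h(1) path_mult_minus_right[symmetric] using PA_uminus[OF h(2)] by (rule imageI)
  show "path_mult RQ f r \<in> path_mult RQ b ` PA RQ" if "r \<in> PA RQ" for r
    unfolding h(1) path_mult_assoc using PA_mult[OF h(2) that] by (rule imageI)
  fix g assume "g \<in> path_mult RQ b ` PA RQ"
  then obtain k where k: "g = path_mult RQ b k" "k \<in> PA RQ" by blast
  show "f + g \<in> path_mult RQ b ` PA RQ"
    unfolding h(1) k(1) path_mult_add_right[symmetric] using PA_add[OF h(2) k(2)] by (rule imageI)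
qed (auto simp: principal_right_cls[OF b])

lemma principal_mod_right_module: "b \<in> PA RQ \<Longrightarrow>
    right_module (rauzy_algebra s) (principal_mod (rauzy_algebra s) (rq.cls s b))"
  unfolding principal_mod_def by (rule restrict_right_module[OF reg_right_module principal_submod])

lemma right_ideal_mod_iff:
  assumes "b \<in> PA RQ"
  shows "f \<in> right_ideal_mod s b \<longleftrightarrow> rq.cls s f \<in> principal_right (rauzy_algebra s) (rq.cls s b)"
  unfolding right_ideal_mod_def principal_right_cls[OF assms] by (auto simp: rq.cls_eq)

lemma left_mult_hom:
  assumes b: "b \<in> PA RQ" and N: "N \<subseteq> carrier (rauzy_algebra s)"
    and N': "\<And>m. m \<in> N \<Longrightarrow> rq.cls s b \<otimes>\<^bsub>rauzy_algebra s\<^esub> m \<in> N'"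
  shows "(\<lambda>m. rq.cls s b \<otimes>\<^bsub>rauzy_algebra s\<^esub> m)
    \<in> mod_hom (rauzy_algebra s) (restrict_mod (reg s) N) (restrict_mod (reg s) N')"
proof -
  have "rq.cls s b \<otimes>\<^bsub>rauzy_algebra s\<^esub> (m \<oplus>\<^bsub>rauzy_algebra s\<^esub> m')
      = (rq.cls s b \<otimes>\<^bsub>rauzy_algebra s\<^esub> m) \<oplus>\<^bsub>rauzy_algebra s\<^esub> (rq.cls s b \<otimes>\<^bsub>rauzy_algebra s\<^esub> m')"
    if mm: "m \<in> N" "m' \<in> N" for m m'
  proof -
    obtain f where "f \<in> PA RQ" "m = rq.cls s f" using subsetD[OF N mm(1)] unfolding A_cls by blast
    moreover obtain g where "g \<in> PA RQ" "m' = rq.cls s g" using subsetD[OF N mm(2)] unfolding A_cls by blast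
    ultimately show ?thesis using b by (simp add: A_add A_mult PA_add path_mult_add_right)
  qed
  moreover have "rq.cls s b \<otimes>\<^bsub>rauzy_algebra s\<^esub> (m \<otimes>\<^bsub>rauzy_algebra s\<^esub> a)
      = (rq.cls s b \<otimes>\<^bsub>rauzy_algebra s\<^esub> m) \<otimes>\<^bsub>rauzy_algebra s\<^esub> a"
    if ma: "m \<in> N" "a \<in> carrier (rauzy_algebra s)" for m a
  proof -
    obtain f where "f \<in> PA RQ" "m = rq.cls s f" using subsetD[OF N ma(1)] unfolding A_cls by blast
    moreover obtain g where "g \<in> PA RQ" "a = rq.cls s g" using ma(2) unfolding A_cls by blast
    ultimately show ?thesis using b by (simp add: A_mult PA_mult path_mult_assoc)
  qed
  ultimately show ?thesis unfolding mod_hom_def hom_def using N' by simp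
qed

section \<open>Rhombus structure of the right ideal of a path along a rhombus\<close>

lemma psi_length: "length ds \<noteq> 4 \<Longrightarrow> psi s p ds = 0"
  by (simp add: psi_def)

text \<open>The combination is multiplied on the right by the remainder of the boundary belonging to
  one of its terms, and \<open>Phi\<close> is applied. The other terms drop out, because their end
  vertex does not fit or because the resulting word does not have length four.\<close>

lemma square_independent:
  fixes s :: "3 \<Rightarrow> point \<Rightarrow> 'k::field"
  assumes s: "sign_choice s" and p: "p \<in> rauzy_vertices" and sq: "square (ht p) d e"
    and y: "y = p + dvec d + dvec e" and f: "f \<in> PA RQ"
    and fI: "path_mult RQ (wpath 1 p [d, e]) f \<in> rauzy_ideal s"
  shows "cf f (y, walk y []) = 0" "cf f (y, walk y [opp e]) = 0" "cf f (y, walk y [opp d]) = 0"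
    "cf f (y, walk y [opp e, opp d]) + cf f (y, walk y [opp d, opp e]) = 0"
proof -
  have axes: "fst d \<noteq> fst e" using sq by (simp add: square_def)
  then have ne: "e \<noteq> opp d" "dvec d \<noteq> dvec e" "dvec e \<noteq> dvec d" unfolding dvec_inj by auto
  define ky where "ky = cf f (y, walk y [])"
  define ku where "ku = cf f (y, walk y [opp e])"
  define kv where "kv = cf f (y, walk y [opp d])"
  define kz where "kz = cf f (y, walk y [opp e, opp d]) + cf f (y, walk y [opp d, opp e])"
  define E where "E = wpath ky p [d, e] + wpath ku p [d, e, opp e] + wpath kv p [d, e, opp d]
    + wpath kz p [d, e, opp e, opp d]"
  have "path_mult RQ (wpath 1 p [d, e]) f - (path_mult RQ (wpath 1 p [d, e]) f - E) \<in> rauzy_ideal s"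
    unfolding E_def ky_def ku_def kv_def kz_def by (rule rq.I_diff[OF fI square_decomp[OF s axes y f]])
  then have E: "E \<in> rauzy_ideal s" by simp
  define k where "k = s (fst d) p * s (fst e) p"
  have "k * k = 1" using sign_unit[OF s p, of "fst d"] sign_unit[OF s p, of "fst e"]
    unfolding k_def by (simp add: mult.assoc mult.left_commute)
  then have k0: "k \<noteq> 0" by auto
  have psi_k: "psi s p [d, e, opp e, opp d] = k" "psi s p [d, e, opp d, opp e] = k"
    unfolding psi_simp psi4_def k_def using ne sq by (simp_all add: square_ind_def)
  have dests: "dest p [d, e] = y" "dest p [d, e, opp e] = p + dvec d" "dest p [d, e, opp d] = p + dvec e"
    "dest p [d, e, opp e, opp d] = p" by (simp_all add: y)
  have Phi_E: "Phi s (path_mult RQ (path_mult RQ (wpath 1 p []) E) (wpath 1 q ws))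
    = (if q = y then ky * psi s p ([d, e] @ ws) else 0)
      + (if q = p + dvec d then ku * psi s p ([d, e, opp e] @ ws) else 0)
      + (if q = p + dvec e then kv * psi s p ([d, e, opp d] @ ws) else 0)
      + (if q = p then kz * psi s p ([d, e, opp e, opp d] @ ws) else 0)" for q ws
  proof -
    have T: "Phi s (path_mult RQ (path_mult RQ (wpath 1 p []) (wpath c p vs)) (wpath 1 q ws))
      = (if q = dest p vs then c * psi s p (vs @ ws) else 0)" for c vs
      by (simp add: wpath_mult Phi_wpath p)
    show ?thesis by (simp only: E_def path_mult_add_left path_mult_add_right Phi_add T dests)
  qed
  have 0: "Phi s (path_mult RQ (path_mult RQ (wpath 1 p []) E) (wpath 1 q ws)) = 0" for q ws
    by (rule Phi_ideal[OF s E])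
  have "kz = 0" using 0[of p "[]"] k0 unfolding Phi_E by (simp add: psi_length psi_k cong: if_cong)
  moreover have "ku = 0" using 0[of "p + dvec d" "[opp d]"] k0 ne unfolding Phi_E by (simp add: psi_length psi_k cong: if_cong)
  moreover have "kv = 0" using 0[of "p + dvec e" "[opp e]"] k0 ne unfolding Phi_E by (simp add: psi_length psi_k cong: if_cong)
  moreover have "ky = 0" using 0[of y "[opp e, opp d]"] k0 unfolding Phi_E by (simp add: psi_length psi_k cong: if_cong)
  ultimately show "cf f (y, walk y []) = 0" "cf f (y, walk y [opp e]) = 0" "cf f (y, walk y [opp d]) = 0"
    "cf f (y, walk y [opp e, opp d]) + cf f (y, walk y [opp d, opp e]) = 0"
    unfolding ky_def ku_def kv_def kz_def by blast+
qed

text \<open>The coordinates of the class of \<open>P\<close> times \<open>f\<close> are read off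
  from \<open>f\<close>. They do not depend on the choice of \<open>f\<close> by
  \<open>square_independent\<close>, and they determine the element by
  \<open>square_decomp\<close>.\<close>

lemma principal_coords:
  fixes s :: "3 \<Rightarrow> point \<Rightarrow> 'k::field"
  assumes s: "sign_choice s" and p: "p \<in> rauzy_vertices" and sq: "square (ht p) d e"
  shows "\<exists>cy cu cv cz. rhombus_coords s (principal_mod (rauzy_algebra s) (rq.cls s (wpath 1 p [d, e]))) p d e cy cu cv cz"
proof -
  define y where "y = p + dvec d + dvec e"
  define P :: "'k rauzy_paths" where "P = wpath 1 p [d, e]"
  have P: "P \<in> PA RQ" by (simp add: P_def)
  have axes: "fst d \<noteq> fst e" using sq by (simp add: square_def)
  define rep where "rep m = (SOME f. f \<in> PA RQ \<and> m = rq.cls s (path_mult RQ P f))" for m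
  let ?M = "principal_mod (rauzy_algebra s) (rq.cls s P)"
  have carrier: "carrier ?M = (\<lambda>f. rq.cls s (path_mult RQ P f)) ` PA RQ"
    by (simp add: principal_mod_def principal_right_cls[OF P])
  have M_ops: "add ?M = add (rauzy_algebra s)" "ract ?M = mult (rauzy_algebra s)"
    by (simp_all add: principal_mod_def)
  define cy where "cy f = cf f (y, [])" for f :: "'k rauzy_paths"
  define cu where "cu f = cf f (y, walk y [opp e])" for f :: "'k rauzy_paths"
  define cv where "cv f = cf f (y, walk y [opp d])" for f :: "'k rauzy_paths"
  define cz where "cz f = cf f (y, walk y [opp e, opp d]) + cf f (y, walk y [opp d, opp e])" for f :: "'k rauzy_paths"
  note c_defs = cy_def cu_def cv_def cz_def
  have c_diff: "cy (f - g) = cy f - cy g" "cu (f - g) = cu f - cu g" "cv (f - g) = cv f - cv g"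
    "cz (f - g) = cz f - cz g" for f g by (simp_all add: c_defs lookup_minus)
  have unique: "cy f = cy g \<and> cu f = cu g \<and> cv f = cv g \<and> cz f = cz g"
    if fg: "f \<in> PA RQ" "g \<in> PA RQ" "rq.cls s (path_mult RQ P f) = rq.cls s (path_mult RQ P g)" for f g
  proof -
    have "path_mult RQ P (f - g) \<in> rauzy_ideal s" using fg(3) by (simp add: rq.cls_eq path_mult_diff_right)
    note ind = square_independent[OF s p sq y_def PA_diff[OF fg(1,2)] this[unfolded P_def]]
    have "cy (f - g) = 0" "cu (f - g) = 0" "cv (f - g) = 0" "cz (f - g) = 0"
      using ind unfolding c_defs by simp_all
    then show ?thesis by (simp add: c_diff)
  qed
  have rep: "rep m \<in> PA RQ" "rq.cls s (path_mult RQ P (rep m)) = m" if m: "m \<in> carrier ?M" for m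
  proof -
    have "\<exists>f. f \<in> PA RQ \<and> m = rq.cls s (path_mult RQ P f)" using m unfolding carrier by blast
    from someI_ex[OF this] show "rep m \<in> PA RQ" "rq.cls s (path_mult RQ P (rep m)) = m"
      unfolding rep_def[symmetric] by simp_all
  qed
  have c_rep: "cy (rep (rq.cls s (path_mult RQ P f))) = cy f" "cu (rep (rq.cls s (path_mult RQ P f))) = cu f"
    "cv (rep (rq.cls s (path_mult RQ P f))) = cv f" "cz (rep (rq.cls s (path_mult RQ P f))) = cz f"
    if f: "f \<in> PA RQ" for f
  proof -
    have "rq.cls s (path_mult RQ P f) \<in> carrier ?M" unfolding carrier using f by (rule imageI)
    note u = unique[OF rep(1)[OF this] f rep(2)[OF this]]
    show "cy (rep (rq.cls s (path_mult RQ P f))) = cy f" using u by (rule conjunct1)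
    show "cu (rep (rq.cls s (path_mult RQ P f))) = cu f" using u[THEN conjunct2] by (rule conjunct1)
    show "cv (rep (rq.cls s (path_mult RQ P f))) = cv f" using u[THEN conjunct2, THEN conjunct2] by (rule conjunct1)
    show "cz (rep (rq.cls s (path_mult RQ P f))) = cz f" using u[THEN conjunct2, THEN conjunct2] by (rule conjunct2)
  qed
  have ends: "y + dvec (opp e) = p + dvec d" "y + dvec (opp d) = p + dvec e"
    "p + dvec d + dvec (opp d) = p" "p + dvec e + dvec (opp e) = p"
    by (simp_all add: y_def)
  have lookup1: "cf (path_mult RQ f g) (y, walk y [a])
      = cf f (y, []) * cf g (y, walk y [a]) + cf f (y, walk y [a]) * cf g (y + dvec a, [])" for f g a
    by (simp add: path_mult_lookup)
  have lookup2: "cf (path_mult RQ f g) (y, walk y [a, b])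
      = cf f (y, []) * cf g (y, walk y [a, b]) + cf f (y, walk y [a]) * cf g (y + dvec a, walk (y + dvec a) [b])
        + cf f (y, walk y [a, b]) * cf g (y + dvec a + dvec b, [])" for f g a b
    by (simp add: path_mult_lookup)
  have c_mult: "cy (path_mult RQ f g) = cy f * cf g (y, [])"
    "cu (path_mult RQ f g) = cy f * cf g (y, walk y [opp e]) + cu f * cf g (p + dvec d, [])"
    "cv (path_mult RQ f g) = cy f * cf g (y, walk y [opp d]) + cv f * cf g (p + dvec e, [])"
    "cz (path_mult RQ f g) = cy f * (cf g (y, walk y [opp e, opp d]) + cf g (y, walk y [opp d, opp e]))
       + cu f * cf g (p + dvec d, walk (p + dvec d) [opp d]) + cv f * cf g (p + dvec e, walk (p + dvec e) [opp e])
       + cz f * cf g (p, [])" for f g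
  proof -
    show "cy (path_mult RQ f g) = cy f * cf g (y, [])" by (simp add: cy_def path_mult_lookup)
    show "cu (path_mult RQ f g) = cy f * cf g (y, walk y [opp e]) + cu f * cf g (p + dvec d, [])"
      "cv (path_mult RQ f g) = cy f * cf g (y, walk y [opp d]) + cv f * cf g (p + dvec e, [])"
      unfolding c_defs lookup1 ends by (rule refl)+
    show "cz (path_mult RQ f g) = cy f * (cf g (y, walk y [opp e, opp d]) + cf g (y, walk y [opp d, opp e]))
       + cu f * cf g (p + dvec d, walk (p + dvec d) [opp d]) + cv f * cf g (p + dvec e, walk (p + dvec e) [opp e])
       + cz f * cf g (p, [])"
      unfolding c_defs lookup2 ends by (simp only: distrib_left distrib_right add_ac)
  qed
  have "rhombus_coords s ?M p d e (cy \<circ> rep) (cu \<circ> rep) (cv \<circ> rep) (cz \<circ> rep)"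
    unfolding rhombus_coords_def rhombus_coords_axioms_def
  proof (intro conjI allI impI)
    show "right_module (rauzy_algebra s) ?M" by (rule principal_mod_right_module[OF P])
  next
    fix m m' assume m: "m \<in> carrier ?M" "m' \<in> carrier ?M"
    obtain f g where fg: "f \<in> PA RQ" "m = rq.cls s (path_mult RQ P f)" "g \<in> PA RQ" "m' = rq.cls s (path_mult RQ P g)"
      using m unfolding carrier by blast
    have mm: "m \<oplus>\<^bsub>?M\<^esub> m' = rq.cls s (path_mult RQ P (f + g))"
      by (simp add: M_ops fg A_add path_mult_add_right)
    show "(cy \<circ> rep) (m \<oplus>\<^bsub>?M\<^esub> m') = (cy \<circ> rep) m + (cy \<circ> rep) m'"
      "(cu \<circ> rep) (m \<oplus>\<^bsub>?M\<^esub> m') = (cu \<circ> rep) m + (cu \<circ> rep) m'"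
      "(cv \<circ> rep) (m \<oplus>\<^bsub>?M\<^esub> m') = (cv \<circ> rep) m + (cv \<circ> rep) m'"
      "(cz \<circ> rep) (m \<oplus>\<^bsub>?M\<^esub> m') = (cz \<circ> rep) m + (cz \<circ> rep) m'"
      unfolding mm unfolding comp_apply c_rep[OF PA_add[OF fg(1,3)]] fg(2,4) c_rep[OF fg(1)] c_rep[OF fg(3)]
      by (simp_all add: c_defs lookup_add)
    assume eq: "(cy \<circ> rep) m = (cy \<circ> rep) m'" "(cu \<circ> rep) m = (cu \<circ> rep) m'"
      "(cv \<circ> rep) m = (cv \<circ> rep) m'" "(cz \<circ> rep) m = (cz \<circ> rep) m'"
    have "cy (f - g) = 0" "cu (f - g) = 0" "cv (f - g) = 0" "cz (f - g) = 0"
      using eq unfolding comp_apply fg(2,4) c_rep[OF fg(1)] c_rep[OF fg(3)] by (simp_all add: c_diff)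
    then have "path_mult RQ P (f - g) \<in> rauzy_ideal s"
      using square_decomp[OF s axes y_def PA_diff[OF fg(1,3)]] unfolding c_defs P_def by simp
    then show "m = m'" unfolding fg(2,4) rq.cls_eq by (simp add: path_mult_diff_right)
  next
    fix ky ku kv kz :: 'k
    have "valid p [d, e, opp e, opp d]"
      using p sq by (simp add: valid_iff square_def algebra_simps)
    then have v: "valid y [opp e, opp d]" "valid y []" "valid y [opp e]"
      using valid_stepD(1)[of y "opp e"] valid_stepD(2)[of y "opp e"] by (auto simp: y_def)
    have "valid p [d, e, opp d]" using p sq by (simp add: valid_iff square_def algebra_simps)
    then have v': "valid y [opp d]" by (simp add: y_def)
    define f where "f = wpath ky y [] + wpath ku y [opp e] + wpath kv y [opp d] + wpath kz y [opp e, opp d]"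
    have f: "f \<in> PA RQ" unfolding f_def by (intro PA_add wpath_PA)
    have ne: "opp d \<noteq> opp e" "opp e \<noteq> opp d" using axes by (metis opp_simps(1))+
    note c = cf_wpath[OF v(1)] cf_wpath[OF v(2)] cf_wpath[OF v(3)] cf_wpath[OF v']
    have w: "cf g (y, []) = cf g (y, walk y [])" for g :: "'k rauzy_paths" by simp
    have "cy f = ky" "cu f = ku" "cv f = kv" "cz f = kz"
      unfolding c_defs w f_def lookup_add c using ne by simp_all
    then show "\<exists>m\<in>carrier ?M. (cy \<circ> rep) m = ky \<and> (cu \<circ> rep) m = ku \<and> (cv \<circ> rep) m = kv \<and> (cz \<circ> rep) m = kz"
      using f by (intro bexI[of _ "rq.cls s (path_mult RQ P f)"]) (simp_all add: c_rep carrier)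
  next
    fix m and g :: "'k rauzy_paths" assume m: "m \<in> carrier ?M" and g: "g \<in> PA RQ"
    obtain f where f: "f \<in> PA RQ" "m = rq.cls s (path_mult RQ P f)" using m unfolding carrier by blast
    have mg: "m \<cdot>\<^bsub>?M\<^esub> rq.cls s g = rq.cls s (path_mult RQ P (path_mult RQ f g))"
      using f g P by (simp add: M_ops A_mult PA_mult path_mult_assoc)
    note c = comp_apply c_rep[OF PA_mult[OF f(1) g]] f(2) c_rep[OF f(1)] c_mult y_def[symmetric]
    show "(cy \<circ> rep) (m \<cdot>\<^bsub>?M\<^esub> rq.cls s g) = (cy \<circ> rep) m * cf g (p + dvec d + dvec e, [])"
      unfolding mg unfolding c ..
    show "(cu \<circ> rep) (m \<cdot>\<^bsub>?M\<^esub> rq.cls s g) = (cy \<circ> rep) m * cf g (p + dvec d + dvec e, walk (p + dvec d + dvec e) [opp e])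
       + (cu \<circ> rep) m * cf g (p + dvec d, [])" unfolding mg unfolding c ..
    show "(cv \<circ> rep) (m \<cdot>\<^bsub>?M\<^esub> rq.cls s g) = (cy \<circ> rep) m * cf g (p + dvec d + dvec e, walk (p + dvec d + dvec e) [opp d])
       + (cv \<circ> rep) m * cf g (p + dvec e, [])" unfolding mg unfolding c ..
    show "(cz \<circ> rep) (m \<cdot>\<^bsub>?M\<^esub> rq.cls s g)
        = (cy \<circ> rep) m * (cf g (p + dvec d + dvec e, walk (p + dvec d + dvec e) [opp e, opp d])
                + cf g (p + dvec d + dvec e, walk (p + dvec d + dvec e) [opp d, opp e]))
          + (cu \<circ> rep) m * cf g (p + dvec d, walk (p + dvec d) [opp d])
          + (cv \<circ> rep) m * cf g (p + dvec e, walk (p + dvec e) [opp e]) + (cz \<circ> rep) m * cf g (p, [])"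
      unfolding mg unfolding c ..
  qed (use p sq in simp_all)
  then show ?thesis unfolding P_def by blast
qed

section \<open>The filtration\<close>

lemma restrict_restrict [simp]: "restrict_mod (restrict_mod M N) N' = restrict_mod M N'"
  by (simp add: restrict_mod_def)

lemma zero_submod:
  assumes "right_module (rauzy_algebra s) M"
  shows "submod (rauzy_algebra s) {\<zero>\<^bsub>M\<^esub>} M"
proof -
  interpret right_module "rauzy_algebra s" M by (rule assms)
  have "\<zero>\<^bsub>M\<^esub> \<cdot>\<^bsub>M\<^esub> a = \<zero>\<^bsub>M\<^esub>" if a: "a \<in> carrier (rauzy_algebra s)" for a
  proof -
    have "\<zero>\<^bsub>M\<^esub> \<cdot>\<^bsub>M\<^esub> a \<oplus>\<^bsub>M\<^esub> \<zero>\<^bsub>M\<^esub> \<cdot>\<^bsub>M\<^esub> a = \<zero>\<^bsub>M\<^esub> \<cdot>\<^bsub>M\<^esub> a"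
      using ract_add_left[of "\<zero>\<^bsub>M\<^esub>" "\<zero>\<^bsub>M\<^esub>" a] a by simp
    then show ?thesis using ract_closed[OF zero_closed a] add.l_cancel_one by blast
  qed
  then show ?thesis unfolding submod_iff[OF abelian_group_axioms] by simp
qed

lemma quot_zero_iso:
  assumes M: "right_module (rauzy_algebra s) M"
  shows "mod_iso (rauzy_algebra s) (quot_mod M {\<zero>\<^bsub>M\<^esub>}) M"
proof (rule quot_iso[OF M zero_submod[OF M] A_closed right_module.axioms(1)[OF M]])
  show "(\<lambda>m. m) \<in> mod_hom (rauzy_algebra s) M M" unfolding mod_hom_def hom_def by simp
  show "(\<lambda>m. m) ` carrier M = carrier M" by simp
  have "\<zero>\<^bsub>M\<^esub> \<in> carrier M"
    using abelian_monoid.zero_closed abelian_group.axioms(1)[OF right_module.axioms(1)[OF M]] by blast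
  then show "{\<zero>\<^bsub>M\<^esub>} = a_kernel M M (\<lambda>m. m)" by (auto simp: a_kernel_def kernel_def)
qed

lemma wpath_arrow: "valid_step p d \<Longrightarrow> arrow s p (p + dvec d) = rq.cls s (wpath 1 p [d])"
  using valid_stepD(2)[of p d] by (simp add: arrow_def rq.cls_def wpath_def)

lemma wpath_mult_assoc:
  "path_mult RQ (wpath 1 q [c]) (path_mult RQ (wpath 1 (q + dvec c) [d]) f) = path_mult RQ (wpath 1 q [c, d]) f"
  by (simp add: wpath_mult flip: path_mult_assoc)

text \<open>\<open>d1\<close>, \<open>d2\<close>, \<open>d3\<close>, \<open>dn\<close> are the directions of the edges from \<open>z\<close> to \<open>x 1\<close>, \<open>x 2\<close>,
  \<open>x 3\<close>, \<open>x n\<close>.\<close>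

locale four_edges =
  fixes s :: "3 \<Rightarrow> point \<Rightarrow> 'k::field" and z :: point and d1 d2 d3 dn :: dir
  assumes s: "sign_choice s" and z: "z \<in> rauzy_vertices"
    and sq: "square (ht z) dn d1" "square (ht z) d1 d2" "square (ht z) d2 d3"
    and ne: "dn \<noteq> d2" "d1 \<noteq> d3" "dn \<noteq> d3"
begin

abbreviation "R \<equiv> rauzy_algebra s"
abbreviation "b1 \<equiv> wpath 1 z [d1] :: 'k rauzy_paths"
abbreviation "b2 \<equiv> wpath 1 z [d2] :: 'k rauzy_paths"
abbreviation "bn' \<equiv> wpath 1 (z + dvec dn) [opp dn] :: 'k rauzy_paths"
abbreviation "b3' \<equiv> wpath 1 (z + dvec d3) [opp d3] :: 'k rauzy_paths"
abbreviation "P \<equiv> wpath 1 z [d1, d2] :: 'k rauzy_paths"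
abbreviation "Rn \<equiv> wpath 1 (z + dvec dn) [opp dn, d1] :: 'k rauzy_paths"
abbreviation "R3 \<equiv> wpath 1 (z + dvec d3) [opp d3, d2] :: 'k rauzy_paths"

lemma steps: "valid_step z d1" "valid_step z d2" "valid_step z d3" "valid_step z dn"
  using sq z by (auto simp: square_def valid_step_def)

lemma axes: "fst dn \<noteq> fst d1" "fst d1 \<noteq> fst d2" "fst d2 \<noteq> fst d3"
  using sq by (auto simp: square_def)

lemma square_n: "square (ht (z + dvec dn)) (opp dn) d1" "square (ht (z + dvec d3)) (opp d3) d2"
  using sq square_opp[of "ht z" dn d1] square_opp[of "ht z" d3 d2] square_commute[of "ht z" d2 d3]
    valid_stepD(3)[OF steps(4)] valid_stepD(3)[OF steps(3)] by auto

text \<open>The edge along \<open>d2\<close> lies in the rhombi with \<open>d1\<close> and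
  \<open>d3\<close> and in no others, and \<open>dn\<close> is neither of these; the assumption
  \<open>dn \<noteq> d3\<close> is what four edges provide. In the same way the edge along
  \<open>d1\<close> belongs to \<open>dn\<close> and \<open>d2\<close>.\<close>

lemma not_square: "\<not> square (ht (z + dvec dn)) (opp dn) d2" "\<not> square (ht (z + dvec d3)) (opp d3) d1"
proof -
  have "dn \<noteq> d1" "d3 \<noteq> d2" using axes by auto
  then have "\<not> square (ht z) d2 dn" "\<not> square (ht z) d1 d3"
    using square_two[of "ht z" d2 d1 d3 dn] square_two[of "ht z" d1 dn d2 d3] sq ne square_commute by blast+
  then show "\<not> square (ht (z + dvec dn)) (opp dn) d2" "\<not> square (ht (z + dvec d3)) (opp d3) d1"
    using square_opp[of "ht z" dn d2] square_opp[of "ht z" d3 d1] square_commute[of "ht z"]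
      valid_stepD(3)[OF steps(4)] valid_stepD(3)[OF steps(3)] by auto
qed

text \<open>The third word follows a rhombus and then continues by a step that does not return along
  it; the fourth begins with a path that is already zero.\<close>

lemma cross_ideal: "wpath 1 (z + dvec dn) [opp dn, d2] \<in> rauzy_ideal s"
  "wpath 1 (z + dvec d3) [opp d3, d1] \<in> rauzy_ideal s"
  "path_mult RQ bn' P \<in> rauzy_ideal s" "path_mult RQ b3' P \<in> rauzy_ideal s"
proof -
  have 1: "nul s (z + dvec dn) [opp dn, d2]" by (rule nul_two) (use ne not_square in auto)
  have 2: "nul s (z + dvec d3) [opp d3, d1]" by (rule nul_two) (use ne not_square in auto)
  have 3: "nul s (z + dvec dn) [opp dn, d1, d2]" by (rule nul_square1) (use ne axes in auto)
  have 4: "nul s (z + dvec d3) ([opp d3, d1] @ [d2])" by (rule nul_prefix[OF 2])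
  show "wpath 1 (z + dvec dn) [opp dn, d2] \<in> rauzy_ideal s" "wpath 1 (z + dvec d3) [opp d3, d1] \<in> rauzy_ideal s"
    using 1 2 by (simp_all add: nul_def)
  show "path_mult RQ bn' P \<in> rauzy_ideal s" using 3 by (simp add: wpath_mult nul_def)
  show "path_mult RQ b3' P \<in> rauzy_ideal s" using 4 by (simp add: wpath_mult nul_def)
qed

text \<open>The vanishing of the product with \<open>Rn\<close> gives four equations on the
  coefficients of \<open>f\<close>, by independence. The same four expressions are the coordinates
  of the product with \<open>b1\<close> modulo the right ideal of \<open>P\<close> in
  \<open>arrow_decomp\<close>, with \<open>dn\<close> in the role of \<open>e1\<close>.\<close>

lemma kernel_n:
  assumes f: "f \<in> PA RQ" and fI: "path_mult RQ Rn f \<in> rauzy_ideal s"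
  shows "path_mult RQ b1 f \<in> right_ideal_mod s P"
proof -
  have y: "z + dvec d1 = z + dvec dn + dvec (opp dn) + dvec d1" by simp
  note c = square_independent[OF s valid_stepD(2)[OF steps(4)] square_n(1) y f fI, unfolded opp_simps(3)]
  have "square (ht z) d1 dn" using sq(1) square_commute by blast
  note a = arrow_decomp[OF s this sq(2) ne(1) refl f]
  show ?thesis using a unfolding c by simp
qed

text \<open>The mirror image of \<open>kernel_n\<close>, with \<open>d3\<close> in the role of
  \<open>e1\<close>. It leads to the right ideal of \<open>[d2, d1]\<close>, which agrees with that
  of \<open>P\<close> as the two steps commute.\<close>

lemma kernel_3:
  assumes f: "f \<in> PA RQ" and fI: "path_mult RQ R3 f \<in> rauzy_ideal s"
  shows "path_mult RQ b2 f \<in> right_ideal_mod s P"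
proof -
  have y: "z + dvec d2 = z + dvec d3 + dvec (opp d3) + dvec d2" by simp
  note c = square_independent[OF s valid_stepD(2)[OF steps(3)] square_n(2) y f fI, unfolded opp_simps(3)]
  have "square (ht z) d2 d1" using sq(2) square_commute by blast
  note a = arrow_decomp[OF s sq(3) this ne(2)[symmetric] refl f]
  have "path_mult RQ b2 f \<in> right_ideal_mod s (wpath 1 z [d2, d1])" using a unfolding c by simp
  then obtain h where h: "h \<in> PA RQ" "path_mult RQ b2 f - path_mult RQ (wpath 1 z [d2, d1]) h \<in> rauzy_ideal s"
    unfolding right_ideal_mod_def by blast
  have "wpath 1 z [d2, d1] - P \<in> rauzy_ideal s" using eqv_two[of d2 d1 s z] axes unfolding eqv_def by simp
  then have "path_mult RQ (wpath 1 z [d2, d1] - P) h \<in> rauzy_ideal s" using h(1) by (rule rq.I_mult_right)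
  from rq.I_add[OF h(2) this] have "path_mult RQ b2 f - path_mult RQ P h \<in> rauzy_ideal s"
    by (simp add: path_mult_diff_left)
  then show ?thesis unfolding right_ideal_mod_def using h(1) by blast
qed

abbreviation "N1 \<equiv> principal_right R (rq.cls s b1)"
abbreviation "N2 \<equiv> principal_right R (rq.cls s b2)"
abbreviation "P1 \<equiv> principal_right R (rq.cls s P)"
abbreviation "Qn \<equiv> principal_right R (rq.cls s Rn)"
abbreviation "Q3 \<equiv> principal_right R (rq.cls s R3)"

definition "S = N1 <+>\<^bsub>R\<^esub> N2"

lemma N1E: "m \<in> N1 \<Longrightarrow> (\<And>f. f \<in> PA RQ \<Longrightarrow> m = rq.cls s (path_mult RQ b1 f) \<Longrightarrow> thesis) \<Longrightarrow> thesis"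
  unfolding principal_right_cls[OF wpath_PA] by blast

lemma N1I: "f \<in> PA RQ \<Longrightarrow> rq.cls s (path_mult RQ b1 f) \<in> N1"
  unfolding principal_right_cls[OF wpath_PA] by (rule imageI)

lemma S_eq: "S = {rq.cls s (path_mult RQ b1 f + path_mult RQ b2 g) | f g. f \<in> PA RQ \<and> g \<in> PA RQ}"
proof -
  have "S = {m \<oplus>\<^bsub>R\<^esub> m' | m m'. m \<in> N1 \<and> m' \<in> N2}"
    unfolding S_def set_add_def set_mult_def by auto
  also have "\<dots> = {rq.cls s (path_mult RQ b1 f) \<oplus>\<^bsub>R\<^esub> rq.cls s (path_mult RQ b2 g) | f g. f \<in> PA RQ \<and> g \<in> PA RQ}"
    unfolding principal_right_cls[OF wpath_PA] by blast
  finally show ?thesis unfolding A_add .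
qed

lemma SE: "m \<in> S \<Longrightarrow> (\<And>f g. f \<in> PA RQ \<Longrightarrow> g \<in> PA RQ \<Longrightarrow>
    m = rq.cls s (path_mult RQ b1 f + path_mult RQ b2 g) \<Longrightarrow> thesis) \<Longrightarrow> thesis"
  unfolding S_eq by blast

lemma SI: "f \<in> PA RQ \<Longrightarrow> g \<in> PA RQ \<Longrightarrow> rq.cls s (path_mult RQ b1 f + path_mult RQ b2 g) \<in> S"
  unfolding S_eq by blast

lemma S_submod: "submod R S (reg s)"
proof (rule submod_regI[where F = "{path_mult RQ b1 f + path_mult RQ b2 g | f g. f \<in> PA RQ \<and> g \<in> PA RQ}"])
  let ?F = "{path_mult RQ b1 f + path_mult RQ b2 g | f g. f \<in> PA RQ \<and> g \<in> PA RQ}"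
  have FI: "path_mult RQ b1 f + path_mult RQ b2 g \<in> ?F" if "f \<in> PA RQ" "g \<in> PA RQ" for f g
    using that by blast
  show "?F \<subseteq> PA RQ" by (auto intro!: PA_add PA_mult)
  show "0 \<in> ?F" using FI[of 0 0] by simp
  show "rq.cls s f \<in> S" if "f \<in> ?F" for f using that SI by blast
  show "\<exists>f\<in>?F. m = rq.cls s f" if "m \<in> S" for m using that FI by (elim SE) blast
  fix f assume "f \<in> ?F"
  then obtain h k where f: "f = path_mult RQ b1 h + path_mult RQ b2 k" "h \<in> PA RQ" "k \<in> PA RQ" by blast
  have "- f = path_mult RQ b1 (- h) + path_mult RQ b2 (- k)" by (simp add: f path_mult_minus_right)
  then show "- f \<in> ?F" using FI[OF PA_uminus[OF f(2)] PA_uminus[OF f(3)]] by simp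
  show "path_mult RQ f r \<in> ?F" if r: "r \<in> PA RQ" for r
  proof -
    have "path_mult RQ f r = path_mult RQ b1 (path_mult RQ h r) + path_mult RQ b2 (path_mult RQ k r)"
      by (simp add: f path_mult_add_left path_mult_assoc)
    then show ?thesis using FI[OF PA_mult[OF f(2) r] PA_mult[OF f(3) r]] by simp
  qed
  fix g assume "g \<in> ?F"
  then obtain h' k' where g: "g = path_mult RQ b1 h' + path_mult RQ b2 k'" "h' \<in> PA RQ" "k' \<in> PA RQ" by blast
  have "f + g = path_mult RQ b1 (h + h') + path_mult RQ b2 (k + k')"
    by (simp add: f g path_mult_add_right)
  then show "f + g \<in> ?F" using FI[OF PA_add[OF f(2) g(2)] PA_add[OF f(3) g(3)]] by simp
qed

lemma N1_submod: "submod R N1 (reg s)" and P1_submod: "submod R P1 (reg s)"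
  and Qn_submod: "submod R Qn (reg s)" and Q3_submod: "submod R Q3 (reg s)"
  by (rule principal_submod[OF wpath_PA])+

lemma N1_S: "N1 \<subseteq> S"
proof
  fix m assume "m \<in> N1"
  then obtain f where "f \<in> PA RQ" "m = rq.cls s (path_mult RQ b1 f)" by (rule N1E)
  then show "m \<in> S" using SI[of f 0] by simp
qed

lemma P1_N1: "P1 \<subseteq> N1"
proof
  fix m assume "m \<in> P1"
  then obtain f where f: "f \<in> PA RQ" "m = rq.cls s (path_mult RQ P f)"
    unfolding principal_right_cls[OF wpath_PA] by blast
  have "path_mult RQ P f = path_mult RQ b1 (path_mult RQ (wpath 1 (z + dvec d1) [d2]) f)"
    by (simp add: wpath_mult_assoc)
  then show "m \<in> N1" using N1I[OF PA_mult[OF wpath_PA f(1)]] f(2) by simp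
qed

lemma P1I: "f \<in> right_ideal_mod s P \<Longrightarrow> rq.cls s f \<in> P1"
  unfolding right_ideal_mod_iff[OF wpath_PA] .

lemma left_n: "f \<in> PA RQ \<Longrightarrow> g \<in> PA RQ \<Longrightarrow>
    rq.cls s bn' \<otimes>\<^bsub>R\<^esub> rq.cls s (path_mult RQ b1 f + path_mult RQ b2 g) = rq.cls s (path_mult RQ Rn f)"
proof -
  assume f: "f \<in> PA RQ" and g: "g \<in> PA RQ"
  have "path_mult RQ bn' (path_mult RQ b1 f + path_mult RQ b2 g)
    = path_mult RQ Rn f + path_mult RQ (wpath 1 (z + dvec dn) [opp dn, d2]) g"
  proof -
    have "path_mult RQ bn' (path_mult RQ (wpath 1 z [e]) h) = path_mult RQ (wpath 1 (z + dvec dn) [opp dn, e]) h" for e h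
      using wpath_mult_assoc[of "z + dvec dn" "opp dn" e h] by simp
    then show ?thesis by (simp only: path_mult_add_right)
  qed
  moreover have "path_mult RQ (wpath 1 (z + dvec dn) [opp dn, d2]) g \<in> rauzy_ideal s"
    by (rule rq.I_mult_right[OF cross_ideal(1) g])
  ultimately show ?thesis using f g by (simp add: A_mult PA_add PA_mult rq.cls_eq)
qed

lemma left_3: "f \<in> PA RQ \<Longrightarrow> g \<in> PA RQ \<Longrightarrow>
    rq.cls s b3' \<otimes>\<^bsub>R\<^esub> rq.cls s (path_mult RQ b1 f + path_mult RQ b2 g) = rq.cls s (path_mult RQ R3 g)"
proof -
  assume f: "f \<in> PA RQ" and g: "g \<in> PA RQ"
  have "path_mult RQ b3' (path_mult RQ b1 f + path_mult RQ b2 g)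
    = path_mult RQ (wpath 1 (z + dvec d3) [opp d3, d1]) f + path_mult RQ R3 g"
  proof -
    have "path_mult RQ b3' (path_mult RQ (wpath 1 z [e]) h) = path_mult RQ (wpath 1 (z + dvec d3) [opp d3, e]) h" for e h
      using wpath_mult_assoc[of "z + dvec d3" "opp d3" e h] by simp
    then show ?thesis by (simp only: path_mult_add_right)
  qed
  moreover have "path_mult RQ (wpath 1 (z + dvec d3) [opp d3, d1]) f \<in> rauzy_ideal s"
    by (rule rq.I_mult_right[OF cross_ideal(2) f])
  ultimately show ?thesis using f g by (simp add: A_mult PA_add PA_mult rq.cls_eq)
qed

lemma left_n_N1: "f \<in> PA RQ \<Longrightarrow>
    rq.cls s bn' \<otimes>\<^bsub>R\<^esub> rq.cls s (path_mult RQ b1 f) = rq.cls s (path_mult RQ Rn f)"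
  using left_n[of f 0] by simp

lemma N1_eq: "N1 = (\<lambda>f. rq.cls s (path_mult RQ b1 f)) ` PA RQ"
  and Qn_eq: "Qn = (\<lambda>f. rq.cls s (path_mult RQ Rn f)) ` PA RQ"
  and Q3_eq: "Q3 = (\<lambda>f. rq.cls s (path_mult RQ R3 f)) ` PA RQ"
  by (rule principal_right_cls[OF wpath_PA])+

lemma S_A: "S \<subseteq> carrier R" and N1_A: "N1 \<subseteq> carrier R"
  using S_submod N1_submod unfolding submod_iff[OF reg_abelian_group] by simp_all

lemma P1_left: "m \<in> P1 \<Longrightarrow> rq.cls s bn' \<otimes>\<^bsub>R\<^esub> m = rq.cls s 0" "m \<in> P1 \<Longrightarrow> rq.cls s b3' \<otimes>\<^bsub>R\<^esub> m = rq.cls s 0"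
proof -
  assume "m \<in> P1"
  then obtain f where f: "f \<in> PA RQ" "m = rq.cls s (path_mult RQ P f)"
    unfolding principal_right_cls[OF wpath_PA] by blast
  have "path_mult RQ (path_mult RQ bn' P) f \<in> rauzy_ideal s" "path_mult RQ (path_mult RQ b3' P) f \<in> rauzy_ideal s"
    using cross_ideal(3,4) f(1) by (auto intro: rq.I_mult_right)
  then show "rq.cls s bn' \<otimes>\<^bsub>R\<^esub> m = rq.cls s 0" "rq.cls s b3' \<otimes>\<^bsub>R\<^esub> m = rq.cls s 0"
    unfolding f(2) A_mult[OF wpath_PA PA_mult[OF wpath_PA f(1)]] rq.cls_0 path_mult_assoc by blast+
qed

lemma reg_restrict_rm: "submod R N (reg s) \<Longrightarrow> right_module R (restrict_mod (reg s) N)"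
  by (rule restrict_right_module[OF reg_right_module])

lemma second_iso: "mod_iso R (quot_mod (restrict_mod (reg s) N1) P1) (restrict_mod (reg s) Qn)"
proof (rule quot_iso[OF reg_restrict_rm[OF N1_submod]
      restrict_submod[OF reg_right_module P1_submod N1_submod P1_N1] A_closed
      right_module.axioms(1)[OF reg_restrict_rm[OF Qn_submod]]])
  let ?g = "\<lambda>m. rq.cls s bn' \<otimes>\<^bsub>R\<^esub> m"
  have img: "?g ` N1 = Qn"
    unfolding N1_eq Qn_eq image_image
    by (rule image_cong) (simp_all add: left_n_N1)
  show "?g \<in> mod_hom R (restrict_mod (reg s) N1) (restrict_mod (reg s) Qn)"
    by (rule left_mult_hom[OF wpath_PA N1_A]) (use img in blast)
  show "?g ` carrier (restrict_mod (reg s) N1) = carrier (restrict_mod (reg s) Qn)" using img by simp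
  have "m \<in> P1" if m: "m \<in> N1" "?g m = rq.cls s 0" for m
  proof -
    obtain f where f: "f \<in> PA RQ" "m = rq.cls s (path_mult RQ b1 f)" using m(1) by (rule N1E)
    have "path_mult RQ Rn f \<in> rauzy_ideal s" using m(2) unfolding f(2) left_n_N1[OF f(1)] rq.cls_0 .
    from P1I[OF kernel_n[OF f(1) this]] show ?thesis by (simp add: f(2))
  qed
  then show "P1 = a_kernel (restrict_mod (reg s) N1) (restrict_mod (reg s) Qn) ?g"
    unfolding a_kernel_def kernel_def using P1_N1 P1_left(1) by auto
qed

text \<open>\<open>b3'\<close> annihilates the part coming from \<open>b1\<close>, and if it
  annihilates a multiple of \<open>b2\<close>, this multiple lies in \<open>P1\<close> by
  \<open>kernel_3\<close>, hence in \<open>N1\<close>. So the kernel on all of \<open>S\<close> is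
  \<open>N1\<close>.\<close>

lemma third_iso: "mod_iso R (quot_mod (restrict_mod (reg s) S) N1) (restrict_mod (reg s) Q3)"
proof (rule quot_iso[OF reg_restrict_rm[OF S_submod]
      restrict_submod[OF reg_right_module N1_submod S_submod N1_S] A_closed
      right_module.axioms(1)[OF reg_restrict_rm[OF Q3_submod]]])
  let ?g = "\<lambda>m. rq.cls s b3' \<otimes>\<^bsub>R\<^esub> m"
  have mem: "?g m \<in> Q3" if "m \<in> S" for m
    using that by (rule SE) (simp add: left_3 Q3_eq)
  have img: "Q3 \<subseteq> ?g ` S"
  proof
    fix m assume "m \<in> Q3"
    then obtain f where f: "f \<in> PA RQ" "m = rq.cls s (path_mult RQ R3 f)" unfolding Q3_eq by blast
    have "?g (rq.cls s (path_mult RQ b1 0 + path_mult RQ b2 f)) = m" using left_3[of 0 f] f by simp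
    then show "m \<in> ?g ` S" using SI[of 0 f] f(1) by (metis PA_zero image_eqI)
  qed
  show "?g \<in> mod_hom R (restrict_mod (reg s) S) (restrict_mod (reg s) Q3)"
    by (rule left_mult_hom[OF wpath_PA S_A mem])
  show "?g ` carrier (restrict_mod (reg s) S) = carrier (restrict_mod (reg s) Q3)" using img mem by auto
  have ker: "m \<in> N1" if m: "m \<in> S" "?g m = rq.cls s 0" for m
  proof -
    obtain f g where fg: "f \<in> PA RQ" "g \<in> PA RQ" "m = rq.cls s (path_mult RQ b1 f + path_mult RQ b2 g)"
      using m(1) by (rule SE)
    have "path_mult RQ R3 g \<in> rauzy_ideal s" using m(2) unfolding fg(3) left_3[OF fg(1,2)] rq.cls_0 .
    from P1I[OF kernel_3[OF fg(2) this]] have "rq.cls s (path_mult RQ b2 g) \<in> N1" using P1_N1 by blast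
    moreover have "rq.cls s (path_mult RQ b1 f) \<in> N1" by (rule N1I[OF fg(1)])
    ultimately have "rq.cls s (path_mult RQ b1 f) \<oplus>\<^bsub>reg s\<^esub> rq.cls s (path_mult RQ b2 g) \<in> N1"
      using N1_submod unfolding submod_iff[OF reg_abelian_group] by blast
    then show ?thesis by (simp add: A_add fg(3))
  qed
  have "?g m = rq.cls s 0" if m: "m \<in> N1" for m
  proof -
    obtain f where "f \<in> PA RQ" "m = rq.cls s (path_mult RQ b1 f)" using m by (rule N1E)
    then show ?thesis using left_3[of f 0] by simp
  qed
  then show "N1 = a_kernel (restrict_mod (reg s) S) (restrict_mod (reg s) Q3) ?g"
    unfolding a_kernel_def kernel_def using ker N1_S by auto
qed

lemma filtration: "has_rhombus_filtration s (restrict_mod (reg s) S) 3"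
proof -
  let ?M = "restrict_mod (reg s) S"
  have M: "right_module R ?M" by (rule reg_restrict_rm[OF S_submod])
  \<comment> \<open>The layers are \<open>P1\<close> itself, the quotient of \<open>N1\<close> by
    \<open>P1\<close>, which is a copy of \<open>Qn\<close>, and the quotient of \<open>S\<close> by
    \<open>N1\<close>, which is a copy of \<open>Q3\<close>.\<close>
  define F where "F j = (if j = 0 then {rq.cls s 0} else if j = 1 then P1 else if j = 2 then N1 else S)" for j :: nat
  have sub: "submod R (F j) ?M" for j
  proof -
    have "submod R {rq.cls s 0} ?M" using zero_submod[OF M] by simp
    moreover have "submod R P1 ?M"
      using P1_N1 N1_S by (intro restrict_submod[OF reg_right_module P1_submod S_submod]) blast
    moreover have "submod R N1 ?M" by (rule restrict_submod[OF reg_right_module N1_submod S_submod N1_S])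
    moreover have "submod R S ?M" by (rule restrict_submod[OF reg_right_module S_submod S_submod]) simp
    ultimately show ?thesis by (simp add: F_def)
  qed
  have "rhombus_module s (quot_mod (restrict_mod (reg s) P1) {rq.cls s 0})"
  proof -
    have rm: "right_module R (restrict_mod (reg s) P1)" by (rule reg_restrict_rm[OF P1_submod])
    obtain cy cu cv cz where "rhombus_coords s (restrict_mod (reg s) P1) z d1 d2 cy cu cv cz"
      using principal_coords[OF s z sq(2)] unfolding principal_mod_def by blast
    from rhombus_module_iso[OF this quot_right_module[OF rm zero_submod[OF rm] A_closed] quot_zero_iso[OF rm]]
    show ?thesis by simp
  qed
  moreover have "rhombus_module s (quot_mod (restrict_mod (reg s) N1) P1)"
  proof -
    obtain cy cu cv cz where "rhombus_coords s (restrict_mod (reg s) Qn) (z + dvec dn) (opp dn) d1 cy cu cv cz"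
      using principal_coords[OF s valid_stepD(2)[OF steps(4)] square_n(1)] unfolding principal_mod_def by blast
    from rhombus_module_iso[OF this quot_right_module[OF reg_restrict_rm[OF N1_submod]
        restrict_submod[OF reg_right_module P1_submod N1_submod P1_N1] A_closed] second_iso]
    show ?thesis .
  qed
  moreover have "rhombus_module s (quot_mod (restrict_mod (reg s) S) N1)"
  proof -
    obtain cy cu cv cz where "rhombus_coords s (restrict_mod (reg s) Q3) (z + dvec d3) (opp d3) d2 cy cu cv cz"
      using principal_coords[OF s valid_stepD(2)[OF steps(3)] square_n(2)] unfolding principal_mod_def by blast
    from rhombus_module_iso[OF this quot_right_module[OF reg_restrict_rm[OF S_submod]
        restrict_submod[OF reg_right_module N1_submod S_submod N1_S] A_closed] third_iso]
    show ?thesis .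
  qed
  ultimately have q: "rhombus_module s (quot_mod (restrict_mod ?M (F (Suc j))) (F j))" if "j < 3" for j
    using that by (auto simp: F_def less_Suc_eq numeral_3_eq_3)
  have "rq.cls s 0 \<in> P1" using P1_submod unfolding submod_iff[OF reg_abelian_group] by simp
  then have inc: "F j \<subseteq> F (Suc j)" if "j < 3" for j
    using that P1_N1 N1_S by (auto simp: F_def less_Suc_eq numeral_3_eq_3)
  have "F 0 = {\<zero>\<^bsub>?M\<^esub>}" "F 3 = carrier ?M" by (simp_all add: F_def)
  then show ?thesis unfolding has_rhombus_filtration_def using sub q inc by blast
qed

text \<open>\<open>bn'\<close> sees only the part coming from \<open>b1\<close>, and
  \<open>b3'\<close> only the part coming from \<open>b2\<close>. The two components can therefore
  be prescribed independently, and the kernel condition splits into \<open>kernel_n\<close> and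
  \<open>kernel_3\<close>.\<close>

lemma exact: "short_exact R (restrict_mod (reg s) P1) (restrict_mod (reg s) S)
  (direct_sum (restrict_mod (reg s) Qn) (restrict_mod (reg s) Q3)) (\<lambda>m. m)
  (\<lambda>m. (rq.cls s bn' \<otimes>\<^bsub>R\<^esub> m, rq.cls s b3' \<otimes>\<^bsub>R\<^esub> m))"
proof -
  let ?g = "\<lambda>m. (rq.cls s bn' \<otimes>\<^bsub>R\<^esub> m, rq.cls s b3' \<otimes>\<^bsub>R\<^esub> m)"
  have P1_S: "P1 \<subseteq> S" using P1_N1 N1_S by blast
  have gS: "?g (rq.cls s (path_mult RQ b1 f + path_mult RQ b2 h))
      = (rq.cls s (path_mult RQ Rn f), rq.cls s (path_mult RQ R3 h))" if "f \<in> PA RQ" "h \<in> PA RQ" for f h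
    using left_n[OF that] left_3[OF that] by simp
  have mem: "rq.cls s bn' \<otimes>\<^bsub>R\<^esub> m \<in> Qn" "rq.cls s b3' \<otimes>\<^bsub>R\<^esub> m \<in> Q3" if m: "m \<in> S" for m
    using m by (rule SE, simp add: left_n left_3 Qn_eq Q3_eq)+
  have "(\<lambda>m. m) \<in> mod_hom R (restrict_mod (reg s) P1) (restrict_mod (reg s) S)"
    unfolding mod_hom_def hom_def using P1_S by auto
  moreover have "?g \<in> mod_hom R (restrict_mod (reg s) S) (direct_sum (restrict_mod (reg s) Qn) (restrict_mod (reg s) Q3))"
    using left_mult_hom[OF wpath_PA S_A mem(1)] left_mult_hom[OF wpath_PA S_A mem(2)] mem
    unfolding mod_hom_def hom_def by simp
  moreover have "P1 = a_kernel (restrict_mod (reg s) S) (direct_sum (restrict_mod (reg s) Qn) (restrict_mod (reg s) Q3)) ?g"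
  proof -
    have "m \<in> P1" if m: "m \<in> S" "rq.cls s bn' \<otimes>\<^bsub>R\<^esub> m = rq.cls s 0" "rq.cls s b3' \<otimes>\<^bsub>R\<^esub> m = rq.cls s 0" for m
    proof -
      obtain f g where fg: "f \<in> PA RQ" "g \<in> PA RQ" "m = rq.cls s (path_mult RQ b1 f + path_mult RQ b2 g)"
        using m(1) by (rule SE)
      have "path_mult RQ Rn f \<in> rauzy_ideal s" using m(2) unfolding fg(3) left_n[OF fg(1,2)] rq.cls_0 .
      moreover have "path_mult RQ R3 g \<in> rauzy_ideal s" using m(3) unfolding fg(3) left_3[OF fg(1,2)] rq.cls_0 .
      ultimately show ?thesis unfolding fg(3)
        by (intro P1I right_ideal_mod_add kernel_n[OF fg(1)] kernel_3[OF fg(2)])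
    qed
    then show ?thesis unfolding a_kernel_def kernel_def using P1_S P1_left by auto
  qed
  moreover have "?g ` S = Qn \<times> Q3"
  proof (intro equalityI subsetI)
    fix x assume "x \<in> ?g ` S"
    then show "x \<in> Qn \<times> Q3" using mem by auto
  next
    fix x assume "x \<in> Qn \<times> Q3"
    then obtain f h where x: "x = (rq.cls s (path_mult RQ Rn f), rq.cls s (path_mult RQ R3 h))"
      "f \<in> PA RQ" "h \<in> PA RQ" unfolding Qn_eq Q3_eq by blast
    then show "x \<in> ?g ` S" using gS[OF x(2,3)] SI[OF x(2,3)] by (metis (no_types, lifting) image_eqI)
  qed
  ultimately show ?thesis unfolding short_exact_def by simp
qed

end

theorem lemma3:
  fixes s :: "3 \<Rightarrow> point \<Rightarrow> 'k::field"
    and n :: nat and z :: point and x y :: "nat \<Rightarrow> point"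
  assumes "sign_choice s"
    and "n_vertex n z" and "n \<ge> 4"
    and "local_labels n z x y"
  defines "A \<equiv> rauzy_algebra s"
    and "b \<equiv> \<lambda>j. arrow s z (x j)"
    and "b' \<equiv> \<lambda>j. arrow s (x j) z"
    and "d \<equiv> \<lambda>j. arrow s (x j) (y j)"
  defines "M \<equiv> restrict_mod (regular_mod A) (principal_right A (b 1) <+>\<^bsub>A\<^esub> principal_right A (b 2))"
  shows "has_rhombus_filtration s M 3 \<and>
         (\<exists>g. short_exact A (principal_mod A (b 1 \<otimes>\<^bsub>A\<^esub> d 1)) M
           (direct_sum (principal_mod A (b' n \<otimes>\<^bsub>A\<^esub> b 1)) (principal_mod A (b' 3 \<otimes>\<^bsub>A\<^esub> b 2)))
           (\<lambda>m. m) g)"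
proof -
  have inj: "inj_on x {1..n}" and rh: "rhombus z (x j) (y j) (x (j + 1))" and per: "x (j + n) = x j" for j
    using assms(4) unfolding local_labels_def bij_betw_def by blast+
  have rh': "\<exists>d e. z \<in> rauzy_vertices \<and> square (ht z) d e \<and> x j = z + dvec d \<and> x (j + 1) = z + dvec e
    \<and> y j = z + dvec d + dvec e" for j
    using rh[of j] unfolding rhombus_iff by blast
  \<comment> \<open>The rhombus with index \<open>n\<close> closes the cycle: it contains the edges
    to \<open>x n\<close> and to \<open>x 1\<close>.\<close>
  have xn: "x (n + 1) = x 1" using per[of 1] by (simp add: add.commute)
  obtain dn d1 where 1: "z \<in> rauzy_vertices" "square (ht z) dn d1" "x n = z + dvec dn" "x 1 = z + dvec d1"
    using rh'[of n] xn by auto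
  obtain d1' d2 where 2: "square (ht z) d1' d2" "x 1 = z + dvec d1'" "x 2 = z + dvec d2" "y 1 = z + dvec d1' + dvec d2"
    using rh'[of 1] by (auto simp: numeral_2_eq_2)
  obtain d2' d3 where 3: "square (ht z) d2' d3" "x 2 = z + dvec d2'" "x 3 = z + dvec d3"
    using rh'[of 2] by auto
  have eq: "d1' = d1" "d2' = d2" using 1(4) 2(2,3) 3(2) by (auto simp: dvec_inj)
  \<comment> \<open>The labels are injective on one period; for \<open>n = 3\<close> the points
    \<open>x n\<close> and \<open>x 3\<close> would coincide.\<close>
  have "x n \<noteq> x 2" "x 1 \<noteq> x 3" "x n \<noteq> x 3"
    using inj_onD[OF inj, of n 2] inj_onD[OF inj, of 1 3] inj_onD[OF inj, of n 3] assms(3) by auto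
  then have ne: "dn \<noteq> d2" "d1 \<noteq> d3" "dn \<noteq> d3" using 1 2 3 by auto
  interpret four_edges s z d1 d2 d3 dn
    using assms(1) 1(1,2) 2(1) 3(1) ne unfolding eq by unfold_locales
  have v: "valid z [d1, d2]" using square_valid[OF sq(2) z] .
  have returns: "valid_step (z + dvec dn) (opp dn)" "valid_step (z + dvec d3) (opp d3)"
    using valid_back[OF steps(4)] valid_back[OF steps(3)] unfolding valid_2 by auto
  have b: "b 1 = rq.cls s b1" "b 2 = rq.cls s b2"
    unfolding b_def 1(4) 2(3) using wpath_arrow steps by blast+
  have b_back: "b' n = rq.cls s bn'" "b' 3 = rq.cls s b3'"
    using wpath_arrow[OF returns(1), of s] wpath_arrow[OF returns(2), of s] unfolding b'_def 1(3) 3(3) by simp_all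
  have d: "d 1 = rq.cls s (wpath 1 (z + dvec d1) [d2])"
    using wpath_arrow[of "z + dvec d1" d2 s] v unfolding d_def 1(4) 2(4) eq valid_2 by simp
  have prods: "b 1 \<otimes>\<^bsub>A\<^esub> d 1 = rq.cls s P" "b' n \<otimes>\<^bsub>A\<^esub> b 1 = rq.cls s Rn" "b' 3 \<otimes>\<^bsub>A\<^esub> b 2 = rq.cls s R3"
    unfolding A_def b b_back d by (simp_all add: A_mult wpath_mult)
  have M: "M = restrict_mod (reg s) S"
    unfolding M_def S_def A_def b ..
  show ?thesis
    unfolding prods M principal_mod_def unfolding A_def using filtration exact by blast
qed

end
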